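(* Let $n\ge 2$. Assume $p>1$ and $b,c,q,r\in\mathbb{R}$ satisfy $bc\ge0$ and $(b,c,q,r)\in W_1\cup W_2\cup W_3\cup W_4$ (sets defined in the context). Then there is a constant $C(n,p,q,r)$ depending only on $n,p,q,r$ with the following property. Let $\Omega\subset\mathbb{R}^n$ be a domain containing $0$ and let $R>0$ be such that $d(0,\partial\Omega)\ge 2R$. Then any positive solution $v\in C^2(\Omega\setminus\{0\})$ of $$\Delta_p v+b|\nabla v|^q+cv^r=0\quad\text{in }\Omega\setminus\{0\}$$ satisfies $$v(x)\le \sup_{|y|=R}v(y)\cdot\left(\frac{R}{|x|}\right)^{C(n,p,q,r)},\qquad\forall x\in B_R\setminus\{0\}.$$
   Context: $\Delta_p v=\operatorname{div}(|\nabla v|^{p-2}\nabla v)$; solutions are understood in the weak sense: $-\int|\nabla v|^{p-2}\langle\nabla v,\nabla\psi\rangle+b\int|\nabla v|^q\psi+c\int v^r\psi=0$ for all $\psi\in C_0^\infty(\Omega\setminus\{0\})$. $B_R$ is the Euclidean ball of radius $R$ centered at $0$. The regions are \begin{align*} W_1&=\left\{(b,c,q,r): b\left(\tfrac{n+1}{n-1}-\tfrac{q}{p-1}\right)\ge 0 \ \text{and}\ c\left(\tfrac{n+1}{n-1}-\tfrac{r}{p-1}\right)\ge 0\right\},\\ W_2&=\left\{(b,c,q,r): b\left(\tfrac{n+1}{n-1}-\tfrac{q}{p-1}\right)\ge 0 \ \text{and}\ \left|\tfrac{n+1}{n-1}-\tfrac{r}{p-1}\right|<\tfrac{2}{n-1}\right\},\\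 W_3&=\left\{(b,c,q,r): \left|\tfrac{n+1}{n-1}-\tfrac{q}{p-1}\right|<\tfrac{2}{n-1} \ \text{and}\ c\left(\tfrac{n+1}{n-1}-\tfrac{r}{p-1}\right)\ge 0\right\},\\ W_4&=\left\{(b,c,q,r): \left(\tfrac{n+1}{n-1}-\tfrac{q}{p-1}\right)^2+\left(\tfrac{n+1}{n-1}-\tfrac{r}{p-1}\right)^2<\tfrac{4}{(n-1)^2}\right\}. \end{align*} *)

theory Defs
  imports "HOL-Analysis.Analysis"
begin

text \<open>\<open>C_on k S f\<close>: \<open>f\<close> is of class \<open>C\<^sup>k\<close> on \<open>S\<close>. Only meant for open \<open>S\<close>, since the derivatives
  are taken at interior points.\<close>

fun C_on :: "nat \<Rightarrow> (real ^ 'n) set \<Rightarrow> (real ^ 'n \<Rightarrow> real) \<Rightarrow> bool" where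
  "C_on 0 S f \<longleftrightarrow> continuous_on S f"
| "C_on (Suc k) S f \<longleftrightarrow> f differentiable_on S \<and>
     (\<forall>i. C_on k S (\<lambda>x. frechet_derivative f (at x) (axis i 1)))"

definition grad :: "(real ^ 'n \<Rightarrow> real) \<Rightarrow> real ^ 'n \<Rightarrow> real ^ 'n" where
  "grad f x = (\<chi> i. frechet_derivative f (at x) (axis i 1))"

text \<open>\<open>C\<^sub>0\<^sup>\<infinity>(U)\<close>, each function being extended by zero to the whole space.\<close>

definition test_functions :: "(real ^ 'n) set \<Rightarrow> (real ^ 'n \<Rightarrow> real) set" where
  "test_functions U = {\<psi>. (\<forall>k. C_on k UNIV \<psi>) \<and>
     compact (closure {x. \<psi> x \<noteq> 0}) \<and> closure {x. \<psi> x \<noteq> 0} \<subseteq> U}"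

text \<open>\<open>t\<^sup>s\<close> for \<open>t \<ge> 0\<close> with \<open>0\<^sup>0 = 1\<close>, whereas \<open>0 powr 0 = 0\<close>. For \<open>s < 0\<close> the value at \<open>t = 0\<close>
  should be \<open>\<infinity>\<close> but is \<open>0\<close> here.\<close>

definition rpow :: "real \<Rightarrow> real \<Rightarrow> real" where
  "rpow t s = (if s = 0 then 1 else t powr s)"

text \<open>Weak solutions of \<open>\<Delta>\<^sub>p v + b |\<nabla>v|\<^sup>q + c v\<^sup>r = 0\<close> in an open set \<open>U\<close>, for \<open>p > 1\<close> and positive \<open>v\<close> of
  class \<open>C\<^sup>2\<close>. The field \<open>|\<nabla>v|\<^sup>p\<^sup>-\<^sup>2 \<nabla>v\<close> is \<open>0\<close> at critical points, which is its continuous extension.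
  The first and third integrands are continuous with compact support, hence integrable; the second
  one need not be if \<open>q < 0\<close>. It is infinite at critical points in that case, so these must form a
  null set where the term is present. For \<open>b = 0\<close> the gradient term is absent and nothing is required.\<close>

definition weak_solution ::
  "real \<Rightarrow> real \<Rightarrow> real \<Rightarrow> real \<Rightarrow> real \<Rightarrow> (real ^ 'n) set \<Rightarrow> (real ^ 'n \<Rightarrow> real) \<Rightarrow> bool" where
  "weak_solution p b c q r U v \<longleftrightarrow>
     (b \<noteq> 0 \<and> q < 0 \<longrightarrow> (AE x in lborel. x \<in> U \<longrightarrow> grad v x \<noteq> 0)) \<and>
     (\<forall>\<psi> \<in> test_functions U.
        (b \<noteq> 0 \<longrightarrow> set_integrable lborel U (\<lambda>x. rpow (norm (grad v x)) q * \<psi> x)) \<and>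
        - (LINT x:U|lborel. (norm (grad v x) powr (p - 2) *\<^sub>R grad v x) \<bullet> grad \<psi> x)
        + b * (LINT x:U|lborel. rpow (norm (grad v x)) q * \<psi> x)
        + c * (LINT x:U|lborel. v x powr r * \<psi> x) = 0)"

definition W1 :: "nat \<Rightarrow> real \<Rightarrow> (real \<times> real \<times> real \<times> real) set" where
  "W1 n p = {(b, c, q, r).
     b * ((real n + 1) / (real n - 1) - q / (p - 1)) \<ge> 0 \<and>
     c * ((real n + 1) / (real n - 1) - r / (p - 1)) \<ge> 0}"

definition W2 :: "nat \<Rightarrow> real \<Rightarrow> (real \<times> real \<times> real \<times> real) set" where
  "W2 n p = {(b, c, q, r).
     b * ((real n + 1) / (real n - 1) - q / (p - 1)) \<ge> 0 \<and>
     \<bar>(real n + 1) / (real n - 1) - r / (p - 1)\<bar> < 2 / (real n - 1)}"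

definition W3 :: "nat \<Rightarrow> real \<Rightarrow> (real \<times> real \<times> real \<times> real) set" where
  "W3 n p = {(b, c, q, r).
     \<bar>(real n + 1) / (real n - 1) - q / (p - 1)\<bar> < 2 / (real n - 1) \<and>
     c * ((real n + 1) / (real n - 1) - r / (p - 1)) \<ge> 0}"

definition W4 :: "nat \<Rightarrow> real \<Rightarrow> (real \<times> real \<times> real \<times> real) set" where
  "W4 n p = {(b, c, q, r).
     ((real n + 1) / (real n - 1) - q / (p - 1))\<^sup>2 + ((real n + 1) / (real n - 1) - r / (p - 1))\<^sup>2
       < 4 / (real n - 1)\<^sup>2}"

end

theory Submission
  imports Defs
begin

text \<open>Bernstein's method for \<open>u = ln v\<close>. Where \<open>\<nabla>v \<noteq> 0\<close>, the weak equation holds pointwise, and with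
  \<open>U = \<nabla>u\<close>, \<open>f = |U|\<^sup>2\<close> and \<open>e = U / |U|\<close> it reads
  \<open>tr ((I + (p - 2) e e\<^sup>T) D\<^sup>2u) = - (p - 1) f (1 + X + Y)\<close>, where \<open>X\<close> and \<open>Y\<close> carry the signs of \<open>b\<close> and \<open>c\<close>.
  At a maximum point of \<open>E\<^sup>2 f\<close>, \<open>E = \<rho>\<^sup>2 - |x - x0|\<^sup>2\<close>, Bochner's formula bounds \<open>f\<close> by a multiple of
  \<open>\<rho>\<^sup>2 / E\<^sup>2\<close> as soon as
  \<open>(1 + (X + Y)\<^sup>2) / (n - 1) + \<alpha> X + \<beta> Y \<ge> \<delta> (1 + X\<^sup>2 + Y\<^sup>2)\<close> with
  \<open>\<alpha> = (n + 1) / (n - 1) - q / (p - 1)\<close> and \<open>\<beta> = (n + 1) / (n - 1) - r / (p - 1)\<close>; the four regions are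
  four ways to guarantee this for all \<open>X Y \<ge> 0\<close>. The resulting bound \<open>|\<nabla> ln v| \<le> C / |x|\<close> is integrated
  along rays. Since \<open>v\<close> is only \<open>C\<^sup>2\<close>, Bochner's formula is replaced by second-order conditions for
  difference quotients of \<open>u\<close>.\<close>

section \<open>Functions of class \<open>C\<^sup>2\<close>\<close>

text \<open>The exponent must not depend on \<open>b\<close> and \<open>c\<close>. At the maximum
  point the signs of \<open>X\<close> and \<open>Y\<close> are known but not their sizes, so the
  quadratic inequality has to hold on a whole quadrant, with a gap \<delta> determined by
  \<open>n, p, q, r\<close>. The assumption \<open>b * c \<ge> 0\<close> enters as
  \<open>X * Y \<ge> 0\<close>, which keeps \<open>(X + Y)^2\<close> above \<open>X^2 + Y^2\<close>.
  The number (n + 1) / (n - 1) is 1 + 2 / (n - 1). The part 2 / (n - 1) is the cross term of (1 + X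
  + Y)^2 / (n - 1), which bounds the squared Hessian from below; the part 1 - q / (p - 1) is minus
  the exponent q - p + 1 of \<open>v\<close> in the equation for \<open>u\<close>, divided by p - 1,
  and likewise for \<open>r\<close>. Critical points of \<open>v\<close>, where the operator
  degenerates or is singular, do no harm: if the centre \<open>x0\<close> is not critical, the
  maximum of \<open>E^2 f\<close> is positive, so it is attained off the critical set, and near it
  the equation has smooth coefficients. The third-derivative terms of Bochner's formula enter only
  through the derivative of the equation along \<open>U\<close>. A difference quotient in which the
  Hessian is frozen at one end captures exactly this.\<close>

definition C2_data ::
  "(real ^ 'n) set \<Rightarrow> (real ^ 'n \<Rightarrow> real) \<Rightarrow> (real ^ 'n \<Rightarrow> real ^ 'n) \<Rightarrow> (real ^ 'n \<Rightarrow> real ^ 'n ^ 'n) \<Rightarrow> bool"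
  where "C2_data S u U L \<longleftrightarrow> open S \<and>
    (\<forall>x\<in>S. (u has_derivative (\<lambda>h. U x \<bullet> h)) (at x) \<and> (U has_derivative (\<lambda>h. L x *v h)) (at x)) \<and>
    continuous_on S L"

lemma C2_dataD:
  assumes "C2_data S u U L"
  shows "open S" "continuous_on S L" "continuous_on S U" "continuous_on S u"
    "x \<in> S \<Longrightarrow> (u has_derivative (\<lambda>h. U x \<bullet> h)) (at x)"
    "x \<in> S \<Longrightarrow> (U has_derivative (\<lambda>h. L x *v h)) (at x)"
proof -
  show "open S" "continuous_on S L"
    "x \<in> S \<Longrightarrow> (u has_derivative (\<lambda>h. U x \<bullet> h)) (at x)"
    "x \<in> S \<Longrightarrow> (U has_derivative (\<lambda>h. L x *v h)) (at x)"
    using assms by (auto simp: C2_data_def)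
  show "continuous_on S U"
    using assms unfolding C2_data_def
    by (intro has_derivative_continuous_on[where f'="\<lambda>x h. L x *v h"]) (auto intro: has_derivative_at_withinI)
  show "continuous_on S u"
    using assms unfolding C2_data_def
    by (intro has_derivative_continuous_on[where f'="\<lambda>x h. U x \<bullet> h"]) (auto intro: has_derivative_at_withinI)
qed

lemma C2_data_subset: "C2_data S u U L \<Longrightarrow> T \<subseteq> S \<Longrightarrow> open T \<Longrightarrow> C2_data T u U L"
  unfolding C2_data_def by (auto intro: continuous_on_subset)

section \<open>Calculus along lines and symmetry of the Hessian\<close>

lemma tendsto_matrix_vector_mult:
  fixes A :: "'b \<Rightarrow> real ^ 'n ^ 'm"
  assumes "(A \<longlongrightarrow> a) F" "(x \<longlongrightarrow> y) F"
  shows "((\<lambda>t. A t *v x t) \<longlongrightarrow> a *v y) F"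
  unfolding matrix_vector_mult_def
  by (intro tendsto_vec_lambda tendsto_sum tendsto_mult tendsto_vec_nth assms)

lemma continuous_on_matrix_vector_mult:
  fixes A :: "'b::topological_space \<Rightarrow> real ^ 'n ^ 'm"
  assumes "continuous_on S A" "continuous_on S x"
  shows "continuous_on S (\<lambda>t. A t *v x t)"
  using assms unfolding continuous_on_def by (auto intro: tendsto_matrix_vector_mult)

lemma outer_product_mult_vec:
  fixes w h :: "real ^ 'n"
  shows "(\<chi> i j. w $ i * w $ j) *v h = (w \<bullet> h) *\<^sub>R w"
  by (simp add: vec_eq_iff matrix_vector_mult_def inner_vec_def sum_distrib_left sum_distrib_right
      mult.commute mult.left_commute)

lemma has_derivative_along_line:
  fixes f :: "'a::real_normed_vector \<Rightarrow> 'b::real_normed_vector"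
  assumes "(f has_derivative f') (at (x + s *\<^sub>R a))"
  shows "((\<lambda>t. f (x + t *\<^sub>R a)) has_vector_derivative f' a) (at s)"
proof -
  have 1: "((\<lambda>t. x + t *\<^sub>R a) has_derivative (\<lambda>t. t *\<^sub>R a)) (at s)"
    by (auto intro!: derivative_eq_intros)
  have "((\<lambda>t. f (x + t *\<^sub>R a)) has_derivative (\<lambda>t. f' (t *\<^sub>R a))) (at s)"
    using has_derivative_compose[OF 1 assms] .
  moreover have "linear f'" using assms has_derivative_linear by blast
  ultimately show ?thesis
    unfolding has_vector_derivative_def by (simp add: linear_cmul)
qed

text \<open>The mean value theorem is used twice: the difference of \<open>u\<close> along
  \<open>b\<close> is differentiated in direction \<open>a\<close>, and the result is a difference
  of \<open>U \<bullet> a\<close> along \<open>b\<close>. The second difference itself is symmetric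
  in \<open>a\<close> and \<open>b\<close>.\<close>

lemma mixed_difference_mvt:
  fixes a b :: "real ^ 'n"
  assumes C2: "C2_data S u U L" and sub: "ball x r \<subseteq> S" and t: "t > 0" "t * (norm a + norm b) < r"
  shows "\<exists>y\<in>ball x r. u (x + t *\<^sub>R a + t *\<^sub>R b) - u (x + t *\<^sub>R a) - u (x + t *\<^sub>R b) + u x
           = t\<^sup>2 * (a \<bullet> (L y *v b))"
proof -
  have inb: "x + s *\<^sub>R a + s' *\<^sub>R b \<in> ball x r" if "0 \<le> s" "s \<le> t" "0 \<le> s'" "s' \<le> t" for s s'
  proof -
    have "norm (s *\<^sub>R a + s' *\<^sub>R b) \<le> s * norm a + s' * norm b"
      using norm_triangle_ineq[of "s *\<^sub>R a" "s' *\<^sub>R b"] that by simp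
    also have "\<dots> \<le> t * norm a + t * norm b"
      using that by (intro add_mono mult_right_mono) auto
    also have "\<dots> < r" using t by (simp add: algebra_simps)
    finally show ?thesis by (simp add: dist_norm norm_minus_commute algebra_simps)
  qed
  define g where "g s = u (x + t *\<^sub>R b + s *\<^sub>R a) - u (x + s *\<^sub>R a)" for s
  have "(g has_real_derivative (U (x + t *\<^sub>R b + s *\<^sub>R a) \<bullet> a - U (x + s *\<^sub>R a) \<bullet> a)) (at s)"
    if "0 \<le> s" "s \<le> t" for s
  proof -
    have "x + t *\<^sub>R b + s *\<^sub>R a \<in> S" "x + s *\<^sub>R a \<in> S"
      using inb[OF that, of t] inb[OF that, of 0] t sub by (auto simp: algebra_simps)
    then show ?thesis unfolding g_def has_real_derivative_iff_has_vector_derivative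
      by (intro has_vector_derivative_diff has_derivative_along_line C2_dataD(5)[OF C2])
  qed
  from MVT2[OF t(1) this] obtain s where s: "0 < s" "s < t"
    "g t - g 0 = t * (U (x + t *\<^sub>R b + s *\<^sub>R a) \<bullet> a - U (x + s *\<^sub>R a) \<bullet> a)" by force
  have "((\<lambda>s'. U (x + s *\<^sub>R a + s' *\<^sub>R b) \<bullet> a) has_real_derivative
          ((L (x + s *\<^sub>R a + s' *\<^sub>R b) *v b) \<bullet> a)) (at s')"
    if "0 \<le> s'" "s' \<le> t" for s'
  proof -
    have "x + s *\<^sub>R a + s' *\<^sub>R b \<in> S"
      using inb[of s s'] that s sub by auto
    then have "((\<lambda>s'. U (x + s *\<^sub>R a + s' *\<^sub>R b)) has_vector_derivative
          (L (x + s *\<^sub>R a + s' *\<^sub>R b) *v b)) (at s')"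
      by (intro has_derivative_along_line C2_dataD(6)[OF C2])
    then show ?thesis unfolding has_real_derivative_iff_has_vector_derivative
      by (rule bounded_linear.has_vector_derivative[OF bounded_linear_inner_left])
  qed
  from MVT2[OF t(1) this] obtain s' where s': "0 < s'" "s' < t"
    "U (x + s *\<^sub>R a + t *\<^sub>R b) \<bullet> a - U (x + s *\<^sub>R a + 0 *\<^sub>R b) \<bullet> a
       = t * ((L (x + s *\<^sub>R a + s' *\<^sub>R b) *v b) \<bullet> a)" by force
  have "u (x + t *\<^sub>R a + t *\<^sub>R b) - u (x + t *\<^sub>R a) - u (x + t *\<^sub>R b) + u x = g t - g 0"
    unfolding g_def by (simp add: algebra_simps)
  also have "\<dots> = t\<^sup>2 * (a \<bullet> (L (x + s *\<^sub>R a + s' *\<^sub>R b) *v b))"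
    using s(3) s'(3) by (simp add: algebra_simps power2_eq_square inner_commute)
  finally show ?thesis using inb[of s s'] s s' by auto
qed

text \<open>Schwarz's theorem: in every ball around \<open>x\<close> the same second difference is
  expressed by \<open>L\<close> at two points, once with \<open>a, b\<close> and once with
  \<open>b, a\<close>. Shrinking the balls moves both points to \<open>x\<close>, where
  \<open>L\<close> is continuous.\<close>

lemma C2_data_symmetric:
  assumes C2: "C2_data S u U L" and x: "x \<in> S"
  shows "a \<bullet> (L x *v b) = b \<bullet> (L x *v a)"
proof -
  obtain r0 where r0: "r0 > 0" "ball x r0 \<subseteq> S"
    using C2_dataD(1)[OF C2] x openE by blast
  have "\<exists>y1 y2. y1 \<in> ball x (r0 / real (Suc n)) \<and> y2 \<in> ball x (r0 / real (Suc n)) \<and>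
      a \<bullet> (L y1 *v b) = b \<bullet> (L y2 *v a)" for n
  proof -
    define r where "r = r0 / real (Suc n)"
    have r: "r > 0" "ball x r \<subseteq> S"
      using r0 by (auto simp: r_def field_simps) (smt (verit) mult_nonneg_nonneg of_nat_0_le_iff subsetD mem_ball)
    \<comment> \<open>The parallelogram then has diameter bound \<open>r / 2\<close>; the summand 1
      covers \<open>a = b = 0\<close>.\<close>
    define t where "t = r / (2 * (norm a + norm b + 1))"
    have pos: "norm a + norm b + 1 > 0" by (smt (verit) norm_ge_zero)
    have t: "t > 0" using r pos by (simp add: t_def)
    have "t * (norm a + norm b) \<le> t * (norm a + norm b + 1)" using t by simp
    also have "\<dots> = r / 2" using pos by (simp add: t_def field_simps)
    finally have t2: "t * (norm a + norm b) < r" using r by simp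
    obtain y1 where y1: "y1 \<in> ball x r"
      "u (x + t *\<^sub>R a + t *\<^sub>R b) - u (x + t *\<^sub>R a) - u (x + t *\<^sub>R b) + u x = t\<^sup>2 * (a \<bullet> (L y1 *v b))"
      using mixed_difference_mvt[OF C2 r(2) t t2] by blast
    obtain y2 where y2: "y2 \<in> ball x r"
      "u (x + t *\<^sub>R b + t *\<^sub>R a) - u (x + t *\<^sub>R b) - u (x + t *\<^sub>R a) + u x = t\<^sup>2 * (b \<bullet> (L y2 *v a))"
      using mixed_difference_mvt[OF C2 r(2) t, of b a] t2 by (auto simp: add.commute)
    have "t\<^sup>2 * (a \<bullet> (L y1 *v b)) = t\<^sup>2 * (b \<bullet> (L y2 *v a))"
      using y1(2) y2(2) by (simp add: algebra_simps)
    then show ?thesis using y1 y2 t unfolding r_def by auto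
  qed
  then obtain y1 y2 where y: "\<And>n. y1 n \<in> ball x (r0 / real (Suc n))" "\<And>n. y2 n \<in> ball x (r0 / real (Suc n))"
     "\<And>n. a \<bullet> (L (y1 n) *v b) = b \<bullet> (L (y2 n) *v a)" by metis
  have lim0: "(\<lambda>n. r0 / real (Suc n)) \<longlonglongrightarrow> 0"
    using tendsto_mult[OF tendsto_const[of r0] LIMSEQ_inverse_real_of_nat] by (simp add: divide_inverse)
  have lim: "z \<longlonglongrightarrow> x" if "\<And>n. z n \<in> ball x (r0 / real (Suc n))" for z
  proof -
    have "(\<lambda>n. dist (z n) x) \<longlonglongrightarrow> 0"
    proof (rule tendsto_sandwich[OF _ _ tendsto_const lim0])
      have "dist (z n) x \<le> r0 / real (Suc n)" for n
        using that[of n] by (simp add: dist_commute)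
      then show "\<forall>\<^sub>F n in sequentially. dist (z n) x \<le> r0 / real (Suc n)" by simp
    qed simp
    then show ?thesis by (rule tendsto_dist_iff[THEN iffD2])
  qed
  have L: "isCont L x"
    using C2_dataD(1,2)[OF C2] x continuous_on_eq_continuous_at by blast
  have "(\<lambda>n. a \<bullet> (L (y1 n) *v b)) \<longlonglongrightarrow> a \<bullet> (L x *v b)"
       "(\<lambda>n. b \<bullet> (L (y2 n) *v a)) \<longlonglongrightarrow> b \<bullet> (L x *v a)"
    by (intro tendsto_intros tendsto_matrix_vector_mult isCont_tendsto_compose[OF L] lim y)+
  then show ?thesis using y(3) by (auto dest: LIMSEQ_unique)
qed

text \<open>If \<open>f2\<close> were positive, \<open>f'\<close> would vanish at 0 and be positive
  just to the right of it, so \<open>f\<close> would exceed its maximum by the mean value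
  theorem.\<close>

lemma second_derivative_test_max:
  fixes f :: "real \<Rightarrow> real"
  assumes "d > 0" and f: "\<And>s. \<bar>s\<bar> < d \<Longrightarrow> (f has_real_derivative f' s) (at s)"
    and f': "(f' has_real_derivative f2) (at 0)"
    and max: "\<And>s. \<bar>s\<bar> < d \<Longrightarrow> f s \<le> f 0"
  shows "f2 \<le> 0"
proof (rule ccontr)
  assume "\<not> f2 \<le> 0"
  have "f' 0 = 0"
    using DERIV_local_max[OF f[of 0] \<open>d > 0\<close>] max \<open>d > 0\<close> by auto
  obtain e where e: "e > 0" "\<And>h. 0 < h \<Longrightarrow> h < e \<Longrightarrow> f' 0 < f' (0 + h)"
    using DERIV_pos_inc_right[OF f'] \<open>\<not> f2 \<le> 0\<close> by auto
  define t where "t = min d e / 2"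
  have t: "0 < t" "t < d" "t < e" using \<open>d > 0\<close> e by (auto simp: t_def)
  obtain s where s: "0 < s" "s < t" "f t - f 0 = (t - 0) * f' s"
    using MVT2[OF t(1), of f f'] f t by force
  have "f' s > 0" using e(2)[of s] s t \<open>f' 0 = 0\<close> by auto
  then show False using s t max[of t] by (smt (verit) mult_pos_pos)
qed

section \<open>The Bernstein inequality without third derivatives\<close>

text \<open>The matrix \<open>I + \<kappa> e e\<^sup>T\<close> is the square of \<open>I + \<sigma> e e\<^sup>T\<close> with \<open>\<sigma> = sqrt (1 + \<kappa>) - 1\<close>.\<close>

lemma trace_weighted_nonpos:
  fixes N :: "real ^ 'n \<Rightarrow> real ^ 'n" and e :: "real ^ 'n"
  assumes lin: "linear N" and neg: "\<And>\<xi>. \<xi> \<bullet> N \<xi> \<le> 0" and "\<kappa> > -1" and e: "e \<bullet> e = 1"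
  shows "(\<Sum>i\<in>UNIV. axis i 1 \<bullet> N (axis i 1)) + \<kappa> * (e \<bullet> N e) \<le> 0"
proof -
  define \<sigma> where "\<sigma> = sqrt (1 + \<kappa>) - 1"
  have \<sigma>: "2 * \<sigma> + \<sigma>\<^sup>2 = \<kappa>"
    using \<open>\<kappa> > -1\<close> by (simp add: \<sigma>_def power2_eq_square algebra_simps)
  have ne: "(\<Sum>i\<in>UNIV. e $ i *\<^sub>R N (axis i 1)) = N e"
  proof -
    have "N e = N (\<Sum>i\<in>UNIV. e $ i *\<^sub>R axis i 1)"
      using basis_expansion[of e] by (simp add: scalar_mult_eq_scaleR)
    then show ?thesis by (simp add: linear_sum[OF lin] linear_cmul[OF lin])
  qed
  have ax: "axis i 1 \<bullet> w = w $ i" for i and w :: "real ^ 'n"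
    by (simp add: inner_axis')
  have "(\<Sum>i\<in>UNIV. e $ i * (e \<bullet> N (axis i 1))) = e \<bullet> N e"
    by (subst ne[symmetric]) (simp add: inner_sum_right)
  moreover have "(\<Sum>i\<in>UNIV. e $ i * N e $ i) = e \<bullet> N e" "(\<Sum>i\<in>UNIV. (e $ i)\<^sup>2) = 1"
    using e by (simp_all add: inner_vec_def power2_eq_square)
  \<comment> \<open>With S = I + \<sigma> e e^T the left side is the trace of S N S, that is, of N
    weighted with S^2 = I + \<kappa> e e^T.\<close>
  moreover have "(\<Sum>i\<in>UNIV. (axis i 1 + (\<sigma> * e $ i) *\<^sub>R e) \<bullet> N (axis i 1 + (\<sigma> * e $ i) *\<^sub>R e)) =
     (\<Sum>i\<in>UNIV. axis i 1 \<bullet> N (axis i 1)) + \<sigma> * (\<Sum>i\<in>UNIV. e $ i * N e $ i)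
      + \<sigma> * (\<Sum>i\<in>UNIV. e $ i * (e \<bullet> N (axis i 1))) + \<sigma>\<^sup>2 * (\<Sum>i\<in>UNIV. (e $ i)\<^sup>2) * (e \<bullet> N e)"
    by (simp add: linear_add[OF lin] linear_cmul[OF lin] inner_add_left inner_add_right ax
        sum.distrib sum_distrib_left sum_distrib_right power2_eq_square algebra_simps)
  ultimately have "(\<Sum>i\<in>UNIV. (axis i 1 + (\<sigma> * e $ i) *\<^sub>R e) \<bullet> N (axis i 1 + (\<sigma> * e $ i) *\<^sub>R e)) =
     (\<Sum>i\<in>UNIV. axis i 1 \<bullet> N (axis i 1)) + (2 * \<sigma> + \<sigma>\<^sup>2) * (e \<bullet> N e)"
    by (simp add: algebra_simps)
  moreover have "(\<Sum>i\<in>UNIV. (axis i 1 + (\<sigma> * e $ i) *\<^sub>R e) \<bullet> N (axis i 1 + (\<sigma> * e $ i) *\<^sub>R e)) \<le> 0"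
    by (intro sum_nonpos neg)
  ultimately show ?thesis unfolding \<sigma> by linarith
qed

text \<open>Because \<open>a\<close> is affine, moving \<open>x\<close> by \<open>s \<xi>\<close>
  moves the shifted point \<open>x + h a x\<close> along a straight line, with velocity
  \<open>\<eta> = \<xi> + h M \<xi>\<close>. The second derivative in \<open>s\<close> therefore
  involves no derivative of \<open>u\<close> beyond \<open>L\<close>. The terms are sorted into a
  difference quotient of the Hessian and a remainder that stays bounded as \<open>h\<close> tends to
  0.\<close>

lemma quotient_second_order:
  fixes z :: "real ^ 'n" and M :: "real ^ 'n ^ 'n"
  assumes C2u: "C2_data S u U L" and C2\<phi>: "C2_data S \<phi> P H"
    and sym: "\<And>a b. a \<bullet> (M *v b) = b \<bullet> (M *v a)"
    and a_def: "\<And>x. a x = c + M *v (x - z)"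
    and sub: "\<And>x. x \<in> ball z \<delta> \<Longrightarrow> x \<in> S \<and> x + h *\<^sub>R a x \<in> S"
    and x: "x \<in> ball z \<delta>" and h: "h > 0"
    and max: "\<And>w. w \<in> ball z \<delta> \<Longrightarrow>
       2 * (u (w + h *\<^sub>R a w) - u w) / h - a w \<bullet> a w - \<phi> w - \<epsilon> * ((w - z) \<bullet> (w - z))
       \<le> 2 * (u (x + h *\<^sub>R a x) - u x) / h - a x \<bullet> a x - \<phi> x - \<epsilon> * ((x - z) \<bullet> (x - z))"
  shows "\<xi> \<bullet> ((2 / h) *\<^sub>R (L (x + h *\<^sub>R a x) *v \<xi> - L x *v \<xi>)
      + (2 *\<^sub>R (L (x + h *\<^sub>R a x) *v (M *v \<xi>)) + 2 *\<^sub>R (M *v (L (x + h *\<^sub>R a x) *v \<xi>))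
        + (2 * h) *\<^sub>R (M *v (L (x + h *\<^sub>R a x) *v (M *v \<xi>)))
      - 2 *\<^sub>R (M *v (M *v \<xi>)) - H x *v \<xi> - (2 * \<epsilon>) *\<^sub>R \<xi>)) \<le> 0"
proof -
  define y where "y = x + h *\<^sub>R a x"
  define \<eta> where "\<eta> = \<xi> + h *\<^sub>R (M *v \<xi>)"
  have line_a: "a (x + s *\<^sub>R \<xi>) = a x + s *\<^sub>R (M *v \<xi>)" for s
    by (simp add: a_def algebra_simps) 
  have line: "x + s *\<^sub>R \<xi> + h *\<^sub>R a (x + s *\<^sub>R \<xi>) = y + s *\<^sub>R \<eta>" for s
    by (simp add: line_a y_def \<eta>_def algebra_simps)
  define k where "k s = (2 / h) * (u (y + s *\<^sub>R \<eta>) - u (x + s *\<^sub>R \<xi>))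
      - (a x + s *\<^sub>R (M *v \<xi>)) \<bullet> (a x + s *\<^sub>R (M *v \<xi>)) - \<phi> (x + s *\<^sub>R \<xi>)
      - \<epsilon> * ((x - z + s *\<^sub>R \<xi>) \<bullet> (x - z + s *\<^sub>R \<xi>))" for s
  define k1 where "k1 s = (2 / h) * (U (y + s *\<^sub>R \<eta>) \<bullet> \<eta> - U (x + s *\<^sub>R \<xi>) \<bullet> \<xi>)
      - 2 * ((a x + s *\<^sub>R (M *v \<xi>)) \<bullet> (M *v \<xi>)) - P (x + s *\<^sub>R \<xi>) \<bullet> \<xi>
      - \<epsilon> * (2 * ((x - z + s *\<^sub>R \<xi>) \<bullet> \<xi>))" for s
  define k2 where "k2 = (2 / h) * ((L y *v \<eta>) \<bullet> \<eta> - (L x *v \<xi>) \<bullet> \<xi>)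
      - 2 * ((M *v \<xi>) \<bullet> (M *v \<xi>)) - (H x *v \<xi>) \<bullet> \<xi> - 2 * \<epsilon> * (\<xi> \<bullet> \<xi>)"
  define d where "d = (\<delta> - dist z x) / (norm \<xi> + 1)"
  have n1: "norm \<xi> + 1 > 0" by (smt (verit) norm_ge_zero)
  have d: "d > 0" using x n1 by (simp add: d_def)
  have inb: "x + s *\<^sub>R \<xi> \<in> ball z \<delta>" if "\<bar>s\<bar> < d" for s
  proof -
    have "\<bar>s\<bar> * norm \<xi> \<le> \<bar>s\<bar> * (norm \<xi> + 1)" by (simp add: mult_left_mono)
    also have "\<dots> < d * (norm \<xi> + 1)" using that n1 by simp
    also have "\<dots> = \<delta> - dist z x" using n1 by (simp add: d_def)
    finally have "norm (s *\<^sub>R \<xi>) < \<delta> - dist z x" by simp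
    moreover have "dist z (x + s *\<^sub>R \<xi>) \<le> dist z x + norm (s *\<^sub>R \<xi>)"
      by (metis add_diff_cancel_left' dist_norm dist_triangle norm_minus_commute)
    ultimately show ?thesis by simp
  qed
  have inS: "x + s *\<^sub>R \<xi> \<in> S" "y + s *\<^sub>R \<eta> \<in> S" if "\<bar>s\<bar> < d" for s
    using sub[OF inb[OF that]] by (auto simp: line)
  have du: "((\<lambda>t. u (w + t *\<^sub>R b)) has_real_derivative U (w + s *\<^sub>R b) \<bullet> b) (at s)"
    if "w + s *\<^sub>R b \<in> S" for w b s
    using has_derivative_along_line[OF C2_dataD(5)[OF C2u that]]
    by (simp add: has_real_derivative_iff_has_vector_derivative)
  have d\<phi>: "((\<lambda>t. \<phi> (w + t *\<^sub>R b)) has_real_derivative P (w + s *\<^sub>R b) \<bullet> b) (at s)"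
    if "w + s *\<^sub>R b \<in> S" for w b s
    using has_derivative_along_line[OF C2_dataD(5)[OF C2\<phi> that]]
    by (simp add: has_real_derivative_iff_has_vector_derivative)
  have dU: "((\<lambda>t. U (w + t *\<^sub>R b) \<bullet> b) has_real_derivative (L (w + s *\<^sub>R b) *v b) \<bullet> b) (at s)"
    if "w + s *\<^sub>R b \<in> S" for w b s
    unfolding has_real_derivative_iff_has_vector_derivative
    by (rule bounded_linear.has_vector_derivative[OF bounded_linear_inner_left
        has_derivative_along_line[OF C2_dataD(6)[OF C2u that]]])
  have dP: "((\<lambda>t. P (w + t *\<^sub>R b) \<bullet> b) has_real_derivative (H (w + s *\<^sub>R b) *v b) \<bullet> b) (at s)"
    if "w + s *\<^sub>R b \<in> S" for w b s
    unfolding has_real_derivative_iff_has_vector_derivative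
    by (rule bounded_linear.has_vector_derivative[OF bounded_linear_inner_left
        has_derivative_along_line[OF C2_dataD(6)[OF C2\<phi> that]]])
  have sq: "((\<lambda>t. (w + t *\<^sub>R b) \<bullet> (w + t *\<^sub>R b)) has_real_derivative 2 * ((w + s *\<^sub>R b) \<bullet> b)) (at s)"
    for w b :: "real ^ 'n" and s
    by (simp add: inner_add_left inner_add_right)
      (auto intro!: derivative_eq_intros simp: algebra_simps inner_commute)
  have li: "((\<lambda>t. (w + t *\<^sub>R b) \<bullet> b) has_real_derivative b \<bullet> b) (at s)"
    for w b :: "real ^ 'n" and s
    by (simp add: inner_add_left) (auto intro!: derivative_eq_intros)
  have k_max: "k s \<le> k 0" if "\<bar>s\<bar> < d" for s
  proof -
    have e1: "x + s *\<^sub>R \<xi> - z = x - z + s *\<^sub>R \<xi>" by simp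
    then show ?thesis
      using max[OF inb[OF that]] unfolding line unfolding line_a e1 k_def y_def by simp
  qed
  have kd: "(k has_real_derivative k1 s) (at s)" if "\<bar>s\<bar> < d" for s
    unfolding k_def k1_def by (intro DERIV_diff DERIV_cmult du d\<phi> sq inS that)
  have kd2: "(k1 has_real_derivative k2) (at 0)"
    unfolding k1_def
  proof (rule DERIV_cong[rotated, OF HOL.sym])
    show "k2 = (2 / h) * ((L (y + 0 *\<^sub>R \<eta>) *v \<eta>) \<bullet> \<eta> - (L (x + 0 *\<^sub>R \<xi>) *v \<xi>) \<bullet> \<xi>)
      - 2 * ((M *v \<xi>) \<bullet> (M *v \<xi>)) - (H (x + 0 *\<^sub>R \<xi>) *v \<xi>) \<bullet> \<xi> - \<epsilon> * (2 * (\<xi> \<bullet> \<xi>))"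
      by (simp add: k2_def)
  next
    show "((\<lambda>s. 2 / h * (U (y + s *\<^sub>R \<eta>) \<bullet> \<eta> - U (x + s *\<^sub>R \<xi>) \<bullet> \<xi>)
      - 2 * ((a x + s *\<^sub>R (M *v \<xi>)) \<bullet> (M *v \<xi>)) - P (x + s *\<^sub>R \<xi>) \<bullet> \<xi>
      - \<epsilon> * (2 * ((x - z + s *\<^sub>R \<xi>) \<bullet> \<xi>))) has_real_derivative
      (2 / h) * ((L (y + 0 *\<^sub>R \<eta>) *v \<eta>) \<bullet> \<eta> - (L (x + 0 *\<^sub>R \<xi>) *v \<xi>) \<bullet> \<xi>)
      - 2 * ((M *v \<xi>) \<bullet> (M *v \<xi>)) - (H (x + 0 *\<^sub>R \<xi>) *v \<xi>) \<bullet> \<xi> - \<epsilon> * (2 * (\<xi> \<bullet> \<xi>))) (at 0)"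
      using d by (intro DERIV_diff DERIV_cmult dU dP li inS) simp_all
  qed
  have "k2 \<le> 0"
    by (rule second_derivative_test_max[OF d kd kd2 k_max])
  moreover have "k2 = \<xi> \<bullet> ((2 / h) *\<^sub>R (L y *v \<xi> - L x *v \<xi>)
      + (2 *\<^sub>R (L y *v (M *v \<xi>)) + 2 *\<^sub>R (M *v (L y *v \<xi>)) + (2 * h) *\<^sub>R (M *v (L y *v (M *v \<xi>)))
      - 2 *\<^sub>R (M *v (M *v \<xi>)) - H x *v \<xi> - (2 * \<epsilon>) *\<^sub>R \<xi>))"
  proof -
    have s1: "(M *v \<xi>) \<bullet> w = \<xi> \<bullet> (M *v w)" for w
      using sym[of \<xi> w] by (simp add: inner_commute)
    have "(L y *v \<eta>) \<bullet> \<eta> = \<xi> \<bullet> (L y *v \<xi>) + h * (\<xi> \<bullet> (L y *v (M *v \<xi>)) + \<xi> \<bullet> (M *v (L y *v \<xi>)))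
        + h * h * (\<xi> \<bullet> (M *v (L y *v (M *v \<xi>))))"
      unfolding inner_commute[of _ \<eta>] unfolding \<eta>_def
      by (simp add: matrix_vector_right_distrib matrix_vector_mult_scaleR inner_add_left
          inner_add_right s1 algebra_simps)
    \<comment> \<open>Every contribution of \<eta> beyond \<xi> carries a factor \<open>h\<close>
      that cancels \<open>2 / h\<close>; only the difference of the two Hessians keeps the singular
      factor.\<close>
    moreover have ar: "(2 / h) * (A + h * (B + C) + h * h * D - E) = (2 / h) * (A - E) + (2 * B + 2 * C + 2 * h * D)"
      for A B C D E :: real using h by (simp add: field_simps)
    ultimately show ?thesis
      unfolding k2_def inner_add_right inner_diff_right inner_scaleR_right
        inner_commute[of "L x *v \<xi>" \<xi>] inner_commute[of "H x *v \<xi>" \<xi>] s1[of "M *v \<xi>"]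
      by (simp only: ar)
  qed
  ultimately show ?thesis unfolding y_def by metis
qed

text \<open>Replacing \<open>|U|\<^sup>2\<close> by its minorant \<open>2 U \<bullet> a - |a|\<^sup>2\<close> with the affine field \<open>a\<close> tangent to \<open>U\<close> at \<open>z\<close>, and
  \<open>U \<bullet> a\<close> by a difference quotient of \<open>u\<close> along \<open>a\<close>, gives \<open>C\<^sup>2\<close> functions whose maxima converge to \<open>z\<close>.
  The second-order conditions at these maxima stand in for third derivatives of \<open>u\<close>.\<close>

lemma touching_max_sequence:
  fixes z :: "real ^ 'n"
  assumes C2u: "C2_data S u U L" and C2\<phi>: "C2_data S \<phi> P H" and z: "z \<in> S"
    and le: "\<And>x. x \<in> S \<Longrightarrow> U x \<bullet> U x \<le> \<phi> x" and eq: "\<phi> z = U z \<bullet> U z"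
    and \<epsilon>: "\<epsilon> > 0"
    and a_def: "\<And>x. a x = U z + L z *v (x - z)"
  shows "\<exists>X h. X \<longlonglongrightarrow> z \<and> h \<longlonglongrightarrow> (0::real) \<and>
    (\<forall>n. h n > 0 \<and> (\<forall>s. 0 \<le> s \<longrightarrow> s \<le> h n \<longrightarrow> X n + s *\<^sub>R a (X n) \<in> S) \<and>
      (\<forall>\<xi>. \<xi> \<bullet> ((2 / h n) *\<^sub>R (L (X n + h n *\<^sub>R a (X n)) *v \<xi> - L (X n) *v \<xi>)
      + (2 *\<^sub>R (L (X n + h n *\<^sub>R a (X n)) *v (L z *v \<xi>)) + 2 *\<^sub>R (L z *v (L (X n + h n *\<^sub>R a (X n)) *v \<xi>))
        + (2 * h n) *\<^sub>R (L z *v (L (X n + h n *\<^sub>R a (X n)) *v (L z *v \<xi>)))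
      - 2 *\<^sub>R (L z *v (L z *v \<xi>)) - H (X n) *v \<xi> - (2 * \<epsilon>) *\<^sub>R \<xi>)) \<le> 0))"
proof -
  have cont_a: "continuous_on T a" for T
    unfolding a_def[abs_def] by (intro continuous_intros continuous_on_matrix_vector_mult)
  have isCont_a: "isCont a x" for x
    using cont_a[of UNIV] by (simp add: continuous_on_eq_continuous_at)
  obtain \<delta>0 where \<delta>0: "\<delta>0 > 0" "cball z \<delta>0 \<subseteq> S"
    using C2_dataD(1)[OF C2u] z open_contains_cball by blast
  define \<delta> where "\<delta> = \<delta>0 / 2"
  have \<delta>: "\<delta> > 0" using \<delta>0 by (simp add: \<delta>_def)
  have "bounded (a ` cball z \<delta>)"
    by (intro compact_imp_bounded compact_continuous_image cont_a) auto
  then obtain B where B: "B > 0" "\<And>x. x \<in> cball z \<delta> \<Longrightarrow> norm (a x) \<le> B"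
    unfolding bounded_pos by auto
  \<comment> \<open>Shifts of length at most \<open>h n * B \<le> \<delta>\<close> keep the points
    of \<open>cball z \<delta>\<close> inside \<open>cball z \<delta>0\<close>, whose radius is
    twice as large.\<close>
  define h where "h n = (\<delta> / B) * inverse (real (Suc n))" for n
  have hpos: "h n > 0" for n using \<delta> B by (simp add: h_def)
  have h0: "h \<longlonglongrightarrow> 0"
    unfolding h_def[abs_def] using tendsto_mult[OF tendsto_const[of "\<delta> / B"] LIMSEQ_inverse_real_of_nat] by simp
  have hB: "h n * B \<le> \<delta>" for n
  proof -
    have "inverse (real (Suc n)) \<le> 1" by (simp add: inverse_le_1_iff)
    from mult_left_mono[OF this, of \<delta>] show ?thesis using B \<delta> by (simp add: h_def)
  qed
  have inS: "x + s *\<^sub>R a x \<in> S" if "x \<in> cball z \<delta>" "0 \<le> s" "s \<le> h n" for x s n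
  proof -
    have "norm (s *\<^sub>R a x) \<le> h n * B"
      using that B(2)[OF that(1)] B(1) hpos[of n] by (auto intro!: mult_mono)
    then have "norm (s *\<^sub>R a x) \<le> \<delta>" using hB[of n] by linarith
    moreover have "dist z (x + s *\<^sub>R a x) \<le> dist z x + norm (s *\<^sub>R a x)"
      by (metis add_diff_cancel_left' dist_norm dist_triangle norm_minus_commute)
    ultimately have "dist z (x + s *\<^sub>R a x) \<le> \<delta>0" using that(1) by (simp add: \<delta>_def)
    then show ?thesis using \<delta>0 by auto
  qed
  have cbS: "x \<in> S" if "x \<in> cball z \<delta>" for x
    using that \<delta>0 by (auto simp: \<delta>_def)
  define K where "K n w = 2 * (u (w + h n *\<^sub>R a w) - u w) / h n - a w \<bullet> a w - \<phi> w
      - \<epsilon> * ((w - z) \<bullet> (w - z))" for n w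
  have "\<exists>x\<in>cball z \<delta>. \<forall>y\<in>cball z \<delta>. K n y \<le> K n x" for n
  proof (rule continuous_attains_sup)
    have 1: "continuous_on (cball z \<delta>) (\<lambda>w. u (w + h n *\<^sub>R a w))"
      using hpos[of n]
      by (intro continuous_on_compose2[OF C2_dataD(4)[OF C2u]] continuous_intros cont_a)
        (auto intro!: inS[of _ _ n] simp: less_imp_le)
    have 2: "continuous_on (cball z \<delta>) u" "continuous_on (cball z \<delta>) \<phi>"
      using cbS by (auto intro: continuous_on_subset[OF C2_dataD(4)[OF C2u]]
          continuous_on_subset[OF C2_dataD(4)[OF C2\<phi>]])
    show "continuous_on (cball z \<delta>) (K n)"
      unfolding K_def[abs_def] using hpos[of n]
      by (intro continuous_intros 1 2 cont_a) auto
  qed (use \<delta> in auto)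
  then obtain zz where zz: "\<And>n. zz n \<in> cball z \<delta>" "\<And>n y. y \<in> cball z \<delta> \<Longrightarrow> K n y \<le> K n (zz n)"
    by metis
  obtain zb r where zb: "zb \<in> cball z \<delta>" "strict_mono r" "(zz \<circ> r) \<longlonglongrightarrow> zb"
    using compact_cball[of z \<delta>, unfolded compact_def] zz(1) by metis
  have hr0: "(\<lambda>n. h (r n)) \<longlonglongrightarrow> 0"
    using LIMSEQ_subseq_LIMSEQ[OF h0 zb(2)] by (simp add: o_def)
  have quot: "(\<lambda>n. (u (w n + h (r n) *\<^sub>R a (w n)) - u (w n)) / h (r n)) \<longlonglongrightarrow> U wb \<bullet> a wb"
    if w: "\<And>n. w n \<in> cball z \<delta>" "w \<longlonglongrightarrow> wb" "wb \<in> cball z \<delta>" for w wb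
  proof -
    have "\<exists>s. 0 < s \<and> s < h (r n) \<and> u (w n + h (r n) *\<^sub>R a (w n)) - u (w n)
        = h (r n) * (U (w n + s *\<^sub>R a (w n)) \<bullet> a (w n))" for n
    proof -
      have "((\<lambda>t. u (w n + t *\<^sub>R a (w n))) has_real_derivative U (w n + s *\<^sub>R a (w n)) \<bullet> a (w n)) (at s)"
        if "0 \<le> s" "s \<le> h (r n)" for s
        using has_derivative_along_line[OF C2_dataD(5)[OF C2u inS[OF w(1) that]]]
        by (simp add: has_real_derivative_iff_has_vector_derivative)
      from MVT2[OF hpos this] show ?thesis by force
    qed
    then obtain s where s: "\<And>n. 0 < s n" "\<And>n. s n < h (r n)"
       "\<And>n. u (w n + h (r n) *\<^sub>R a (w n)) - u (w n) = h (r n) * (U (w n + s n *\<^sub>R a (w n)) \<bullet> a (w n))"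
      by metis
    have s0: "s \<longlonglongrightarrow> 0"
      by (rule tendsto_sandwich[OF _ _ tendsto_const hr0])
        (simp_all add: s less_imp_le)
    have aw: "(\<lambda>n. a (w n)) \<longlonglongrightarrow> a wb" by (rule isCont_tendsto_compose[OF isCont_a w(2)])
    have "(\<lambda>n. w n + s n *\<^sub>R a (w n)) \<longlonglongrightarrow> wb + 0 *\<^sub>R a wb"
      by (intro tendsto_intros w s0 aw)
    moreover have "isCont U wb"
      using C2_dataD(1,3)[OF C2u] cbS[OF w(3)] continuous_on_eq_continuous_at by blast
    ultimately have "(\<lambda>n. U (w n + s n *\<^sub>R a (w n)) \<bullet> a (w n)) \<longlonglongrightarrow> U wb \<bullet> a wb"
      by (intro tendsto_inner aw isCont_tendsto_compose[of wb U]) simp_all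
    then show ?thesis using s(3) hpos by (simp add: less_imp_neq[THEN not_sym])
  qed
  have Klim: "(\<lambda>n. K (r n) (w n)) \<longlonglongrightarrow> 2 * (U wb \<bullet> a wb) - a wb \<bullet> a wb - \<phi> wb - \<epsilon> * ((wb - z) \<bullet> (wb - z))"
    if w: "\<And>n. w n \<in> cball z \<delta>" "w \<longlonglongrightarrow> wb" "wb \<in> cball z \<delta>" for w wb
  proof -
    have "isCont \<phi> wb"
      using C2_dataD(1,4)[OF C2\<phi>] cbS[OF w(3)] continuous_on_eq_continuous_at by blast
    then show ?thesis
      unfolding K_def times_divide_eq_right[symmetric]
      by (intro tendsto_intros quot w isCont_tendsto_compose[OF isCont_a] isCont_tendsto_compose[of wb \<phi>])
  qed
  have "a z = U z" by (simp add: a_def)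
  \<comment> \<open>The limit function is 0 at \<open>z\<close>, since \<open>a z = U z\<close> and
    \<phi> touches there. At \<open>zb\<close> it is at most \<open>- \<epsilon> |zb - z|^2\<close>,
    since \<open>2 U \<bullet> a - |a|^2 \<le> |U|^2 \<le> \<phi>\<close>. The penalty thus forces
    \<open>zb = z\<close>.\<close>
  have "2 * (U z \<bullet> a z) - a z \<bullet> a z - \<phi> z - \<epsilon> * ((z - z) \<bullet> (z - z))
      \<le> 2 * (U zb \<bullet> a zb) - a zb \<bullet> a zb - \<phi> zb - \<epsilon> * ((zb - z) \<bullet> (zb - z))"
  proof (rule LIMSEQ_le)
    show "(\<lambda>n. K (r n) z) \<longlonglongrightarrow> 2 * (U z \<bullet> a z) - a z \<bullet> a z - \<phi> z - \<epsilon> * ((z - z) \<bullet> (z - z))"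
      using \<delta> by (intro Klim) auto
    show "(\<lambda>n. K (r n) ((zz \<circ> r) n)) \<longlonglongrightarrow> 2 * (U zb \<bullet> a zb) - a zb \<bullet> a zb - \<phi> zb - \<epsilon> * ((zb - z) \<bullet> (zb - z))"
      using zb zz(1) by (intro Klim) (auto simp: o_def)
    show "\<exists>N. \<forall>n\<ge>N. K (r n) z \<le> K (r n) ((zz \<circ> r) n)"
      using zz(2)[of z] \<delta> by auto
  qed
  then have "\<epsilon> * ((zb - z) \<bullet> (zb - z)) \<le> 2 * (U zb \<bullet> a zb) - a zb \<bullet> a zb - \<phi> zb"
    using \<open>a z = U z\<close> eq by simp
  also have "\<dots> \<le> U zb \<bullet> U zb - \<phi> zb"
    using inner_ge_zero[of "U zb - a zb"] by (simp add: inner_diff_left inner_diff_right inner_commute)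
  also have "\<dots> \<le> 0" using le[OF cbS[OF zb(1)]] by simp
  finally have "zb = z" using \<epsilon> inner_ge_zero[of "zb - z"]
    by (metis eq_iff_diff_eq_0 inner_eq_zero_iff linorder_not_less mult_pos_pos order_less_le)
  then have lim: "(zz \<circ> r) \<longlonglongrightarrow> z" using zb by simp
  \<comment> \<open>Late maximizers lie in the open ball, where the second-order condition is
    available.\<close>
  obtain N where N: "\<And>n. n \<ge> N \<Longrightarrow> zz (r n) \<in> ball z \<delta>"
    using lim \<delta> unfolding LIMSEQ_def by (auto simp: dist_commute)
  show ?thesis
  proof (intro exI[of _ "\<lambda>n. (zz \<circ> r) (n + N)"] exI[of _ "\<lambda>n. h (r (n + N))"] conjI allI impI)
    show "(\<lambda>n. (zz \<circ> r) (n + N)) \<longlonglongrightarrow> z" using lim by (rule LIMSEQ_ignore_initial_segment)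
    show "(\<lambda>n. h (r (n + N))) \<longlonglongrightarrow> 0" using hr0 by (rule LIMSEQ_ignore_initial_segment)
    fix n
    show "0 < h (r (n + N))" by (rule hpos)
    show "(zz \<circ> r) (n + N) + s *\<^sub>R a ((zz \<circ> r) (n + N)) \<in> S" if "0 \<le> s" "s \<le> h (r (n + N))" for s
      using inS[OF _ that] zz(1) by simp
    fix \<xi>
    let ?h = "h (r (n + N))" and ?x = "(zz \<circ> r) (n + N)"
    show "\<xi> \<bullet> ((2 / ?h) *\<^sub>R (L (?x + ?h *\<^sub>R a ?x) *v \<xi> - L ?x *v \<xi>)
      + (2 *\<^sub>R (L (?x + ?h *\<^sub>R a ?x) *v (L z *v \<xi>)) + 2 *\<^sub>R (L z *v (L (?x + ?h *\<^sub>R a ?x) *v \<xi>))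
        + (2 * ?h) *\<^sub>R (L z *v (L (?x + ?h *\<^sub>R a ?x) *v (L z *v \<xi>)))
      - 2 *\<^sub>R (L z *v (L z *v \<xi>)) - H ?x *v \<xi> - (2 * \<epsilon>) *\<^sub>R \<xi>)) \<le> 0"
    proof (rule quotient_second_order[OF C2u C2\<phi> _ a_def])
      show "b \<bullet> (L z *v c) = c \<bullet> (L z *v b)" for b c by (rule C2_data_symmetric[OF C2u z])
      show "x \<in> S \<and> x + ?h *\<^sub>R a x \<in> S" if "x \<in> ball z \<delta>" for x
        using that cbS inS[of x ?h "r (n + N)"] hpos[of "r (n + N)"] by (auto simp: less_imp_le)
      show "?x \<in> ball z \<delta>" using N[of "n + N"] by simp
      show "?h > 0" by (rule hpos)
      show "2 * (u (w + ?h *\<^sub>R a w) - u w) / ?h - a w \<bullet> a w - \<phi> w - \<epsilon> * ((w - z) \<bullet> (w - z))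
       \<le> 2 * (u (?x + ?h *\<^sub>R a ?x) - u ?x) / ?h - a ?x \<bullet> a ?x - \<phi> ?x - \<epsilon> * ((?x - z) \<bullet> (?x - z))"
        if "w \<in> ball z \<delta>" for w
        using zz(2)[of w "r (n + N)"] that unfolding K_def by auto
    qed
  qed
qed

lemma DERIV_inner:
  fixes V W :: "real \<Rightarrow> 'a::real_inner"
  assumes "(V has_vector_derivative v) (at s)" "(W has_vector_derivative w) (at s)"
  shows "((\<lambda>t. V t \<bullet> W t) has_real_derivative (V s \<bullet> w + v \<bullet> W s)) (at s)"
proof -
  have "((\<lambda>t. V t \<bullet> W t) has_derivative (\<lambda>h. V s \<bullet> (h *\<^sub>R w) + (h *\<^sub>R v) \<bullet> W s)) (at s)"
    using has_derivative_inner[OF assms[unfolded has_vector_derivative_def]] .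
  moreover have "(\<lambda>h. V s \<bullet> (h *\<^sub>R w) + (h *\<^sub>R v) \<bullet> W s) = (*) (V s \<bullet> w + v \<bullet> W s)"
    by (auto simp: fun_eq_iff distrib_left mult.commute)
  ultimately show ?thesis by (simp add: has_field_derivative_def)
qed

text \<open>The second-order condition at \<open>X n\<close> is contracted with I + \<kappa> e e^T,
  where \<open>e\<close> is the direction of \<open>U\<close> at the shifted point
  \<open>Y n\<close>. By the equation at both points, the singular term becomes a difference
  quotient of a function \<Gamma> in which the Hessian is frozen at \<open>X n\<close>. This
  \<Gamma> is differentiable although \<open>L\<close> need not be, so the mean value theorem turns
  the quotient into first derivatives of \<open>G\<close> and \<open>U\<close>, and \<open>n\<close>
  can tend to infinity.\<close>

lemma touching_inequality_eps:
  fixes z :: "real ^ 'n"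
  assumes C2u: "C2_data S u U L" and C2\<phi>: "C2_data S \<phi> P H" and z: "z \<in> S" and \<kappa>: "\<kappa> > -1"
    and nz: "\<And>x. x \<in> S \<Longrightarrow> U x \<noteq> 0"
    and pde: "\<And>x. x \<in> S \<Longrightarrow> trace (L x) + \<kappa> * (U x \<bullet> (L x *v U x)) / (U x \<bullet> U x) = G x"
    and G: "\<And>x. x \<in> S \<Longrightarrow> (G has_derivative (\<lambda>h. G' x \<bullet> h)) (at x)" "continuous_on S G'"
    and le: "\<And>x. x \<in> S \<Longrightarrow> U x \<bullet> U x \<le> \<phi> x" and eq: "\<phi> z = U z \<bullet> U z"
    and \<epsilon>: "\<epsilon> > 0"
  shows "2 * (G' z \<bullet> U z - \<kappa> * (((L z *v U z) \<bullet> (L z *v U z) + U z \<bullet> (L z *v (L z *v U z))) / (U z \<bullet> U z)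
             - (U z \<bullet> (L z *v U z)) * (2 * (U z \<bullet> (L z *v U z))) / (U z \<bullet> U z)\<^sup>2))
      + ((\<Sum>i\<in>UNIV. axis i 1 \<bullet> (2 *\<^sub>R (L z *v (L z *v axis i 1)) - H z *v axis i 1 - (2 * \<epsilon>) *\<^sub>R axis i 1))
        + \<kappa> * (U z \<bullet> (2 *\<^sub>R (L z *v (L z *v U z)) - H z *v U z - (2 * \<epsilon>) *\<^sub>R U z)) / (U z \<bullet> U z)) \<le> 0"
proof -
  define a where "a x = U z + L z *v (x - z)" for x
  obtain X h where X: "X \<longlonglongrightarrow> z" and h0: "h \<longlonglongrightarrow> (0::real)" and hpos: "\<And>n. h n > 0"
    and seg: "\<And>n s. 0 \<le> s \<Longrightarrow> s \<le> h n \<Longrightarrow> X n + s *\<^sub>R a (X n) \<in> S"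
    and neg: "\<And>n \<xi>. \<xi> \<bullet> ((2 / h n) *\<^sub>R (L (X n + h n *\<^sub>R a (X n)) *v \<xi> - L (X n) *v \<xi>)
      + (2 *\<^sub>R (L (X n + h n *\<^sub>R a (X n)) *v (L z *v \<xi>)) + 2 *\<^sub>R (L z *v (L (X n + h n *\<^sub>R a (X n)) *v \<xi>))
        + (2 * h n) *\<^sub>R (L z *v (L (X n + h n *\<^sub>R a (X n)) *v (L z *v \<xi>)))
      - 2 *\<^sub>R (L z *v (L z *v \<xi>)) - H (X n) *v \<xi> - (2 * \<epsilon>) *\<^sub>R \<xi>)) \<le> 0"
    using touching_max_sequence[OF C2u C2\<phi> z le eq \<epsilon> a_def] by blast
  define Y where "Y n = X n + h n *\<^sub>R a (X n)" for n
  define R where "R n \<xi> = 2 *\<^sub>R (L (Y n) *v (L z *v \<xi>)) + 2 *\<^sub>R (L z *v (L (Y n) *v \<xi>))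
        + (2 * h n) *\<^sub>R (L z *v (L (Y n) *v (L z *v \<xi>)))
      - 2 *\<^sub>R (L z *v (L z *v \<xi>)) - H (X n) *v \<xi> - (2 * \<epsilon>) *\<^sub>R \<xi>" for n \<xi>
  \<comment> \<open>The derivative at \<open>w\<close> in direction \<open>b\<close> of
    \<open>G - \<kappa> (U \<bullet> (L x *v U)) / (U \<bullet> U)\<close>, with the Hessian frozen
    at \<open>x\<close>.\<close>
  define D where "D x w b = G' w \<bullet> b - \<kappa> * (((L w *v b) \<bullet> (L x *v U w) + U w \<bullet> (L x *v (L w *v b))) / (U w \<bullet> U w)
             - (U w \<bullet> (L x *v U w)) * (2 * (U w \<bullet> (L w *v b))) / (U w \<bullet> U w)\<^sup>2)" for x w b
  have XS: "X n \<in> S" for n using seg[of 0 n] hpos[of n] by simp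
  have YS: "Y n \<in> S" for n using seg[of "h n" n] hpos[of n] by (simp add: Y_def)
  have key: "\<exists>s. 0 < s \<and> s < h n \<and> 2 * D (X n) (X n + s *\<^sub>R a (X n)) (a (X n))
      + ((\<Sum>i\<in>UNIV. axis i 1 \<bullet> R n (axis i 1)) + \<kappa> * (U (Y n) \<bullet> R n (U (Y n))) / (U (Y n) \<bullet> U (Y n))) \<le> 0" for n
  proof -
    let ?x = "X n" and ?y = "Y n" and ?b = "a (X n)" and ?h = "h n"
    define f where "f w = U w \<bullet> U w" for w
    have fpos: "f w > 0" if "w \<in> S" for w using nz[OF that] by (simp add: f_def)
    define \<Gamma> where "\<Gamma> s = G (?x + s *\<^sub>R ?b) - \<kappa> * ((U (?x + s *\<^sub>R ?b) \<bullet> (L ?x *v U (?x + s *\<^sub>R ?b))) /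
         (U (?x + s *\<^sub>R ?b) \<bullet> U (?x + s *\<^sub>R ?b)))" for s
    have "(\<Gamma> has_real_derivative D ?x (?x + s *\<^sub>R ?b) ?b) (at s)" if s: "0 \<le> s" "s \<le> ?h" for s
    proof -
      let ?w = "?x + s *\<^sub>R ?b"
      have w: "?w \<in> S" by (rule seg[OF s])
      have g: "((\<lambda>s. G (?x + s *\<^sub>R ?b)) has_real_derivative G' ?w \<bullet> ?b) (at s)"
        using has_derivative_along_line[OF G(1)[OF w]]
        by (simp add: has_real_derivative_iff_has_vector_derivative)
      have V: "((\<lambda>s. U (?x + s *\<^sub>R ?b)) has_vector_derivative (L ?w *v ?b)) (at s)"
        by (rule has_derivative_along_line[OF C2_dataD(6)[OF C2u w]])
      have LV: "((\<lambda>s. L ?x *v U (?x + s *\<^sub>R ?b)) has_vector_derivative (L ?x *v (L ?w *v ?b))) (at s)"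
        by (rule bounded_linear.has_vector_derivative[OF matrix_vector_mul_bounded_linear V])
      show ?thesis unfolding \<Gamma>_def[abs_def] D_def
      proof (rule DERIV_diff[OF g DERIV_cmult], rule DERIV_cong[OF DERIV_divide[OF DERIV_inner[OF V LV] DERIV_inner[OF V V]]])
        show "U ?w \<bullet> U ?w \<noteq> 0" using nz[OF w] by simp
        then show "((U ?w \<bullet> (L ?x *v (L ?w *v ?b)) + (L ?w *v ?b) \<bullet> (L ?x *v U ?w)) * (U ?w \<bullet> U ?w)
           - (U ?w \<bullet> (L ?x *v U ?w)) * (U ?w \<bullet> (L ?w *v ?b) + (L ?w *v ?b) \<bullet> U ?w)) / ((U ?w \<bullet> U ?w) * (U ?w \<bullet> U ?w))
          = ((L ?w *v ?b) \<bullet> (L ?x *v U ?w) + U ?w \<bullet> (L ?x *v (L ?w *v ?b))) / (U ?w \<bullet> U ?w)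
             - (U ?w \<bullet> (L ?x *v U ?w)) * (2 * (U ?w \<bullet> (L ?w *v ?b))) / (U ?w \<bullet> U ?w)\<^sup>2"
          by (simp add: diff_divide_distrib power2_eq_square inner_commute[of "L ?w *v ?b" "U ?w"] add.commute)
      qed
    qed
    from MVT2[OF hpos this] obtain s where s: "0 < s" "s < ?h"
      "\<Gamma> ?h - \<Gamma> 0 = ?h * D ?x (?x + s *\<^sub>R ?b) ?b" by force
    \<comment> \<open>Taking \<open>e\<close> at the shifted point makes the quadratic term in
      \<open>L ?y\<close> the same as the one in the equation at \<open>?y\<close>.\<close>
    define e where "e = (1 / sqrt (f ?y)) *\<^sub>R U ?y"
    have sq: "sqrt (f ?y) * sqrt (f ?y) = f ?y" using fpos[OF YS[of n]] by simp
    have e: "e \<bullet> e = 1"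
      using fpos[OF YS[of n]] sq by (simp add: e_def f_def[symmetric])
    define N where "N \<xi> = (2 / ?h) *\<^sub>R (L ?y *v \<xi> - L ?x *v \<xi>) + R n \<xi>" for \<xi>
    have lin: "linear N"
      by (rule linearI) (simp_all add: N_def R_def matrix_vector_right_distrib matrix_vector_mult_scaleR algebra_simps)
    have T: "(\<Sum>i\<in>UNIV. axis i 1 \<bullet> N (axis i 1)) + \<kappa> * (e \<bullet> N e) \<le> 0"
      using neg[of _ n] by (intro trace_weighted_nonpos[OF lin _ \<kappa> e]) (simp add: N_def R_def Y_def)
    have eN: "e \<bullet> N e = (U ?y \<bullet> N (U ?y)) / f ?y"
      using sq by (simp add: e_def linear_cmul[OF lin])
    have UN: "U ?y \<bullet> N (U ?y) = (2 / ?h) * (U ?y \<bullet> (L ?y *v U ?y) - U ?y \<bullet> (L ?x *v U ?y)) + U ?y \<bullet> R n (U ?y)"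
      unfolding N_def inner_add_right inner_scaleR_right inner_diff_right ..
    have SN: "(\<Sum>i\<in>UNIV. axis i 1 \<bullet> N (axis i 1)) = (2 / ?h) * (trace (L ?y) - trace (L ?x))
        + (\<Sum>i\<in>UNIV. axis i 1 \<bullet> R n (axis i 1))"
    proof -
      have "axis i 1 \<bullet> (A *v axis i 1) = A $ i $ i" for i and A :: "real ^ 'n ^ 'n"
        by (simp add: inner_axis' matrix_vector_mult_basis column_def)
      then show ?thesis
        unfolding N_def inner_add_right inner_scaleR_right inner_diff_right sum.distrib trace_def
        by (simp only: sum_subtractf flip: sum_distrib_left)
    qed
    have tr: "trace (L ?y) = G ?y - \<kappa> * (U ?y \<bullet> (L ?y *v U ?y)) / f ?y"
      "trace (L ?x) = G ?x - \<kappa> * (U ?x \<bullet> (L ?x *v U ?x)) / f ?x"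
      using pde[OF XS[of n]] pde[OF YS[of n]] by (simp_all add: f_def)
    have ga: "\<Gamma> ?h = G ?y - \<kappa> * ((U ?y \<bullet> (L ?x *v U ?y)) / f ?y)"
       "\<Gamma> 0 = G ?x - \<kappa> * ((U ?x \<bullet> (L ?x *v U ?x)) / f ?x)"
      by (simp_all add: \<Gamma>_def f_def Y_def)
    \<comment> \<open>Here \<open>o'\<close> stands for the quadratic form of \<open>L ?y\<close>;
      it cancels, and what remains is the quotient of \<Gamma>, whose values contain
      \<open>L ?x\<close> only.\<close>
    have alg: "(2 / h) * (Gy - \<kappa> * (q / fy) - (Gx - \<kappa> * (p / fx))) + (s + \<kappa> * t / fy)
        = (2 / h) * ((Gy - \<kappa> * o' / fy) - (Gx - \<kappa> * p / fx)) + s + \<kappa> * (((2 / h) * (o' - q) + t) / fy)"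
      for h Gy q fy Gx p fx s t o' :: real
      by (simp add: divide_inverse algebra_simps)
    have "(2 / ?h) * (\<Gamma> ?h - \<Gamma> 0) + ((\<Sum>i\<in>UNIV. axis i 1 \<bullet> R n (axis i 1))
        + \<kappa> * (U ?y \<bullet> R n (U ?y)) / f ?y) \<le> 0"
      using T unfolding eN UN SN tr ga unfolding alg[symmetric] .
    moreover have "(2 / ?h) * (\<Gamma> ?h - \<Gamma> 0) = 2 * D ?x (?x + s *\<^sub>R ?b) ?b"
      using hpos[of n] by (simp add: s(3))
    ultimately show ?thesis using s by (auto simp: f_def)
  qed
  then have "\<forall>n. \<exists>s. 0 < s \<and> s < h n \<and> 2 * D (X n) (X n + s *\<^sub>R a (X n)) (a (X n))
      + ((\<Sum>i\<in>UNIV. axis i 1 \<bullet> R n (axis i 1)) + \<kappa> * (U (Y n) \<bullet> R n (U (Y n))) / (U (Y n) \<bullet> U (Y n))) \<le> 0" ..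
  from choice[OF this] obtain s where s': "\<forall>n. 0 < s n \<and> s n < h n \<and> 2 * D (X n) (X n + s n *\<^sub>R a (X n)) (a (X n))
      + ((\<Sum>i\<in>UNIV. axis i 1 \<bullet> R n (axis i 1)) + \<kappa> * (U (Y n) \<bullet> R n (U (Y n))) / (U (Y n) \<bullet> U (Y n))) \<le> 0" ..
  then have s: "\<And>n. 0 < s n" "\<And>n. s n < h n" and
    ineq: "\<And>n. 2 * D (X n) (X n + s n *\<^sub>R a (X n)) (a (X n))
      + ((\<Sum>i\<in>UNIV. axis i 1 \<bullet> R n (axis i 1)) + \<kappa> * (U (Y n) \<bullet> R n (U (Y n))) / (U (Y n) \<bullet> U (Y n))) \<le> 0"
    by simp_all
  have s0: "s \<longlonglongrightarrow> 0"
    by (rule tendsto_sandwich[OF _ _ tendsto_const h0]) (simp_all add: s less_imp_le)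
  have "(\<lambda>n. a (X n)) \<longlonglongrightarrow> U z + L z *v (z - z)"
    unfolding a_def by (intro tendsto_intros tendsto_matrix_vector_mult X)
  then have aX: "(\<lambda>n. a (X n)) \<longlonglongrightarrow> U z" by simp
  have "(\<lambda>n. X n + s n *\<^sub>R a (X n)) \<longlonglongrightarrow> z + 0 *\<^sub>R U z"
    by (intro tendsto_intros X s0 aX)
  then have W: "(\<lambda>n. X n + s n *\<^sub>R a (X n)) \<longlonglongrightarrow> z" by simp
  have "Y \<longlonglongrightarrow> z + 0 *\<^sub>R U z"
    unfolding Y_def[abs_def] by (intro tendsto_intros X h0 aX)
  then have Y: "Y \<longlonglongrightarrow> z" by simp
  have cont: "isCont L z" "isCont U z" "isCont G' z" "isCont H z"
    using C2_dataD(1,2,3)[OF C2u] C2_dataD(2)[OF C2\<phi>] G(2) z continuous_on_eq_continuous_at by blast+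
  have fz: "U z \<bullet> U z \<noteq> 0" using nz[OF z] by simp
  \<comment> \<open>Each mixed term tends to \<open>2 L z (L z \<zeta>)\<close>, the subtracted
    square removes one of them, and the cubic term disappears with \<open>h\<close>.\<close>
  have LR: "(\<lambda>n. R n (\<xi> n)) \<longlonglongrightarrow> 2 *\<^sub>R (L z *v (L z *v \<zeta>)) - H z *v \<zeta> - (2 * \<epsilon>) *\<^sub>R \<zeta>"
    if "\<xi> \<longlonglongrightarrow> \<zeta>" for \<xi> \<zeta>
  proof -
    have "(\<lambda>n. R n (\<xi> n)) \<longlonglongrightarrow> 2 *\<^sub>R (L z *v (L z *v \<zeta>)) + 2 *\<^sub>R (L z *v (L z *v \<zeta>))
        + (2 * 0) *\<^sub>R (L z *v (L z *v (L z *v \<zeta>)))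
      - 2 *\<^sub>R (L z *v (L z *v \<zeta>)) - H z *v \<zeta> - (2 * \<epsilon>) *\<^sub>R \<zeta>"
      unfolding R_def
      by (intro tendsto_intros tendsto_matrix_vector_mult h0 that isCont_tendsto_compose[OF cont(1)]
          isCont_tendsto_compose[OF cont(4)] X Y)
    then show ?thesis by (simp flip: scaleR_left_diff_distrib)
  qed
  have LD: "(\<lambda>n. D (X n) (X n + s n *\<^sub>R a (X n)) (a (X n))) \<longlonglongrightarrow> D z z (U z)"
    unfolding D_def
    by (intro tendsto_intros tendsto_matrix_vector_mult aX isCont_tendsto_compose[OF cont(1)]
        isCont_tendsto_compose[OF cont(2)] isCont_tendsto_compose[OF cont(3)] X W fz)
      (use fz in simp)
  have UY: "(\<lambda>n. U (Y n)) \<longlonglongrightarrow> U z" by (rule isCont_tendsto_compose[OF cont(2) Y])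
  have "2 * D z z (U z)
      + ((\<Sum>i\<in>UNIV. axis i 1 \<bullet> (2 *\<^sub>R (L z *v (L z *v axis i 1)) - H z *v axis i 1 - (2 * \<epsilon>) *\<^sub>R axis i 1))
        + \<kappa> * (U z \<bullet> (2 *\<^sub>R (L z *v (L z *v U z)) - H z *v U z - (2 * \<epsilon>) *\<^sub>R U z)) / (U z \<bullet> U z)) \<le> 0"
  proof (rule LIMSEQ_le_const2)
    show "(\<lambda>n. 2 * D (X n) (X n + s n *\<^sub>R a (X n)) (a (X n))
      + ((\<Sum>i\<in>UNIV. axis i 1 \<bullet> R n (axis i 1)) + \<kappa> * (U (Y n) \<bullet> R n (U (Y n))) / (U (Y n) \<bullet> U (Y n))))
     \<longlonglongrightarrow> 2 * D z z (U z)
      + ((\<Sum>i\<in>UNIV. axis i 1 \<bullet> (2 *\<^sub>R (L z *v (L z *v axis i 1)) - H z *v axis i 1 - (2 * \<epsilon>) *\<^sub>R axis i 1))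
        + \<kappa> * (U z \<bullet> (2 *\<^sub>R (L z *v (L z *v U z)) - H z *v U z - (2 * \<epsilon>) *\<^sub>R U z)) / (U z \<bullet> U z))"
      by (intro tendsto_add tendsto_mult tendsto_divide tendsto_sum tendsto_inner tendsto_const LD LR UY fz)
  qed (use ineq in blast)
  then show ?thesis unfolding D_def .
qed

text \<open>This is Bochner's formula for \<open>|U|\<^sup>2\<close>, contracted with \<open>I + \<kappa> e e\<^sup>T\<close> where \<open>e = U / |U|\<close>; the terms
  in \<open>\<kappa>\<close> on the left also account for the derivative of \<open>e\<close> along \<open>U\<close>.\<close>

lemma touching_inequality:
  fixes z :: "real ^ 'n"
  assumes C2u: "C2_data S u U L" and C2\<phi>: "C2_data S \<phi> P H" and z: "z \<in> S" and \<kappa>: "\<kappa> > -1"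
    and nz: "\<And>x. x \<in> S \<Longrightarrow> U x \<noteq> 0"
    and pde: "\<And>x. x \<in> S \<Longrightarrow> trace (L x) + \<kappa> * (U x \<bullet> (L x *v U x)) / (U x \<bullet> U x) = G x"
    and G: "\<And>x. x \<in> S \<Longrightarrow> (G has_derivative (\<lambda>h. G' x \<bullet> h)) (at x)" "continuous_on S G'"
    and le: "\<And>x. x \<in> S \<Longrightarrow> U x \<bullet> U x \<le> \<phi> x" and eq: "\<phi> z = U z \<bullet> U z"
  shows "2 * (G' z \<bullet> U z) + 2 * (\<Sum>i\<in>UNIV. (norm (L z *v axis i 1))\<^sup>2)
      - 2 * \<kappa> * (norm (L z *v U z))\<^sup>2 / (U z \<bullet> U z) + 4 * \<kappa> * (U z \<bullet> (L z *v U z))\<^sup>2 / (U z \<bullet> U z)\<^sup>2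
      \<le> trace (H z) + \<kappa> * (U z \<bullet> (H z *v U z)) / (U z \<bullet> U z)" (is "?l \<le> ?r")
proof (rule field_le_epsilon)
  fix \<delta> :: real assume "\<delta> > 0"
  define f where "f = U z \<bullet> U z"
  have f: "f > 0" using nz[OF z] by (simp add: f_def)
  \<comment> \<open>The penalty contributes \<open>2 \<epsilon> (n + \<kappa>)\<close> to the
    contracted inequality, which is at most \<open>\<epsilon> c\<close>; hence \<epsilon> is taken
    as \<open>\<delta> / c\<close>.\<close>
  define c where "c = 2 * (real CARD('n) + \<bar>\<kappa>\<bar>) + 1"
  have c: "c > 0" by (simp add: c_def add_nonneg_pos)
  define \<epsilon> where "\<epsilon> = \<delta> / c"
  have \<epsilon>: "\<epsilon> > 0" using \<open>\<delta> > 0\<close> c by (simp add: \<epsilon>_def)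
  have sym: "b \<bullet> (L z *v (L z *v b)) = (norm (L z *v b))\<^sup>2" for b
    using C2_data_symmetric[OF C2u z, of b "L z *v b"] by (simp add: power2_norm_eq_inner)
  have ax: "axis i 1 \<bullet> (A *v axis i 1) = A $ i $ i" for i and A :: "real ^ 'n ^ 'n"
    by (simp add: inner_axis' matrix_vector_mult_basis column_def)
  have "(\<Sum>i\<in>UNIV. axis i 1 \<bullet> (2 *\<^sub>R (L z *v (L z *v axis i 1)) - H z *v axis i 1 - (2 * \<epsilon>) *\<^sub>R axis i 1))
     = 2 * (\<Sum>i\<in>UNIV. (norm (L z *v axis i 1))\<^sup>2) - trace (H z) - 2 * \<epsilon> * real CARD('n)"
    unfolding inner_diff_right inner_scaleR_right sym ax
    by (simp add: sum_subtractf sum_distrib_left trace_def inner_axis')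
  moreover have "\<kappa> * (U z \<bullet> (2 *\<^sub>R (L z *v (L z *v U z)) - H z *v U z - (2 * \<epsilon>) *\<^sub>R U z)) / f
     = 2 * \<kappa> * (norm (L z *v U z))\<^sup>2 / f - \<kappa> * (U z \<bullet> (H z *v U z)) / f - 2 * \<epsilon> * \<kappa>"
    unfolding inner_diff_right inner_scaleR_right sym using f unfolding f_def[symmetric]
    by (simp add: field_simps)
  moreover note touching_inequality_eps[OF C2u C2\<phi> z \<kappa> nz pde G le eq \<epsilon>, unfolded sym power2_norm_eq_inner[symmetric], folded f_def]
  moreover have "(norm (U z))\<^sup>2 = f" by (simp add: f_def power2_norm_eq_inner)
  ultimately have "2 * (G' z \<bullet> U z - \<kappa> * (((norm (L z *v U z))\<^sup>2 + (norm (L z *v U z))\<^sup>2) / f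
             - (U z \<bullet> (L z *v U z)) * (2 * (U z \<bullet> (L z *v U z))) / f\<^sup>2))
      + (2 * (\<Sum>i\<in>UNIV. (norm (L z *v axis i 1))\<^sup>2) - trace (H z) - 2 * \<epsilon> * real CARD('n)
        + (2 * \<kappa> * (norm (L z *v U z))\<^sup>2 / f - \<kappa> * (U z \<bullet> (H z *v U z)) / f - 2 * \<epsilon> * \<kappa>)) \<le> 0"
    by simp
  then have "?l \<le> ?r + \<epsilon> * (2 * (real CARD('n) + \<kappa>))"
    unfolding f_def[symmetric] by (simp add: algebra_simps power2_eq_square add_divide_distrib)
  also have "\<epsilon> * (2 * (real CARD('n) + \<kappa>)) \<le> \<epsilon> * c"
    using \<epsilon> by (intro mult_left_mono) (auto simp: c_def)
  also have "\<epsilon> * c = \<delta>" using c by (simp add: \<epsilon>_def)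
  finally show "?l \<le> ?r + \<delta>" by simp
qed

section \<open>The local gradient estimate\<close>

text \<open>Cauchy--Schwarz between the projection \<open>I - e e\<^sup>T\<close>, whose squared norm is \<open>n - 1\<close>, and the compression
  of \<open>A\<close> to the orthogonal complement of \<open>e\<close>.\<close>

lemma symmetric_trace_bound:
  fixes A :: "real ^ 'n ^ 'n" and e :: "real ^ 'n"
  assumes sym: "\<And>a b. a \<bullet> (A *v b) = b \<bullet> (A *v a)" and e: "e \<bullet> e = 1"
  shows "(trace A - e \<bullet> (A *v e))\<^sup>2
    \<le> (real CARD('n) - 1) * ((\<Sum>i\<in>UNIV. (norm (A *v axis i 1))\<^sup>2) - 2 * (norm (A *v e))\<^sup>2 + (e \<bullet> (A *v e))\<^sup>2)"
proof -
  define m where "m = A *v e"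
  define l where "l = e \<bullet> m"
  \<comment> \<open>Row by row, \<open>B\<close> is \<open>P A P\<close> for the projection
    \<open>P\<close> onto the complement of \<open>e\<close>, with \<open>m = A e\<close> and
    \<open>l = e \<bullet> A e\<close>.\<close>
  define B :: "real ^ 'n ^ 'n" where "B = (\<chi> i. A $ i - e $ i *\<^sub>R m - m $ i *\<^sub>R e + (l * e $ i) *\<^sub>R e)"
  define P :: "real ^ 'n ^ 'n" where "P = (\<chi> i. axis i 1 - e $ i *\<^sub>R e)"
  have Ai: "A $ i \<bullet> v = (A *v v) $ i" for i v by (simp add: matrix_vector_mul_component)
  have ax: "v \<bullet> axis i 1 = v $ i" "axis i 1 \<bullet> v = v $ i" for i and v :: "real ^ 'n"
    by (simp_all add: inner_axis inner_axis')
  have S: "(\<Sum>i\<in>UNIV. v $ i * w $ i) = v \<bullet> w" for v w :: "real ^ 'n"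
    by (simp add: inner_vec_def)
  have eAm: "e \<bullet> (A *v m) = m \<bullet> m" using sym[of e m] by (simp add: m_def)
  have rows: "(\<Sum>i\<in>UNIV. A $ i \<bullet> A $ i) = (\<Sum>i\<in>UNIV. (norm (A *v axis i 1))\<^sup>2)"
  proof -
    have "A *v axis i 1 = A $ i" for i
      unfolding vec_eq_iff using sym[of "axis _ 1" "axis i 1"]
      by (simp add: ax Ai[symmetric])
    then show ?thesis by (simp add: power2_norm_eq_inner)
  qed
  have "B \<bullet> P = trace A - l"
  proof -
    have "B \<bullet> P = (\<Sum>i\<in>UNIV. A $ i $ i - 2 * (e $ i * m $ i) + l * (e $ i * e $ i))"
      unfolding inner_vec_def[of B P] using e
      by (intro sum.cong refl)
        (simp add: B_def P_def inner_diff_left inner_diff_right inner_add_left ax Ai m_def[symmetric]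
          l_def[symmetric] inner_commute[of m e] algebra_simps)
    also have "\<dots> = trace A - 2 * l + l"
      unfolding sum.distrib sum_subtractf sum_distrib_left[symmetric] S
      by (simp add: trace_def l_def e)
    finally show ?thesis by simp
  qed
  moreover have "P \<bullet> P = real CARD('n) - 1"
  proof -
    have "P \<bullet> P = (\<Sum>i\<in>UNIV. 1 - e $ i * e $ i)"
      unfolding inner_vec_def[of P P] using e
      by (intro sum.cong refl)
        (simp add: P_def inner_diff_left inner_diff_right ax algebra_simps)
    then show ?thesis by (simp add: sum_subtractf S e)
  qed
  moreover have "B \<bullet> B = (\<Sum>i\<in>UNIV. A $ i \<bullet> A $ i) - 2 * (m \<bullet> m) + l\<^sup>2"
  proof -
    have "B \<bullet> B = (\<Sum>i\<in>UNIV. A $ i \<bullet> A $ i - 2 * (e $ i * (A *v m) $ i) - m $ i * m $ i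
        + (2 * l) * (e $ i * m $ i) + (m \<bullet> m - l\<^sup>2) * (e $ i * e $ i))"
      unfolding inner_vec_def[of B B]
    proof (intro sum.cong refl)
      fix i
      have "B $ i \<bullet> B $ i = A $ i \<bullet> A $ i - 2 * e $ i * (A $ i \<bullet> m) - 2 * m $ i * (A $ i \<bullet> e)
          + 2 * l * e $ i * (A $ i \<bullet> e) + (e $ i)\<^sup>2 * (m \<bullet> m) + 2 * e $ i * m $ i * (e \<bullet> m)
          - 2 * l * (e $ i)\<^sup>2 * (e \<bullet> m) + ((m $ i)\<^sup>2 - 2 * l * m $ i * e $ i + l\<^sup>2 * (e $ i)\<^sup>2) * (e \<bullet> e)"
        by (simp add: B_def inner_diff_left inner_diff_right inner_add_left inner_add_right
          inner_commute[of m e] inner_commute[of m "A $ i"] inner_commute[of e "A $ i"]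
          power2_eq_square algebra_simps)
      then show "B $ i \<bullet> B $ i = A $ i \<bullet> A $ i - 2 * (e $ i * (A *v m) $ i) - m $ i * m $ i
        + (2 * l) * (e $ i * m $ i) + (m \<bullet> m - l\<^sup>2) * (e $ i * e $ i)"
        unfolding e Ai m_def[symmetric] l_def[symmetric] by (simp add: power2_eq_square algebra_simps)
    qed
    also have "\<dots> = (\<Sum>i\<in>UNIV. A $ i \<bullet> A $ i) - 2 * (m \<bullet> m) - m \<bullet> m + 2 * l * l + (m \<bullet> m - l\<^sup>2)"
      unfolding sum.distrib sum_subtractf sum_distrib_left[symmetric] S eAm
      by (simp add: l_def e)
    finally show ?thesis by (simp add: power2_eq_square)
  qed
  moreover have "(B \<bullet> P)\<^sup>2 \<le> (B \<bullet> B) * (P \<bullet> P)" by (rule Cauchy_Schwarz_ineq)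
  ultimately show ?thesis
    by (simp add: rows power2_norm_eq_inner m_def[symmetric] l_def[symmetric] mult.commute)
qed

text \<open>With \<open>M\<close> the maximum of \<open>E^2 f\<close>, the function
  \<open>M / E^2\<close> lies above \<open>f\<close> in the ball and touches it at the maximum
  point, so it can serve as the \<phi> of \<open>touching_inequality\<close>. It blows up at the
  boundary, and all its derivatives are explicit.\<close>

lemma barrier_C2_data:
  fixes x0 :: "real ^ 'n" and \<rho> M :: real
  defines "E \<equiv> \<lambda>x. \<rho>\<^sup>2 - (x - x0) \<bullet> (x - x0)"
  defines "H \<equiv> \<lambda>x. (4 * M / E x ^ 3) *\<^sub>R mat 1 + (24 * M / E x ^ 4) *\<^sub>R (\<chi> i j. (x - x0) $ i * (x - x0) $ j)"
  shows "C2_data (ball x0 \<rho>) (\<lambda>x. M / (E x)\<^sup>2) (\<lambda>x. (4 * M / E x ^ 3) *\<^sub>R (x - x0)) H"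
    and "trace (H x) = 4 * M * real CARD('n) / E x ^ 3 + 24 * M * ((x - x0) \<bullet> (x - x0)) / E x ^ 4"
    and "v \<bullet> (H x *v v) = 4 * M * (v \<bullet> v) / E x ^ 3 + 24 * M * ((x - x0) \<bullet> v)\<^sup>2 / E x ^ 4"
    and "x \<in> ball x0 \<rho> \<Longrightarrow> E x > 0"
proof -
  have Epos: "E x > 0" if "x \<in> ball x0 \<rho>" for x
  proof -
    have "norm (x - x0) < \<rho>" using that by (simp add: dist_norm norm_minus_commute)
    then have "(norm (x - x0))\<^sup>2 < \<rho>\<^sup>2" by (intro power_strict_mono) auto
    then show ?thesis by (simp add: E_def power2_norm_eq_inner)
  qed
  then show "x \<in> ball x0 \<rho> \<Longrightarrow> E x > 0" .
  have Hv: "H x *v h = (4 * M / E x ^ 3) *\<^sub>R h + (24 * M * ((x - x0) \<bullet> h) / E x ^ 4) *\<^sub>R (x - x0)" for x h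
    unfolding H_def matrix_vector_mult_add_rdistrib scaleR_matrix_vector_assoc[symmetric] outer_product_mult_vec
    by simp
  show "v \<bullet> (H x *v v) = 4 * M * (v \<bullet> v) / E x ^ 3 + 24 * M * ((x - x0) \<bullet> v)\<^sup>2 / E x ^ 4"
    unfolding Hv by (simp add: inner_add_right inner_commute[of v "x - x0"] power2_eq_square)
  show "trace (H x) = 4 * M * real CARD('n) / E x ^ 3 + 24 * M * ((x - x0) \<bullet> (x - x0)) / E x ^ 4"
    by (simp add: H_def trace_def mat_def sum.distrib inner_vec_def sum_distrib_left sum_divide_distrib)
  have dE: "(E has_derivative (\<lambda>h. - 2 * ((x - x0) \<bullet> h))) (at x)" for x
    unfolding E_def by (auto intro!: derivative_eq_intros simp: inner_commute)
  have d1: "((\<lambda>x. M / (E x)\<^sup>2) has_derivative (\<lambda>h. ((4 * M / E x ^ 3) *\<^sub>R (x - x0)) \<bullet> h)) (at x)"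
    if "x \<in> ball x0 \<rho>" for x
  proof -
    have "((\<lambda>x. M / (E x)\<^sup>2) has_derivative (\<lambda>h. 4 * M / E x ^ 3 * ((x - x0) \<bullet> h))) (at x)"
      using Epos[OF that]
      by (auto intro!: derivative_eq_intros dE simp: fun_eq_iff power2_eq_square power3_eq_cube field_simps)
    then show ?thesis by simp
  qed
  have d2: "((\<lambda>x. (4 * M / E x ^ 3) *\<^sub>R (x - x0)) has_derivative (\<lambda>h. H x *v h)) (at x)"
    if "x \<in> ball x0 \<rho>" for x
  proof -
    have "((\<lambda>x. 4 * M / E x ^ 3) has_derivative (\<lambda>h. 24 * M * ((x - x0) \<bullet> h) / E x ^ 4)) (at x)"
      using Epos[OF that]
      by (auto intro!: derivative_eq_intros dE simp: fun_eq_iff power2_eq_square power3_eq_cube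
          power4_eq_xxxx field_simps)
    moreover have "((\<lambda>x. x - x0) has_derivative (\<lambda>h. h)) (at x)"
      by (auto intro!: derivative_eq_intros)
    ultimately show ?thesis unfolding Hv by (rule has_derivative_scaleR)
  qed
  have "continuous_on (ball x0 \<rho>) H"
    unfolding H_def E_def using Epos unfolding E_def
    by (intro continuous_intros) (fastforce)+
  then show "C2_data (ball x0 \<rho>) (\<lambda>x. M / (E x)\<^sup>2) (\<lambda>x. (4 * M / E x ^ 3) *\<^sub>R (x - x0)) H"
    unfolding C2_data_def by (intro conjI ballI open_ball d1 d2 \<open>continuous_on _ H\<close>)
qed

text \<open>Young's inequality puts half of \<open>D t^2\<close> against the cross term. The
  constant is kept explicit because the final exponent must be traced back to
  \<open>n, p, q, r\<close>.\<close>

lemma quadratic_absorption: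
  fixes t w D A K :: real
  assumes D: "D > 0" and ineq: "D * t\<^sup>2 \<le> A * t * w + K * w\<^sup>2"
  shows "t\<^sup>2 \<le> (2 / D * (K + A\<^sup>2 / (2 * D))) * w\<^sup>2"
proof -
  have "0 \<le> (D * t - A * w)\<^sup>2" by simp
  then have "2 * D * (A * t * w) \<le> D\<^sup>2 * t\<^sup>2 + A\<^sup>2 * w\<^sup>2"
    by (simp add: power2_eq_square algebra_simps)
  then have "A * t * w \<le> D / 2 * t\<^sup>2 + A\<^sup>2 / (2 * D) * w\<^sup>2"
    using D by (simp add: field_simps power2_eq_square)
  then have "D / 2 * t\<^sup>2 \<le> (K + A\<^sup>2 / (2 * D)) * w\<^sup>2"
    using ineq unfolding distrib_right by linarith
  then have "2 / D * (D / 2 * t\<^sup>2) \<le> 2 / D * ((K + A\<^sup>2 / (2 * D)) * w\<^sup>2)"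
    using D by (intro mult_left_mono) auto
  moreover have "2 / D * (D / 2 * t\<^sup>2) = t\<^sup>2" using D by simp
  ultimately show ?thesis by (simp only: mult.assoc)
qed

text \<open>At the maximum point \<open>f\<close> is \<open>|U|\<^sup>2\<close>, \<open>GU\<close> is the derivative of the right-hand side along \<open>U\<close>, \<open>S2\<close> and \<open>TL\<close>
  are the squared norm and the trace of the Hessian \<open>L\<close>, \<open>mm = |L e|\<^sup>2\<close> and \<open>l = e \<bullet> L e\<close>; the lower-order
  terms are \<open>(p - 1) f X\<close> and \<open>(p - 1) f Y\<close>, and \<open>w = \<rho> / E\<close> for the cutoff \<open>E\<close>.\<close>

lemma bernstein_algebra:
  fixes p q r n :: real and f l mm X Y w GU S2 TL \<delta> K1 :: real
  defines "P \<equiv> p - 1" and "\<kappa> \<equiv> p - 2"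
  defines "m1 \<equiv> (q - p + 2) / 2" and "m2 \<equiv> (2 - p) / 2"
  defines "D \<equiv> 2 * P\<^sup>2 * \<delta>" and "A \<equiv> 16 * P * (P + 1 + \<bar>m1\<bar> + \<bar>m2\<bar>)" and "K2 \<equiv> K1 + 24 * \<bar>\<kappa>\<bar>"
  assumes p: "p > 1" and n: "n \<ge> 2" and f: "f > 0" and w: "w \<ge> 0" and \<delta>: "\<delta> > 0"
    and main: "2 * GU + 2 * S2 - 2 * \<kappa> * mm + 4 * \<kappa> * l\<^sup>2 \<le> K1 * f * w\<^sup>2"
    and cs: "(TL - l)\<^sup>2 \<le> (n - 1) * (S2 - 2 * mm + l\<^sup>2)"
    and TL: "TL + \<kappa> * l = - P * f * (1 + X + Y)"
    and GU: "GU = - 2 * P * f * l - P * f * X * ((q - p + 1) * f + 2 * m1 * l)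
                - P * f * Y * ((r - p + 1) * f + 2 * m2 * l)"
    and mm: "mm \<le> 4 * f * w\<^sup>2" and l: "l\<^sup>2 \<le> mm"
    and cond: "(1 + (X + Y)\<^sup>2) / (n - 1) + ((n + 1) / (n - 1) - q / (p - 1)) * X
        + ((n + 1) / (n - 1) - r / (p - 1)) * Y \<ge> \<delta> * (1 + X\<^sup>2 + Y\<^sup>2)"
  shows "f \<le> (2 / D * (K2 + A\<^sup>2 / (2 * D))) * w\<^sup>2"
proof -
  have P: "P > 0" using p by (simp add: P_def)
  have n1: "n - 1 \<ge> 1" using n by simp
  \<comment> \<open>\<open>V\<close> measures the unknown size of \<open>(1, X, Y)\<close>. The good
    term grows like \<open>f V^2\<close> and the error terms only like \<open>sqrt f V\<close>, so
    the estimate is uniform in \<open>X\<close> and \<open>Y\<close>.\<close>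
  define V where "V = sqrt (1 + X\<^sup>2 + Y\<^sup>2)"
  have V2: "V\<^sup>2 = 1 + X\<^sup>2 + Y\<^sup>2" by (simp add: V_def add_nonneg_nonneg)
  have V0: "V \<ge> 0" by (simp add: V_def)
  have mm0: "mm \<ge> 0" using l by (meson order_trans zero_le_power2)
  have S2: "(TL - l)\<^sup>2 / (n - 1) \<le> S2"
  proof -
    have "(TL - l)\<^sup>2 \<le> (n - 1) * S2"
      using cs l mm0 n1 mult_left_mono[of "S2 - 2 * mm + l\<^sup>2" S2 "n - 1"] by linarith
    then show ?thesis using n1 by (simp add: field_simps)
  qed
  have "\<kappa> * mm \<le> \<bar>\<kappa>\<bar> * (4 * f * w\<^sup>2)" "- (\<kappa> * l\<^sup>2) \<le> \<bar>\<kappa>\<bar> * (4 * f * w\<^sup>2)"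
  proof -
    have "\<kappa> * mm \<le> \<bar>\<kappa>\<bar> * mm" "- (\<kappa> * l\<^sup>2) \<le> \<bar>\<kappa>\<bar> * l\<^sup>2"
      using mult_right_mono[of \<kappa> "\<bar>\<kappa>\<bar>" mm] mult_right_mono[of "-\<kappa>" "\<bar>\<kappa>\<bar>" "l\<^sup>2"] mm0 by auto
    moreover have "\<bar>\<kappa>\<bar> * mm \<le> \<bar>\<kappa>\<bar> * (4 * f * w\<^sup>2)" "\<bar>\<kappa>\<bar> * l\<^sup>2 \<le> \<bar>\<kappa>\<bar> * (4 * f * w\<^sup>2)"
      using mm l by (intro mult_left_mono; simp)+
    ultimately show "\<kappa> * mm \<le> \<bar>\<kappa>\<bar> * (4 * f * w\<^sup>2)" "- (\<kappa> * l\<^sup>2) \<le> \<bar>\<kappa>\<bar> * (4 * f * w\<^sup>2)"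
      by linarith+
  qed
  \<comment> \<open>The terms \<open>- 2 \<kappa> mm\<close> and \<open>4 \<kappa> l^2\<close> cost
    8 and 16 times \<open>|\<kappa>| f w^2\<close>, whence the 24 in \<open>K2\<close>.\<close>
  then have 1: "2 * GU + 2 * ((TL - l)\<^sup>2 / (n - 1)) \<le> K2 * f * w\<^sup>2"
    using main S2 unfolding K2_def by (simp add: algebra_simps)
  have TLl: "TL - l = - P * (f * (1 + X + Y) + l)"
    using TL by (simp add: P_def \<kappa>_def algebra_simps)
  have "(TL - l)\<^sup>2 \<ge> P\<^sup>2 * (f\<^sup>2 * (1 + X + Y)\<^sup>2 + 2 * f * (1 + X + Y) * l)"
  proof -
    have "(TL - l)\<^sup>2 = P\<^sup>2 * (f\<^sup>2 * (1 + X + Y)\<^sup>2 + 2 * f * (1 + X + Y) * l) + (P * l)\<^sup>2"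
      unfolding TLl by (simp add: power2_eq_square algebra_simps)
    then show ?thesis by simp
  qed
  then have 2: "(TL - l)\<^sup>2 / (n - 1) \<ge> P\<^sup>2 * f\<^sup>2 * ((1 + X + Y)\<^sup>2 / (n - 1)) + 2 * P\<^sup>2 * f * l * ((1 + X + Y) / (n - 1))"
  proof -
    have "P\<^sup>2 * f\<^sup>2 * (c\<^sup>2 / (n - 1)) + 2 * P\<^sup>2 * f * l * (c / (n - 1)) = (P\<^sup>2 * (f\<^sup>2 * c\<^sup>2 + 2 * f * c * l)) / (n - 1)" for c
      by (simp add: add_divide_distrib distrib_left mult_ac)
    then show ?thesis using n1 divide_right_mono[OF \<open>(TL - l)\<^sup>2 \<ge> _\<close>, of "n - 1"] by simp
  qed
  \<comment> \<open>This is the origin of the critical ratio: differentiating the lower-order terms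
    along \<open>U\<close> yields 1 - q / (p - 1) and 1 - r / (p - 1), and the cross terms of the
    square add 2 / (n - 1) to each.\<close>
  have qP: "q - p + 1 = P * (q / (p - 1) - 1)" "r - p + 1 = P * (r / (p - 1) - 1)"
    using p by (simp_all add: P_def field_simps)
  have e1: "(1 + X + Y)\<^sup>2 / (n - 1) - (q / (p - 1) - 1) * X - (r / (p - 1) - 1) * Y
     = (1 + (X + Y)\<^sup>2) / (n - 1) + ((n + 1) / (n - 1) - q / (p - 1)) * X
        + ((n + 1) / (n - 1) - r / (p - 1)) * Y"
  proof -
    have "(n + 1) / (n - 1) = 1 + 2 / (n - 1)" using n1 by (simp add: field_simps)
    moreover have "(1 + X + Y)\<^sup>2 / (n - 1) = (1 + (X + Y)\<^sup>2) / (n - 1) + 2 / (n - 1) * X + 2 / (n - 1) * Y"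
      by (simp add: power2_eq_square algebra_simps add_divide_distrib)
    ultimately show ?thesis by (simp add: algebra_simps)
  qed
  \<comment> \<open>\<open>Z\<close> collects the terms linear in \<open>l\<close>. Since
    \<open>l\<close> is controlled by the gradient of the barrier, they are of lower order.\<close>
  define Z where "Z = P * ((1 + X + Y) / (n - 1)) - 1 - m1 * X - m2 * Y"
  have "2 * P\<^sup>2 * f\<^sup>2 * ((1 + X + Y)\<^sup>2 / (n - 1) - (q / (p - 1) - 1) * X - (r / (p - 1) - 1) * Y)
     + 4 * P * f * l * Z = 2 * GU + 2 * (P\<^sup>2 * f\<^sup>2 * ((1 + X + Y)\<^sup>2 / (n - 1))
       + 2 * P\<^sup>2 * f * l * ((1 + X + Y) / (n - 1)))"
    unfolding GU Z_def qP by (simp add: power2_eq_square algebra_simps)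
  also have "\<dots> \<le> 2 * GU + 2 * ((TL - l)\<^sup>2 / (n - 1))"
    by (intro add_left_mono mult_left_mono 2) simp
  also note 1
  finally have 3: "2 * P\<^sup>2 * f\<^sup>2 * ((1 + X + Y)\<^sup>2 / (n - 1) - (q / (p - 1) - 1) * X - (r / (p - 1) - 1) * Y)
     + 4 * P * f * l * Z \<le> K2 * f * w\<^sup>2" .
  have "2 * P\<^sup>2 * f\<^sup>2 * (\<delta> * V\<^sup>2) \<le> 2 * P\<^sup>2 * f\<^sup>2 * ((1 + X + Y)\<^sup>2 / (n - 1) - (q / (p - 1) - 1) * X - (r / (p - 1) - 1) * Y)"
    unfolding e1 V2 using cond by (intro mult_left_mono) auto
  with 3 have "f * (D * (f * V\<^sup>2)) \<le> f * (K2 * w\<^sup>2 - 4 * P * l * Z)"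
    unfolding D_def by (simp add: algebra_simps power2_eq_square)
  then have 4: "D * (f * V\<^sup>2) \<le> K2 * w\<^sup>2 - 4 * P * l * Z" using f by simp
  have XV: "\<bar>X\<bar> \<le> V" "\<bar>Y\<bar> \<le> V" "1 \<le> V"
    unfolding V_def by (intro real_le_rsqrt; simp)+
  have lb: "\<bar>l\<bar> \<le> 2 * (sqrt f * w)"
  proof -
    have "l\<^sup>2 \<le> (2 * (sqrt f * w))\<^sup>2"
      using l mm f by (simp add: power_mult_distrib)
    then show ?thesis using w f by (metis abs_le_square_iff abs_of_nonneg mult_nonneg_nonneg real_sqrt_ge_zero less_imp_le zero_le_numeral)
  qed
  have Zb: "\<bar>Z\<bar> \<le> 2 * (P + 1 + \<bar>m1\<bar> + \<bar>m2\<bar>) * V"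
  proof -
    have s: "\<bar>1 + X + Y\<bar> \<le> 2 * V"
    proof -
      have "(1 + X + Y)\<^sup>2 \<le> 3 * V\<^sup>2"
        unfolding V2 using sum_squares_ge_zero[of "1 - X" "1 - Y"] zero_le_power2[of "X - Y"]
          zero_le_power2[of "1 - X"] zero_le_power2[of "1 - Y"]
        by (simp add: power2_eq_square algebra_simps)
      also have "\<dots> \<le> (2 * V)\<^sup>2" by (simp add: power_mult_distrib)
      finally show ?thesis using V0 by (metis abs_le_square_iff abs_of_nonneg mult_nonneg_nonneg zero_le_numeral)
    qed
    have "\<bar>(1 + X + Y) / (n - 1)\<bar> \<le> \<bar>1 + X + Y\<bar> / 1"
      unfolding abs_divide using n1 by (intro frac_le) auto
    then have "P * \<bar>(1 + X + Y) / (n - 1)\<bar> \<le> P * (2 * V)"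
      using s P by (intro mult_left_mono) auto
    moreover have "\<bar>m1 * X\<bar> \<le> \<bar>m1\<bar> * V" "\<bar>m2 * Y\<bar> \<le> \<bar>m2\<bar> * V"
      using XV by (auto simp: abs_mult intro!: mult_left_mono)
    moreover have "\<bar>P * ((1 + X + Y) / (n - 1))\<bar> = P * \<bar>(1 + X + Y) / (n - 1)\<bar>"
      using P by (simp add: abs_mult)
    ultimately have "\<bar>Z\<bar> \<le> P * (2 * V) + V + \<bar>m1\<bar> * V + \<bar>m2\<bar> * V"
      unfolding Z_def using XV(3) by linarith
    also have "\<dots> \<le> 2 * (P + 1 + \<bar>m1\<bar> + \<bar>m2\<bar>) * V"
      using V0 mult_nonneg_nonneg[of "\<bar>m1\<bar>" V] mult_nonneg_nonneg[of "\<bar>m2\<bar>" V] by (simp add: algebra_simps)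
    finally show ?thesis .
  qed
  have "- (l * Z) \<le> \<bar>l\<bar> * \<bar>Z\<bar>" by (metis abs_ge_minus_self abs_mult)
  also have "\<dots> \<le> (2 * (sqrt f * w)) * (2 * (P + 1 + \<bar>m1\<bar> + \<bar>m2\<bar>) * V)"
    using lb Zb f w by (intro mult_mono) auto
  finally have "4 * P * (- (l * Z)) \<le> 4 * P * ((2 * (sqrt f * w)) * (2 * (P + 1 + \<bar>m1\<bar> + \<bar>m2\<bar>) * V))"
    using P by (intro mult_left_mono) auto
  also have "\<dots> = A * (sqrt f * V) * w" unfolding A_def by (simp add: algebra_simps)
  finally have "D * (sqrt f * V)\<^sup>2 \<le> A * (sqrt f * V) * w + K2 * w\<^sup>2"
    using 4 f by (simp add: power_mult_distrib)
  moreover have "D > 0" using P \<delta> by (simp add: D_def)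
  ultimately have "(sqrt f * V)\<^sup>2 \<le> (2 / D * (K2 + A\<^sup>2 / (2 * D))) * w\<^sup>2"
    by (intro quadratic_absorption)
  moreover have "f * 1 \<le> (sqrt f * V)\<^sup>2"
    using f V2 by (simp add: power_mult_distrib)
  ultimately show ?thesis by simp
qed

text \<open>This is \<open>2 / D * (K2 + A^2 / (2 * D))\<close> of \<open>bernstein_algebra\<close>,
  with the value of \<open>K1\<close> that the barrier produces. The parameters \<open>b\<close>,
  \<open>c\<close> and \<open>r\<close> can influence it only through the choice of
  \<delta>.\<close>

definition bernstein_const :: "real \<Rightarrow> real \<Rightarrow> real \<Rightarrow> real \<Rightarrow> real" where
  "bernstein_const n p q \<delta> =
    2 / (2 * (p - 1)\<^sup>2 * \<delta>) *
      (4 * (n + \<bar>p - 2\<bar>) + 24 * (1 + \<bar>p - 2\<bar>) + 24 * \<bar>p - 2\<bar> +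
        (16 * (p - 1) * (p - 1 + 1 + \<bar>(q - p + 2) / 2\<bar> + \<bar>(2 - p) / 2\<bar>))\<^sup>2 / (2 * (2 * (p - 1)\<^sup>2 * \<delta>)))"

lemma C2_data_gradient_square:
  assumes C2: "C2_data S u U L" and x: "x \<in> S"
  shows "((\<lambda>x. U x \<bullet> U x) has_derivative (\<lambda>h. 2 * ((L x *v U x) \<bullet> h))) (at x)"
proof -
  have "((\<lambda>x. U x \<bullet> U x) has_derivative (\<lambda>h. U x \<bullet> (L x *v h) + (L x *v h) \<bullet> U x)) (at x)"
    by (rule has_derivative_inner[OF C2_dataD(6)[OF C2 x] C2_dataD(6)[OF C2 x]])
  moreover have "U x \<bullet> (L x *v h) + (L x *v h) \<bullet> U x = 2 * ((L x *v U x) \<bullet> h)" for h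
    using C2_data_symmetric[OF C2 x, of "U x" h] by (simp add: inner_commute)
  ultimately show ?thesis by simp
qed

lemma exp_powr_has_derivative:
  fixes x :: "real ^ 'n"
  assumes C2: "C2_data S u U L" and x: "x \<in> S" "U x \<noteq> 0"
  shows "((\<lambda>x. k * exp (s * u x) * (U x \<bullet> U x) powr m) has_derivative
    (\<lambda>h. ((k * exp (s * u x) * (U x \<bullet> U x) powr m) *\<^sub>R
       (s *\<^sub>R U x + (2 * m / (U x \<bullet> U x)) *\<^sub>R (L x *v U x))) \<bullet> h)) (at x)"
proof -
  note f = C2_data_gradient_square[OF C2 x(1)]
  have pos: "U x \<bullet> U x > 0" using x by simp
  have ex: "((\<lambda>x. exp (s * u x)) has_derivative (\<lambda>h. exp (s * u x) * (s * (U x \<bullet> h)))) (at x)"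
    using C2_dataD(5)[OF C2 x(1)] by (auto intro!: derivative_eq_intros)
  have "((\<lambda>x. k * exp (s * u x) * (U x \<bullet> U x) powr m) has_derivative
    (\<lambda>h. k * exp (s * u x) * ((U x \<bullet> U x) powr m * (0 * ln (U x \<bullet> U x) + 2 * ((L x *v U x) \<bullet> h) * m / (U x \<bullet> U x)))
      + k * (exp (s * u x) * (s * (U x \<bullet> h))) * (U x \<bullet> U x) powr m)) (at x)"
    by (intro has_derivative_mult has_derivative_powr f pos has_derivative_const has_derivative_mult_right
        ex UNIV_I)
  then show ?thesis
    by (rule has_derivative_eq_rhs) (simp add: fun_eq_iff inner_add_left algebra_simps)
qed

text \<open>The bound is invariant under scaling, which is what a rate of \<open>C / |x|\<close>
  requires. As \<open>cond\<close> is assumed for all \<open>t1, t2 \<ge> 0\<close>, neither the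
  size of \<open>u\<close> nor that of \<open>b\<close> and \<open>c\<close> enters the
  constant.\<close>

lemma log_gradient_bound:
  fixes x0 :: "real ^ 'n" and u :: "real ^ 'n \<Rightarrow> real" and p q r b c \<delta> :: real
  defines "n \<equiv> real CARD('n)"
  assumes C2: "C2_data S u U L" and sub: "cball x0 \<rho> \<subseteq> S" and \<rho>: "\<rho> > 0" and p: "p > 1"
    and n: "n \<ge> 2" and \<delta>: "\<delta> > 0"
    and pde: "\<And>x. x \<in> S \<Longrightarrow> U x \<noteq> 0 \<Longrightarrow>
      trace (L x) + (p - 2) * (U x \<bullet> (L x *v U x)) / (U x \<bullet> U x)
       = - (p - 1) * (U x \<bullet> U x) - b * exp ((q - p + 1) * u x) * (U x \<bullet> U x) powr ((q - p + 2) / 2)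
         - c * exp ((r - p + 1) * u x) * (U x \<bullet> U x) powr ((2 - p) / 2)"
    and cond: "\<And>t1 t2. t1 \<ge> 0 \<Longrightarrow> t2 \<ge> 0 \<Longrightarrow>
      (1 + (b * t1 + c * t2)\<^sup>2) / (n - 1) + ((n + 1) / (n - 1) - q / (p - 1)) * (b * t1)
        + ((n + 1) / (n - 1) - r / (p - 1)) * (c * t2) \<ge> \<delta> * (1 + (b * t1)\<^sup>2 + (c * t2)\<^sup>2)"
  shows "(norm (U x0) * \<rho>)\<^sup>2 \<le> bernstein_const n p q \<delta>"
proof (cases "U x0 = 0")
  case True
  have "bernstein_const n p q \<delta> \<ge> 0"
    unfolding bernstein_const_def using n p \<delta>
    by (intro mult_nonneg_nonneg add_nonneg_nonneg divide_nonneg_nonneg) auto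
  then show ?thesis using True by simp
next
  case False
  define f where "f x = U x \<bullet> U x" for x
  define E where "E x = \<rho>\<^sup>2 - (x - x0) \<bullet> (x - x0)" for x
  define F where "F x = (E x)\<^sup>2 * f x" for x
  have Eball: "E x > 0" if "x \<in> ball x0 \<rho>" for x
    using barrier_C2_data(4)[of x x0 \<rho>] that by (simp add: E_def)
  have "\<exists>z\<in>cball x0 \<rho>. \<forall>y\<in>cball x0 \<rho>. F y \<le> F z"
  proof (rule continuous_attains_sup)
    show "continuous_on (cball x0 \<rho>) F"
      unfolding F_def E_def f_def using continuous_on_subset[OF C2_dataD(3)[OF C2] sub]
      by (intro continuous_intros) auto
  qed (use \<rho> in auto)
  then obtain z where z: "z \<in> cball x0 \<rho>" "\<And>y. y \<in> cball x0 \<rho> \<Longrightarrow> F y \<le> F z" by blast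
  have "F x0 > 0" using False \<rho> by (simp add: F_def E_def f_def)
  then have Fz: "F z > 0" using z(2)[of x0] \<rho> by simp
  then have Ez0: "E z \<noteq> 0" and fz: "f z > 0" and Uz: "U z \<noteq> 0"
    by (auto simp: F_def f_def zero_less_mult_iff)
  have zb: "z \<in> ball x0 \<rho>"
  proof (rule ccontr)
    assume "z \<notin> ball x0 \<rho>"
    then have "dist x0 z = \<rho>" using z(1) by auto
    then have "(norm (z - x0))\<^sup>2 = \<rho>\<^sup>2" by (simp add: dist_norm norm_minus_commute)
    then show False using Ez0 by (simp add: E_def power2_norm_eq_inner)
  qed
  then have Ez: "E z > 0" by (rule Eball)
  \<comment> \<open>An open neighbourhood of \<open>z\<close> without critical points: there the
    equation holds and the powers of \<open>U x \<bullet> U x\<close> are differentiable, whatever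
    the sign of their exponents.\<close>
  define T where "T = ball x0 \<rho> \<inter> (S \<inter> U -` (- {0}))"
  have "open T" unfolding T_def
    by (intro open_Int open_ball continuous_open_preimage C2_dataD(1,3)[OF C2]) auto
  have zT: "z \<in> T" using zb z(1) sub Uz by (auto simp: T_def)
  have C2T: "C2_data T u U L" by (rule C2_data_subset[OF C2 _ \<open>open T\<close>]) (auto simp: T_def)
  define M where "M = F z"
  define P where "P x = (4 * M / E x ^ 3) *\<^sub>R (x - x0)" for x
  define H :: "real ^ 'n \<Rightarrow> real ^ 'n ^ 'n" where
    "H x = (4 * M / E x ^ 3) *\<^sub>R mat 1 + (24 * M / E x ^ 4) *\<^sub>R (\<chi> i j. (x - x0) $ i * (x - x0) $ j)" for x
  have C2\<phi>: "C2_data T (\<lambda>x. M / (E x)\<^sup>2) P H"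
    using barrier_C2_data(1)[of x0 \<rho> M] unfolding P_def[abs_def] H_def[abs_def] E_def
    by (rule C2_data_subset) (use \<open>open T\<close> in \<open>auto simp: T_def\<close>)
  have trH: "trace (H z) = 4 * M * n / E z ^ 3 + 24 * M * ((z - x0) \<bullet> (z - x0)) / E z ^ 4"
    using barrier_C2_data(2)[where x=z and ?x0.0=x0 and \<rho>=\<rho> and M=M] by (simp add: H_def E_def n_def)
  have vH: "v \<bullet> (H z *v v) = 4 * M * (v \<bullet> v) / E z ^ 3 + 24 * M * ((z - x0) \<bullet> v)\<^sup>2 / E z ^ 4" for v
    using barrier_C2_data(3)[where x=z and ?x0.0=x0 and \<rho>=\<rho> and M=M and v=v] by (simp add: H_def E_def)
  have le: "U x \<bullet> U x \<le> M / (E x)\<^sup>2" if "x \<in> T" for x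
    using z(2)[of x] Eball[of x] that by (auto simp: T_def M_def F_def f_def field_simps)
  have eq: "M / (E z)\<^sup>2 = U z \<bullet> U z" using Ez by (simp add: M_def F_def f_def)
  define s1 where "s1 = q - p + 1"
  define s2 where "s2 = r - p + 1"
  define m1 where "m1 = (q - p + 2) / 2"
  define m2 where "m2 = (2 - p) / 2"
  define T1 where "T1 x = b * exp (s1 * u x) * (U x \<bullet> U x) powr m1" for x
  define T2 where "T2 x = c * exp (s2 * u x) * (U x \<bullet> U x) powr m2" for x
  define G where "G x = - (p - 1) * (U x \<bullet> U x) - T1 x - T2 x" for x
  define G' where "G' x = - (2 * (p - 1)) *\<^sub>R (L x *v U x) - T1 x *\<^sub>R (s1 *\<^sub>R U x + (2 * m1 / (U x \<bullet> U x)) *\<^sub>R (L x *v U x))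
     - T2 x *\<^sub>R (s2 *\<^sub>R U x + (2 * m2 / (U x \<bullet> U x)) *\<^sub>R (L x *v U x))" for x
  have TU: "x \<in> S" "U x \<noteq> 0" if "x \<in> T" for x using that by (auto simp: T_def)
  have pdeT: "trace (L x) + (p - 2) * (U x \<bullet> (L x *v U x)) / (U x \<bullet> U x) = G x" if "x \<in> T" for x
    using pde[OF TU[OF that]] by (simp add: G_def T1_def T2_def s1_def s2_def m1_def m2_def)
  have symL: "v \<bullet> (L x *v w) = w \<bullet> (L x *v v)" if "x \<in> T" for x v w
    by (rule C2_data_symmetric[OF C2T that])
  note df = C2_data_gradient_square[OF C2T]
  have G1: "(G has_derivative (\<lambda>h. G' x \<bullet> h)) (at x)" if "x \<in> T" for x
  proof -
    have "(G has_derivative (\<lambda>h. - (p - 1) * (2 * ((L x *v U x) \<bullet> h))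
        - (T1 x *\<^sub>R (s1 *\<^sub>R U x + (2 * m1 / (U x \<bullet> U x)) *\<^sub>R (L x *v U x))) \<bullet> h
        - (T2 x *\<^sub>R (s2 *\<^sub>R U x + (2 * m2 / (U x \<bullet> U x)) *\<^sub>R (L x *v U x))) \<bullet> h)) (at x)"
      unfolding G_def[abs_def] T1_def T2_def
      by (intro has_derivative_diff has_derivative_mult_right df[OF that]
          exp_powr_has_derivative[OF C2T that TU(2)[OF that]])
    then show ?thesis by (rule has_derivative_eq_rhs) (simp add: G'_def inner_diff_left algebra_simps)
  qed
  have G2: "continuous_on T G'"
    unfolding G'_def T1_def T2_def
    using C2_dataD(2,3,4)[OF C2T] TU
    by (intro continuous_intros continuous_on_matrix_vector_mult) auto
  have touch: "2 * (G' z \<bullet> U z) + 2 * (\<Sum>i\<in>UNIV. (norm (L z *v axis i 1))\<^sup>2)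
      - 2 * (p - 2) * (norm (L z *v U z))\<^sup>2 / (U z \<bullet> U z) + 4 * (p - 2) * (U z \<bullet> (L z *v U z))\<^sup>2 / (U z \<bullet> U z)\<^sup>2
      \<le> trace (H z) + (p - 2) * (U z \<bullet> (H z *v U z)) / (U z \<bullet> U z)"
    by (rule touching_inequality[OF C2T C2\<phi> zT _ TU(2) pdeT G1 G2 le eq]) (use p in auto)
  \<comment> \<open>The difference of \<open>f\<close> and the barrier is maximal at
    \<open>z\<close>, so their gradients \<open>2 L U\<close> and \<open>P\<close> agree there. Thus
    \<open>L z *v U z\<close> is known although the full Hessian is not.\<close>
  have LU: "L z *v U z = (2 * f z / E z) *\<^sub>R (z - x0)"
  proof -
    have "((\<lambda>x. U x \<bullet> U x - M / (E x)\<^sup>2) has_derivative (\<lambda>h. 2 * ((L z *v U z) \<bullet> h) - P z \<bullet> h)) (at z)"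
      by (intro has_derivative_diff df C2_dataD(5)[OF C2\<phi>] zT)
    then have "(\<lambda>h. 2 * ((L z *v U z) \<bullet> h) - P z \<bullet> h) = (\<lambda>h. 0)"
      by (rule differential_zero_maxmin[OF zT \<open>open T\<close>]) (use le eq in auto)
    then have "2 * ((L z *v U z) \<bullet> h) - P z \<bullet> h = 0" for h by meson
    then have "(2 *\<^sub>R (L z *v U z) - P z) \<bullet> h = 0" for h by (simp add: inner_diff_left)
    then have "2 *\<^sub>R (L z *v U z) = P z" by (metis eq_iff_diff_eq_0 inner_eq_zero_iff)
    then have "L z *v U z = (1 / 2) *\<^sub>R P z" by (simp flip: \<open>2 *\<^sub>R _ = P z\<close>)
    also have "\<dots> = (2 * f z / E z) *\<^sub>R (z - x0)"
      using Ez by (simp add: P_def M_def F_def power2_eq_square power3_eq_cube)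
    finally show ?thesis .
  qed
  define w where "w = \<rho> / E z"
  define d2 where "d2 = (z - x0) \<bullet> (z - x0)"
  have d2: "0 \<le> d2" "d2 \<le> \<rho>\<^sup>2" using Ez by (auto simp: d2_def E_def)
  have dw: "d2 / (E z)\<^sup>2 \<le> w\<^sup>2"
    unfolding w_def power_divide using d2 by (intro divide_right_mono) auto
  have Ew: "1 / E z \<le> w\<^sup>2"
  proof -
    have "E z \<le> \<rho>\<^sup>2" by (simp add: E_def)
    then show ?thesis using Ez by (simp add: w_def power_divide power2_eq_square[of "E z"] field_simps)
  qed
  define e where "e = (1 / sqrt (f z)) *\<^sub>R U z"
  have sq: "sqrt (f z) * sqrt (f z) = f z" using fz by simp
  have e: "e \<bullet> e = 1" using fz sq by (simp add: e_def f_def[symmetric])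
  have Le: "L z *v e = (1 / sqrt (f z)) *\<^sub>R (L z *v U z)" by (simp add: e_def matrix_vector_mult_scaleR)
  define l where "l = e \<bullet> (L z *v e)"
  define mm where "mm = (norm (L z *v e))\<^sup>2"
  have l: "l = U z \<bullet> (L z *v U z) / f z" using sq by (simp add: l_def Le) (simp add: e_def)
  have mm: "mm = (norm (L z *v U z))\<^sup>2 / f z" using fz by (simp add: mm_def Le power_mult_distrib power_divide)
  have mm': "mm = 4 * f z * (d2 / (E z)\<^sup>2)"
  proof -
    have "(norm (L z *v U z))\<^sup>2 = (2 * f z / E z)\<^sup>2 * d2"
      unfolding LU norm_scaleR power_mult_distrib power2_abs power2_norm_eq_inner d2_def ..
    then show ?thesis
      unfolding mm using fz Ez by (simp add: power2_eq_square field_simps)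
  qed
  have "norm e = 1" using e by (simp add: norm_eq_sqrt_inner)
  then have "\<bar>l\<bar> \<le> norm (L z *v e)"
    using Cauchy_Schwarz_ineq2[of e "L z *v e"] by (simp add: l_def)
  then have lmm: "l\<^sup>2 \<le> mm" unfolding mm_def by (metis abs_ge_zero power2_abs power_mono)
  \<comment> \<open>The 4 and the 24 come from the Hessian of the barrier, as \<open>1 / E z\<close>
    and \<open>d2 / E z ^ 2\<close> are both at most \<open>w^2\<close>. In each pair the first
    summand belongs to the trace, the second to the direction of \<open>U\<close>.\<close>
  define K1 where "K1 = 4 * (n + \<bar>p - 2\<bar>) + 24 * (1 + \<bar>p - 2\<bar>)"
  have rhs: "trace (H z) + (p - 2) * (U z \<bullet> (H z *v U z)) / f z \<le> K1 * f z * w\<^sup>2"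
  proof -
    define t where "t = ((z - x0) \<bullet> U z)\<^sup>2 / f z"
    have t: "0 \<le> t" "t \<le> d2"
      using Cauchy_Schwarz_ineq[of "z - x0" "U z"] fz
      by (auto simp: t_def d2_def f_def[symmetric] divide_simps)
    have Mz: "M = f z * E z * E z" by (simp add: M_def F_def power2_eq_square)
    have "trace (H z) + (p - 2) * (U z \<bullet> (H z *v U z)) / f z
      = f z * (4 * n * (1 / E z) + 24 * (d2 / (E z)\<^sup>2) + (p - 2) * (4 * (1 / E z) + 24 * (t / (E z)\<^sup>2)))"
      unfolding trH vH d2_def[symmetric] f_def[symmetric] t_def Mz using fz Ez
      by (simp add: power2_eq_square power3_eq_cube power4_eq_xxxx field_simps)
    also have "\<dots> \<le> f z * (4 * n * w\<^sup>2 + 24 * w\<^sup>2 + \<bar>p - 2\<bar> * (4 * w\<^sup>2 + 24 * w\<^sup>2))"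
    proof (intro mult_left_mono add_mono)
      have tw: "t / (E z)\<^sup>2 \<le> w\<^sup>2" using t dw divide_right_mono[OF t(2), of "(E z)\<^sup>2"] by simp
      have "0 \<le> 4 * (1 / E z) + 24 * (t / (E z)\<^sup>2)" using t Ez by simp
      then have "(p - 2) * (4 * (1 / E z) + 24 * (t / (E z)\<^sup>2)) \<le> \<bar>p - 2\<bar> * (4 * (1 / E z) + 24 * (t / (E z)\<^sup>2))"
        by (intro mult_right_mono) auto
      also have "\<dots> \<le> \<bar>p - 2\<bar> * (4 * w\<^sup>2 + 24 * w\<^sup>2)"
        using tw Ew by (intro mult_left_mono) auto
      finally show "(p - 2) * (4 * (1 / E z) + 24 * (t / (E z)\<^sup>2)) \<le> \<bar>p - 2\<bar> * (4 * w\<^sup>2 + 24 * w\<^sup>2)" .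
    qed (use Ew dw fz n in auto)
    also have "\<dots> = K1 * f z * w\<^sup>2" by (simp add: K1_def algebra_simps)
    finally show ?thesis .
  qed
  \<comment> \<open>Normalizing by \<open>(p - 1) f\<close> gives \<open>X = b t1\<close> and
    \<open>Y = c t2\<close> with nonnegative \<open>t1, t2\<close>, the form in which
    \<open>cond\<close> is stated.\<close>
  define t1 where "t1 = exp (s1 * u z) * f z powr m1 / ((p - 1) * f z)"
  define t2 where "t2 = exp (s2 * u z) * f z powr m2 / ((p - 1) * f z)"
  have TX: "T1 z = (p - 1) * f z * (b * t1)" "T2 z = (p - 1) * f z * (c * t2)"
    using p fz by (simp_all add: T1_def T2_def t1_def t2_def f_def[symmetric])
  have Ul: "U z \<bullet> (L z *v U z) = f z * l" using fz by (simp add: l)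
  have GU: "G' z \<bullet> U z = - 2 * (p - 1) * f z * l
     - (p - 1) * f z * (b * t1) * ((q - p + 1) * f z + 2 * ((q - p + 2) / 2) * l)
     - (p - 1) * f z * (c * t2) * ((r - p + 1) * f z + 2 * ((2 - p) / 2) * l)"
  proof -
    have "G' z \<bullet> U z = - (2 * (p - 1)) * (f z * l) - T1 z * (s1 * f z + (2 * m1 / f z) * (f z * l))
       - T2 z * (s2 * f z + (2 * m2 / f z) * (f z * l))"
      unfolding G'_def inner_diff_left inner_scaleR_left inner_add_left
        inner_commute[of "L z *v U z" "U z"] Ul f_def[symmetric] ..
    also have "\<dots> = - 2 * (p - 1) * f z * l - T1 z * (s1 * f z + 2 * m1 * l) - T2 z * (s2 * f z + 2 * m2 * l)"
      using fz by (simp add: mult.assoc)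
    finally show ?thesis unfolding TX s1_def s2_def m1_def m2_def .
  qed
  have "f z \<le> bernstein_const n p q \<delta> * w\<^sup>2"
    unfolding bernstein_const_def K1_def[symmetric]
  proof (rule bernstein_algebra[OF p n fz _ \<delta> _ _ _ GU])
    show "w \<ge> 0" using \<rho> Ez by (simp add: w_def)
    show "2 * (G' z \<bullet> U z) + 2 * (\<Sum>i\<in>UNIV. (norm (L z *v axis i 1))\<^sup>2) - 2 * (p - 2) * mm + 4 * (p - 2) * l\<^sup>2
       \<le> K1 * f z * w\<^sup>2"
      using touch rhs unfolding f_def[symmetric] by (simp add: mm l power_divide)
    show "(trace (L z) - l)\<^sup>2 \<le> (n - 1) * ((\<Sum>i\<in>UNIV. (norm (L z *v axis i 1))\<^sup>2) - 2 * mm + l\<^sup>2)"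
      unfolding n_def l_def mm_def by (rule symmetric_trace_bound[OF symL[OF zT] e])
    show "trace (L z) + (p - 2) * l = - (p - 1) * f z * (1 + b * t1 + c * t2)"
      using pdeT[OF zT] unfolding G_def TX f_def[symmetric] l by (simp add: algebra_simps)
    show "mm \<le> 4 * f z * w\<^sup>2" unfolding mm' using dw fz by (intro mult_left_mono) auto
    show "l\<^sup>2 \<le> mm" by (rule lmm)
    show "\<delta> * (1 + (b * t1)\<^sup>2 + (c * t2)\<^sup>2)
      \<le> (1 + (b * t1 + c * t2)\<^sup>2) / (n - 1) + ((n + 1) / (n - 1) - q / (p - 1)) * (b * t1)
        + ((n + 1) / (n - 1) - r / (p - 1)) * (c * t2)"
      using p fz by (intro cond) (auto simp: t1_def t2_def)
  qed
  then have "M \<le> bernstein_const n p q \<delta> * \<rho>\<^sup>2"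
    using Ez by (simp add: M_def F_def w_def power_divide field_simps)
  \<comment> \<open>At the centre \<open>E = \<rho>^2\<close>, so two of the four powers of \<rho>
    cancel and a bound for \<open>\<rho>^2 f x0\<close> remains.\<close>
  moreover have "\<rho>\<^sup>2 * \<rho>\<^sup>2 * f x0 \<le> M"
    using z(2)[of x0] \<rho> by (simp add: M_def F_def E_def power2_eq_square)
  ultimately have "\<rho>\<^sup>2 * (\<rho>\<^sup>2 * f x0) \<le> \<rho>\<^sup>2 * bernstein_const n p q \<delta>" by (simp add: mult_ac)
  then have "\<rho>\<^sup>2 * f x0 \<le> bernstein_const n p q \<delta>"
    by (rule mult_left_le_imp_le) (use \<rho> in simp)
  then show ?thesis by (simp add: f_def power_mult_distrib power2_norm_eq_inner mult.commute)
qed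

section \<open>From the weak to the pointwise equation\<close>

definition flat :: "nat \<Rightarrow> real \<Rightarrow> real" where
  "flat m t = (if t > 0 then exp (- inverse t) * inverse t ^ m else 0)"

lemma flat_tendsto_0: "(flat m \<longlongrightarrow> 0) (at 0)"
proof -
  have "((\<lambda>t. inverse t ^ m / exp (inverse t)) \<longlongrightarrow> (0::real)) (at_right 0)"
    by (rule filterlim_compose[OF tendsto_power_div_exp_0 filterlim_inverse_at_top_right])
  then have "(flat m \<longlongrightarrow> 0) (at_right 0)"
    by (rule Lim_transform_eventually)
      (auto simp: eventually_at_right_field flat_def exp_minus divide_inverse intro!: exI[of _ 1])
  moreover have "(flat m \<longlongrightarrow> 0) (at_left 0)"
    by (rule Lim_transform_eventually[OF tendsto_const])
      (auto simp: eventually_at_left_field flat_def intro!: exI[of _ "-1"])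
  ultimately show ?thesis by (simp add: filterlim_split_at)
qed

text \<open>The factor \<open>inverse t ^ m\<close> is carried along so that derivatives are again
  linear combinations of functions \<open>flat\<close>; smoothness at 0 is then settled for all
  orders at once.\<close>

lemma flat_has_derivative:
  "(flat m has_real_derivative (flat (m + 2) t - real m * flat (m + 1) t)) (at t)"
proof -
  consider "t > 0" | "t < 0" | "t = 0" by linarith
  then show ?thesis
  proof cases
    case 1
    have e: "((\<lambda>t. exp (- inverse t)) has_real_derivative exp (- inverse t) * (inverse t)\<^sup>2) (at t)"
      using 1 by (auto intro!: derivative_eq_intros simp: power2_eq_square)
    have i: "((\<lambda>t. inverse t ^ m) has_real_derivative real m * (- (inverse t)\<^sup>2 * inverse t ^ (m - Suc 0))) (at t)"
      using 1 DERIV_inverse[of t] by (intro DERIV_power) (simp add: numeral_2_eq_2)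
    have "((\<lambda>t. exp (- inverse t) * inverse t ^ m) has_real_derivative
        (flat (m + 2) t - real m * flat (m + 1) t)) (at t)"
    proof (rule DERIV_cong[OF DERIV_mult[OF e i]])
      show "exp (- inverse t) * (inverse t)\<^sup>2 * inverse t ^ m
          + real m * (- (inverse t)\<^sup>2 * inverse t ^ (m - Suc 0)) * exp (- inverse t)
        = flat (m + 2) t - real m * flat (m + 1) t"
        using 1 by (cases m) (simp_all add: flat_def power2_eq_square algebra_simps)
    qed
    then show ?thesis
      by (rule has_field_derivative_transform_within_open[where S="{0<..}"]) (use 1 in \<open>auto simp: flat_def\<close>)
  next
    case 2
    have "((\<lambda>t. 0) has_real_derivative (flat (m + 2) t - real m * flat (m + 1) t)) (at t)"
      using 2 by (simp add: flat_def)
    then show ?thesis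
      by (rule has_field_derivative_transform_within_open[where S="{..<0}"]) (use 2 in \<open>auto simp: flat_def\<close>)
  next
    case 3
    \<comment> \<open>At 0 the difference quotient of \<open>flat m\<close> is literally
      \<open>flat (m + 1)\<close>, also at \<open>h = 0\<close>, where division by zero gives
      0.\<close>
    have "(\<lambda>h. (flat m (0 + h) - flat m 0) / h) = flat (m + 1)"
      by (auto simp: flat_def fun_eq_iff divide_inverse)
    then show ?thesis
      using flat_tendsto_0[of "m + 1"] unfolding DERIV_def 3 by (simp add: flat_def)
  qed
qed

text \<open>\<open>C_on k\<close> is defined by recursion on partial derivatives, so the induction
  on \<open>k\<close> needs a class closed under them. The algebra generated by constants,
  coordinates and all functions \<open>flat m\<close> of the same argument is such a class;
  \<open>R\<close> plays the role of the squared radius.\<close>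

inductive smooth_alg :: "real ^ 'n \<Rightarrow> real \<Rightarrow> (real ^ 'n \<Rightarrow> real) \<Rightarrow> bool" for c R where
  const: "smooth_alg c R (\<lambda>x. k)"
| coord: "smooth_alg c R (\<lambda>x. x $ i)"
| bump: "smooth_alg c R (\<lambda>x. flat m (R - (x - c) \<bullet> (x - c)))"
| add: "smooth_alg c R f \<Longrightarrow> smooth_alg c R g \<Longrightarrow> smooth_alg c R (\<lambda>x. f x + g x)"
| mult: "smooth_alg c R f \<Longrightarrow> smooth_alg c R g \<Longrightarrow> smooth_alg c R (\<lambda>x. f x * g x)"

lemma smooth_alg_derivative:
  assumes "smooth_alg c R f"
  shows "\<exists>D. (\<forall>x. (f has_derivative D x) (at x)) \<and> (\<forall>i. smooth_alg c R (\<lambda>x. D x (axis i 1)))"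
  using assms
proof induction
  case (const k)
  show ?case by (intro exI[of _ "\<lambda>x h. 0"]) (auto intro: smooth_alg.const)
next
  case (coord i)
  have "((\<lambda>x. x $ i) has_derivative (\<lambda>h. h $ i)) (at x)" for x :: "real ^ 'a"
    by (rule bounded_linear.has_derivative[OF bounded_linear_vec_nth has_derivative_ident])
  then show ?case by (intro exI[of _ "\<lambda>x h. h $ i"]) (auto intro: smooth_alg.const)
next
  case (bump m)
  let ?R = "\<lambda>x. R - (x - c) \<bullet> (x - c)"
  let ?D = "\<lambda>x h. (flat (m + 2) (?R x) - real m * flat (m + 1) (?R x)) * (- 2 * ((x - c) \<bullet> h))"
  have R: "(?R has_derivative (\<lambda>h. - 2 * ((x - c) \<bullet> h))) (at x)" for x
    by (auto intro!: derivative_eq_intros simp: inner_commute)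
  have D: "((\<lambda>x. flat m (?R x)) has_derivative ?D x) (at x)" for x
    using has_derivative_compose[OF R flat_has_derivative[unfolded has_field_derivative_def]] .
  have "smooth_alg c R (\<lambda>x. (flat (m + 2) (?R x) + (- real m) * flat (m + 1) (?R x)) * ((- 2) * (x $ i + (- c $ i))))" for i
    by (intro smooth_alg.intros)
  then have "smooth_alg c R (\<lambda>x. ?D x (axis i 1))" for i
    by (simp add: inner_axis)
  with D show ?case by (intro exI[of _ ?D]) auto
next
  case (add f g)
  then obtain F G where "\<And>x. (f has_derivative F x) (at x)" "\<And>i. smooth_alg c R (\<lambda>x. F x (axis i 1))"
    "\<And>x. (g has_derivative G x) (at x)" "\<And>i. smooth_alg c R (\<lambda>x. G x (axis i 1))" by auto
  then show ?case
    by (intro exI[of _ "\<lambda>x h. F x h + G x h"]) (auto intro!: has_derivative_add smooth_alg.add)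
next
  case (mult f g)
  then obtain F G where "\<And>x. (f has_derivative F x) (at x)" "\<And>i. smooth_alg c R (\<lambda>x. F x (axis i 1))"
    "\<And>x. (g has_derivative G x) (at x)" "\<And>i. smooth_alg c R (\<lambda>x. G x (axis i 1))" by auto
  with mult show ?case
    by (intro exI[of _ "\<lambda>x h. f x * G x h + F x h * g x"])
      (auto intro!: has_derivative_mult smooth_alg.add smooth_alg.mult)
qed

lemma smooth_alg_C_on:
  assumes "smooth_alg c R f"
  shows "C_on k UNIV f"
  using assms
proof (induction k arbitrary: f)
  case 0
  then obtain D where "\<And>x. (f has_derivative D x) (at x)" using smooth_alg_derivative by blast
  then show ?case by (auto intro!: has_derivative_continuous_on)
next
  case (Suc k)
  then obtain D where D: "\<And>x. (f has_derivative D x) (at x)" "\<And>i. smooth_alg c R (\<lambda>x. D x (axis i 1))"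
    using smooth_alg_derivative by metis
  have "frechet_derivative f (at x) = D x" for x using frechet_derivative_at[OF D(1)] by simp
  then show ?case using D Suc.IH by (auto simp: differentiable_on_def differentiable_def)
qed

section \<open>Gradients, test functions and integration by parts\<close>

lemma has_derivative_grad:
  assumes "f differentiable (at x)"
  shows "(f has_derivative (\<lambda>h. grad f x \<bullet> h)) (at x)"
proof -
  have D: "(f has_derivative frechet_derivative f (at x)) (at x)"
    using assms frechet_derivative_works by blast
  then have lin: "linear (frechet_derivative f (at x))" using has_derivative_linear by blast
  have "frechet_derivative f (at x) h = grad f x \<bullet> h" for h
  proof -
    have "frechet_derivative f (at x) h = frechet_derivative f (at x) (\<Sum>i\<in>UNIV. h $ i *\<^sub>R axis i 1)"
      using basis_expansion[of h] by (simp add: scalar_mult_eq_scaleR)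
    also have "\<dots> = grad f x \<bullet> h"
      by (simp add: linear_sum[OF lin] linear_cmul[OF lin] grad_def inner_vec_def mult.commute)
    finally show ?thesis .
  qed
  then show ?thesis using D by (metis (no_types, lifting) ext)
qed

lemma grad_eqI:
  assumes "(f has_derivative (\<lambda>h. w \<bullet> h)) (at x)"
  shows "grad f x = w"
  unfolding grad_def using frechet_derivative_at[OF assms, symmetric]
  by (simp add: vec_eq_iff inner_axis)

lemma bump_test_function:
  fixes z :: "real ^ 'n"
  assumes \<rho>: "\<rho> > 0" and sub: "cball z \<rho> \<subseteq> U"
  obtains \<psi> where "\<psi> \<in> test_functions U" "\<And>x. \<psi> x \<ge> 0" "\<And>x. x \<in> ball z \<rho> \<Longrightarrow> \<psi> x > 0"
    "\<And>x. x \<notin> ball z \<rho> \<Longrightarrow> \<psi> x = 0" "\<And>x. \<psi> differentiable (at x)" "continuous_on UNIV (grad \<psi>)"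
proof
  let ?\<psi> = "\<lambda>x. flat 0 (\<rho>\<^sup>2 - (x - z) \<bullet> (x - z))"
  have C: "C_on k UNIV ?\<psi>" for k by (rule smooth_alg_C_on[OF smooth_alg.bump])
  have iff: "\<rho>\<^sup>2 - (x - z) \<bullet> (x - z) > 0 \<longleftrightarrow> x \<in> ball z \<rho>" for x
  proof -
    have "(norm (x - z))\<^sup>2 < \<rho>\<^sup>2 \<longleftrightarrow> norm (x - z) < \<rho>"
      using \<rho> by (metis norm_ge_zero power2_less_imp_less power_strict_mono less_imp_le zero_less_numeral)
    then show ?thesis by (simp add: power2_norm_eq_inner dist_norm norm_minus_commute)
  qed
  have val: "?\<psi> x = (if x \<in> ball z \<rho> then exp (- inverse (\<rho>\<^sup>2 - (x - z) \<bullet> (x - z))) else 0)" for x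
    unfolding flat_def iff by simp
  have "{x. ?\<psi> x \<noteq> 0} = ball z \<rho>" unfolding val by (auto split: if_splits)
  then have "closure {x. ?\<psi> x \<noteq> 0} = cball z \<rho>" using \<rho> by (simp add: closure_ball)
  then show "?\<psi> \<in> test_functions U"
    unfolding test_functions_def mem_Collect_eq by (intro conjI allI C) (simp_all only: compact_cball sub)
  show "?\<psi> x \<ge> 0" for x by (simp add: flat_def)
  show "x \<in> ball z \<rho> \<Longrightarrow> ?\<psi> x > 0" "x \<notin> ball z \<rho> \<Longrightarrow> ?\<psi> x = 0" for x
    unfolding val by simp_all
  have C1: "C_on (Suc 0) UNIV ?\<psi>" by (rule C)
  then show "?\<psi> differentiable (at x)" for x by (simp add: differentiable_on_def)
  show "continuous_on UNIV (grad ?\<psi>)"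
    unfolding grad_def[abs_def] using C1 by (intro continuous_on_vec_lambda) simp
qed

text \<open>Translation invariance makes all difference quotients integrate to zero.\<close>

lemma integral_directional_derivative_eq_0:
  fixes g :: "real ^ 'n \<Rightarrow> real"
  assumes g': "\<And>x. (g has_derivative g' x) (at x)" and supp: "\<And>x. norm x > r \<Longrightarrow> g x = 0"
    and bound: "\<And>x. \<bar>g' x a\<bar> \<le> B"
  shows "integrable lborel (\<lambda>x. g' x a)" "integral\<^sup>L lborel (\<lambda>x. g' x a) = 0"
proof -
  define t where "t n = inverse (real (Suc n))" for n
  have t: "t n > 0" "t n \<le> 1" for n by (auto simp: t_def inverse_le_1_iff)
  have t0: "t \<longlonglongrightarrow> 0" unfolding t_def[abs_def] by (rule LIMSEQ_inverse_real_of_nat)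
  have B: "B \<ge> 0" using bound[of 0] by linarith
  define d where "d n x = (g (x + t n *\<^sub>R a) - g x) / t n" for n x
  have line: "((\<lambda>s. g (x + s *\<^sub>R a)) has_real_derivative g' (x + s *\<^sub>R a) a) (at s)" for x s
    using has_derivative_along_line[OF g'] by (simp add: has_real_derivative_iff_has_vector_derivative)
  have lim: "(\<lambda>n. d n x) \<longlonglongrightarrow> g' x a" for x
  proof -
    have "((\<lambda>s. (g (x + s *\<^sub>R a) - g x) / s) \<longlongrightarrow> g' x a) (at 0)"
      using line[of x 0] by (simp add: DERIV_def)
    moreover have "filterlim t (at 0) sequentially"
      using t0 t(1) by (intro filterlim_atI) (auto simp: less_imp_neq[THEN not_sym])
    ultimately show ?thesis unfolding d_def by (rule filterlim_compose)
  qed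
  \<comment> \<open>As \<open>t n \<le> 1\<close>, all quotients vanish outside one fixed ball, and
    the mean value theorem bounds them by \<open>B\<close>; this is the majorant for dominated
    convergence.\<close>
  have dB: "\<bar>d n x\<bar> \<le> B * indicator (cball 0 (r + norm a)) x" for n x
  proof (cases "norm x \<le> r + norm a")
    case True
    obtain s where "0 < s" "s < t n" "g (x + t n *\<^sub>R a) - g (x + 0 *\<^sub>R a) = (t n - 0) * g' (x + s *\<^sub>R a) a"
      using MVT2[of 0 "t n" "\<lambda>s. g (x + s *\<^sub>R a)" "\<lambda>s. g' (x + s *\<^sub>R a) a"] line t(1) by blast
    then have "d n x = g' (x + s *\<^sub>R a) a" using t(1)[of n] by (simp add: d_def)
    then show ?thesis using True bound by simp
  next
    case False
    have "norm (t n *\<^sub>R a) \<le> norm a" using t[of n] by (simp add: mult_left_le_one_le)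
    then have "norm (x + t n *\<^sub>R a) > r" using False norm_triangle_ineq4[of "x + t n *\<^sub>R a" "t n *\<^sub>R a"] by simp
    moreover have "norm x > r" using False norm_ge_zero[of a] by linarith
    ultimately show ?thesis using supp B by (simp add: d_def)
  qed
  have cont: "continuous_on UNIV g"
    using g' by (intro has_derivative_continuous_on) auto
  then have [measurable]: "g \<in> borel_measurable borel" by (rule borel_measurable_continuous_onI)
  have ig: "integrable lborel g"
  proof -
    have "integrable lborel (\<lambda>x. indicator (cball 0 r) x *\<^sub>R g x)"
      by (intro borel_integrable_compact compact_cball continuous_on_subset[OF cont]) auto
    moreover have "(\<lambda>x. indicator (cball 0 r) x *\<^sub>R g x) = g"
      using supp by (auto simp: fun_eq_iff indicator_def)
    ultimately show ?thesis by simp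
  qed
  have sh: "integrable lborel (\<lambda>x. g (x + y))" "integral\<^sup>L lborel (\<lambda>x. g (x + y)) = integral\<^sup>L lborel g" for y
  proof -
    have eq: "lborel = distr lborel borel ((+) y)" using lborel_distr_plus[of y] by simp
    show "integral\<^sup>L lborel (\<lambda>x. g (x + y)) = integral\<^sup>L lborel g"
      by (subst (2) eq, subst integral_distr) (auto simp: add.commute)
    have "integrable (distr lborel borel ((+) y)) g" using ig eq by simp
    then show "integrable lborel (\<lambda>x. g (x + y))"
      by (subst (asm) integrable_distr_eq) (auto simp: add.commute)
  qed
  have d0: "integral\<^sup>L lborel (d n) = 0" for n
    unfolding d_def[abs_def] using sh ig by simp
  have meas [measurable]: "d n \<in> borel_measurable lborel" for n
    unfolding d_def[abs_def] by measurable
  have meas' : "(\<lambda>x. g' x a) \<in> borel_measurable lborel"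
    by (rule borel_measurable_LIMSEQ_real[OF lim meas])
  have dom: "integrable lborel (\<lambda>x. B * indicator (cball 0 (r + norm a)) x :: real)"
    using borel_integrable_compact[of "cball 0 (r + norm a)" "\<lambda>x. B"] by (simp add: mult.commute)
  have ae: "AE x in lborel. (\<lambda>n. d n x) \<longlonglongrightarrow> g' x a"
    "\<And>n. AE x in lborel. norm (d n x) \<le> B * indicator (cball 0 (r + norm a)) x"
    using lim dB by auto
  show "integrable lborel (\<lambda>x. g' x a)"
    by (rule integrable_dominated_convergence[OF meas' meas dom ae])
  show "integral\<^sup>L lborel (\<lambda>x. g' x a) = 0"
    using integral_dominated_convergence[OF meas' meas dom ae] d0 LIMSEQ_unique by (auto simp: LIMSEQ_const_iff)
qed

lemma C_on_2_C2_data: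
  fixes v :: "real ^ 'n \<Rightarrow> real"
  assumes "open U" "C_on 2 U v"
  shows "\<exists>H. C2_data U v (grad v) H"
proof -
  have C: "C_on (Suc (Suc 0)) U v" using assms(2) by (simp add: numeral_2_eq_2)
  define H :: "real ^ 'n \<Rightarrow> real ^ 'n ^ 'n" where
    "H x = (\<chi> i. grad (\<lambda>x. frechet_derivative v (at x) (axis i 1)) x)" for x
  have diff: "f differentiable (at x)" if "f differentiable_on U" "x \<in> U" for f :: "real ^ 'n \<Rightarrow> real" and x
    using that \<open>open U\<close> by (simp add: differentiable_on_eq_differentiable_at)
  have "continuous_on U H"
    unfolding H_def[abs_def] grad_def using C by (intro continuous_on_vec_lambda) simp
  moreover have "(v has_derivative (\<lambda>h. grad v x \<bullet> h)) (at x)" if "x \<in> U" for x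
    using C that by (intro has_derivative_grad diff) auto
  moreover have "(grad v has_derivative (\<lambda>h. H x *v h)) (at x)" if "x \<in> U" for x
  proof -
    have "((\<lambda>x. frechet_derivative v (at x) (axis i 1)) has_derivative
        (\<lambda>h. grad (\<lambda>x. frechet_derivative v (at x) (axis i 1)) x \<bullet> h)) (at x)" for i
      using C that by (intro has_derivative_grad diff) auto
    then show ?thesis
      unfolding grad_def[of v, abs_def]
      by (subst has_derivative_componentwise_within)
        (auto simp: Basis_vec_def inner_axis H_def matrix_vector_mul_component)
  qed
  ultimately show ?thesis using \<open>open U\<close> unfolding C2_data_def by blast
qed

lemma pointwise_zero_of_integral_zero:
  fixes D \<psi> :: "real ^ 'n \<Rightarrow> real"
  assumes \<rho>: "\<rho> > 0" and cont: "continuous_on (cball z \<rho>) D" "continuous_on (cball z \<rho>) \<psi>"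
    and pos: "\<And>x. \<psi> x \<ge> 0" "\<And>x. x \<in> ball z \<rho> \<Longrightarrow> \<psi> x > 0" and D: "\<And>x. x \<in> cball z \<rho> \<Longrightarrow> D x > 0"
    and int: "integral\<^sup>L lborel (\<lambda>x. indicator (cball z \<rho>) x *\<^sub>R (\<psi> x * D x)) = 0"
  shows False
proof -
  have "integrable lborel (\<lambda>x. indicator (cball z \<rho>) x *\<^sub>R (\<psi> x * D x))"
    by (intro borel_integrable_compact compact_cball continuous_intros cont)
  moreover have "AE x in lborel. 0 \<le> indicator (cball z \<rho>) x *\<^sub>R (\<psi> x * D x)"
    using pos(1) D by (intro AE_I2) (auto simp: indicator_def less_imp_le)
  ultimately have "AE x in lborel. indicator (cball z \<rho>) x *\<^sub>R (\<psi> x * D x) = 0"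
    using integral_nonneg_eq_0_iff_AE int by blast
  then have "AE x in lborel. x \<notin> ball z \<rho>"
  proof (rule eventually_mono)
    fix x assume 0: "indicator (cball z \<rho>) x *\<^sub>R (\<psi> x * D x) = 0"
    show "x \<notin> ball z \<rho>"
    proof
      assume "x \<in> ball z \<rho>"
      moreover from this have "\<psi> x > 0" "D x > 0" using pos(2) D by auto
      ultimately show False using 0 by auto
    qed
  qed
  then have "ball z \<rho> \<in> null_sets lborel" by (subst AE_iff_null_sets) auto
  then have "measure lborel (ball z \<rho>) = 0" by (simp add: null_sets_def measure_def)
  then show False using content_ball_pos[OF \<rho>, of z] by simp
qed

text \<open>Off the critical set the field |\<nabla>v|^(p - 2) \<nabla>v is continuously
  differentiable. If the pointwise expression \<open>D\<close> were nonzero at \<open>z\<close>, it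
  would keep its sign on a small ball without critical points, and a bump supported there would
  contradict the weak equation after integration by parts.\<close>

lemma weak_solution_pointwise:
  fixes v :: "real ^ 'n \<Rightarrow> real"
  assumes C2: "C2_data U v (grad v) H" and pos: "\<And>x. x \<in> U \<Longrightarrow> v x > 0"
    and weak: "weak_solution p b c q r U v" and z: "z \<in> U" "grad v z \<noteq> 0"
  shows "(grad v z \<bullet> grad v z) powr ((p - 2) / 2) *
      (trace (H z) + (p - 2) * (grad v z \<bullet> (H z *v grad v z)) / (grad v z \<bullet> grad v z))
    + b * (grad v z \<bullet> grad v z) powr (q / 2) + c * v z powr r = 0"
proof (rule ccontr)
  define V where "V = grad v"
  define f where "f x = V x \<bullet> V x" for x
  define \<alpha> where "\<alpha> = (p - 2) / 2"
  define D where "D x = f x powr \<alpha> * (trace (H x) + (p - 2) * (V x \<bullet> (H x *v V x)) / f x)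
      + b * f x powr (q / 2) + c * v x powr r" for x
  note C2V = C2[folded V_def]
  define T where "T = U \<inter> V -` (- {0})"
  have oT: "open T" unfolding T_def
    by (intro continuous_open_preimage C2_dataD(1,3)[OF C2V]) auto
  have C2T: "C2_data T v V H" by (rule C2_data_subset[OF C2V _ oT]) (auto simp: T_def)
  have zT: "z \<in> T" using z by (auto simp: T_def V_def)
  have fT: "f x > 0" if "x \<in> T" for x using that by (auto simp: T_def f_def)
  have vT: "v x > 0" if "x \<in> T" for x using that pos by (auto simp: T_def)
  have contf: "continuous_on T f" unfolding f_def[abs_def]
    by (intro continuous_intros C2_dataD(3)[OF C2T])
  have contH: "continuous_on T (\<lambda>x. trace (H x))" unfolding trace_def
    by (intro continuous_intros C2_dataD(2)[OF C2T])
  have contD: "continuous_on T D"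
    unfolding D_def using fT vT
    by (intro continuous_intros contf contH continuous_on_matrix_vector_mult C2_dataD[OF C2T]) force+
  assume "\<not> ?thesis"
  then have Dz: "D z \<noteq> 0" by (simp add: D_def f_def V_def \<alpha>_def)
  define \<sigma> where "\<sigma> = sgn (D z)"
  have \<sigma>: "\<sigma> * D z > 0" using Dz by (simp add: \<sigma>_def sgn_mult_abs abs_sgn mult.commute flip: abs_sgn)
  have "open (T \<inter> (\<lambda>x. \<sigma> * D x) -` {0<..})"
    by (intro continuous_open_preimage continuous_intros contD oT open_greaterThan)
  then obtain \<rho> where \<rho>: "\<rho> > 0" "cball z \<rho> \<subseteq> T \<inter> (\<lambda>x. \<sigma> * D x) -` {0<..}"
    using \<sigma> zT open_contains_cball by (metis IntI greaterThan_iff vimage_eq)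
  have cT: "x \<in> T" if "x \<in> cball z \<rho>" for x using \<rho> that by auto
  have cU: "cball z \<rho> \<subseteq> U" using cT by (auto simp: T_def)
  obtain \<psi> where \<psi>: "\<psi> \<in> test_functions U" "\<And>x. \<psi> x \<ge> 0" "\<And>x. x \<in> ball z \<rho> \<Longrightarrow> \<psi> x > 0"
    "\<And>x. x \<notin> ball z \<rho> \<Longrightarrow> \<psi> x = 0" "\<And>x. \<psi> differentiable (at x)" "continuous_on UNIV (grad \<psi>)"
    using bump_test_function[OF \<rho>(1) cU] by blast
  have d\<psi>: "(\<psi> has_derivative (\<lambda>h. grad \<psi> x \<bullet> h)) (at x)" for x by (rule has_derivative_grad[OF \<psi>(5)])
  have cont\<psi>: "continuous_on A \<psi>" for A
    by (rule has_derivative_continuous_on) (use d\<psi> has_derivative_at_withinI in blast)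
  have zero_out: "(g has_derivative (\<lambda>h. 0)) (at x)"
    if "x \<notin> cball z \<rho>" "\<And>y. y \<notin> cball z \<rho> \<Longrightarrow> g y = 0" for g :: "real ^ 'n \<Rightarrow> real" and x
    by (rule has_derivative_transform_within_open[OF has_derivative_const[of 0], where s="- cball z \<rho>"])
      (use that in auto)
  have grad_out: "grad \<psi> x = 0" if "x \<notin> cball z \<rho>" for x
    using zero_out[OF that, of \<psi>] \<psi>(4) by (intro grad_eqI) auto
  define W where "W x = f x powr \<alpha> *\<^sub>R V x" for x
  define W' where "W' x h = f x powr \<alpha> *\<^sub>R (H x *v h) + (f x powr \<alpha> * ((p - 2) * (V x \<bullet> (H x *v h)) / f x)) *\<^sub>R V x" for x h
  have dW: "(W has_derivative W' x) (at x)" if "x \<in> T" for x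
  proof -
    have "(f has_derivative (\<lambda>h. V x \<bullet> (H x *v h) + (H x *v h) \<bullet> V x)) (at x)"
      unfolding f_def[abs_def]
      by (rule has_derivative_inner[OF C2_dataD(6)[OF C2T that] C2_dataD(6)[OF C2T that]])
    from has_derivative_powr[OF this has_derivative_const[of \<alpha>] fT[OF that] UNIV_I]
    have "((\<lambda>x. f x powr \<alpha>) has_derivative
       (\<lambda>h. f x powr \<alpha> * (0 * ln (f x) + (V x \<bullet> (H x *v h) + (H x *v h) \<bullet> V x) * \<alpha> / f x))) (at x)" .
    from has_derivative_scaleR[OF this C2_dataD(6)[OF C2T that]]
    show ?thesis unfolding W_def[abs_def]
      by (rule has_derivative_eq_rhs)
        (simp add: fun_eq_iff W'_def \<alpha>_def inner_commute[of "H x *v _" "V x"] mult.commute)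
  qed
  \<comment> \<open>The product \<psi> W is differentiable on the whole space because it vanishes
    outside the ball; \<open>W\<close> alone may fail to be so at critical points.\<close>
  define g' where "g' i x h = (if x \<in> cball z \<rho> then \<psi> x * (W' x h $ i) + (grad \<psi> x \<bullet> h) * (W x $ i) else 0)" for i x h
  have dg: "((\<lambda>x. \<psi> x * W x $ i) has_derivative g' i x) (at x)" for i x
  proof (cases "x \<in> cball z \<rho>")
    case True
    have "((\<lambda>x. W x $ i) has_derivative (\<lambda>h. W' x h $ i)) (at x)"
      by (rule bounded_linear.has_derivative[OF bounded_linear_vec_nth dW[OF cT[OF True]]])
    from has_derivative_mult[OF d\<psi> this] show ?thesis using True by (simp add: g'_def[abs_def])
  next
    case False
    have "g' i x = (\<lambda>h. 0)" using False by (simp add: g'_def fun_eq_iff)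
    moreover have "((\<lambda>x. \<psi> x * W x $ i) has_derivative (\<lambda>h. 0)) (at x)"
      using False \<psi>(4) by (intro zero_out) auto
    ultimately show ?thesis by simp
  qed
  have contc: "continuous_on (cball z \<rho>) V" "continuous_on (cball z \<rho>) H" "continuous_on (cball z \<rho>) f"
    "continuous_on (cball z \<rho>) D" "continuous_on (cball z \<rho>) v"
    using C2_dataD[OF C2T] contf contD cT by (auto intro: continuous_on_subset)
  have gc: "continuous_on (cball z \<rho>) (grad \<psi>)" using \<psi>(6) continuous_on_subset by blast
  have fc: "f x \<noteq> 0" if "x \<in> cball z \<rho>" for x using fT[OF cT[OF that]] by simp
  have Wc: "continuous_on (cball z \<rho>) W"
    unfolding W_def[abs_def] using fc by (intro continuous_intros contc) auto
  have ibp: "integrable lborel (\<lambda>x. g' i x (axis i 1)) \<and> integral\<^sup>L lborel (\<lambda>x. g' i x (axis i 1)) = 0" for i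
  proof -
    let ?F = "\<lambda>x. \<psi> x * (W' x (axis i 1) $ i) + (grad \<psi> x \<bullet> axis i 1) * (W x $ i)"
    have "continuous_on (cball z \<rho>) ?F"
      unfolding W'_def using fc
      by (intro continuous_intros contc gc Wc cont\<psi> continuous_on_matrix_vector_mult) auto
    then have "bounded (?F ` cball z \<rho>)"
      by (intro compact_imp_bounded compact_continuous_image) auto
    then obtain B where B: "B > 0" "\<And>x. x \<in> cball z \<rho> \<Longrightarrow> \<bar>?F x\<bar> \<le> B"
      unfolding bounded_pos by auto
    have b: "\<bar>g' i x (axis i 1)\<bar> \<le> B" for x using B by (simp add: g'_def)
    have s: "\<psi> x * W x $ i = 0" if "norm x > norm z + \<rho>" for x
    proof -
      have "x \<notin> ball z \<rho>"
        using that norm_triangle_ineq[of z "x - z"] by (auto simp: dist_norm norm_minus_commute)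
      then show ?thesis using \<psi>(4) by simp
    qed
    show ?thesis using integral_directional_derivative_eq_0[OF dg s b] by blast
  qed
  \<comment> \<open>The left side is the divergence of \<psi> W. Its integral vanishes by
    \<open>ibp\<close>, and the right side splits it into \<psi> div W and
    \<open>W \<bullet> grad \<psi>\<close>.\<close>
  have sumg: "(\<Sum>i\<in>UNIV. g' i x (axis i 1)) = indicator (cball z \<rho>) x *\<^sub>R
      (\<psi> x * (f x powr \<alpha> * (trace (H x) + (p - 2) * (V x \<bullet> (H x *v V x)) / f x)) + W x \<bullet> grad \<psi> x)" for x
  proof (cases "x \<in> cball z \<rho>")
    case True
    have 1: "(\<Sum>i\<in>UNIV. (H x *v axis i 1) $ i) = trace (H x)"
      by (simp add: trace_def matrix_vector_mult_basis column_def)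
    have 2: "(\<Sum>i\<in>UNIV. (V x \<bullet> (H x *v axis i 1)) * V x $ i) = V x \<bullet> (H x *v V x)"
    proof -
      have "V x \<bullet> (H x *v V x) = V x \<bullet> (H x *v (\<Sum>i\<in>UNIV. V x $ i *\<^sub>R axis i 1))"
        using basis_expansion[of "V x"] by (simp add: scalar_mult_eq_scaleR)
      also have "\<dots> = (\<Sum>i\<in>UNIV. (V x \<bullet> (H x *v axis i 1)) * V x $ i)"
        by (simp add: linear_sum[OF matrix_vector_mul_linear] matrix_vector_mult_scaleR inner_sum_right mult.commute)
      finally show ?thesis by simp
    qed
    have "(\<Sum>i\<in>UNIV. W' x (axis i 1) $ i) = f x powr \<alpha> * (\<Sum>i\<in>UNIV. (H x *v axis i 1) $ i)
        + f x powr \<alpha> * ((p - 2) / f x) * (\<Sum>i\<in>UNIV. (V x \<bullet> (H x *v axis i 1)) * V x $ i)"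
      by (simp add: W'_def sum.distrib sum_distrib_left mult_ac)
    then have "(\<Sum>i\<in>UNIV. W' x (axis i 1) $ i) = f x powr \<alpha> * (trace (H x) + (p - 2) * (V x \<bullet> (H x *v V x)) / f x)"
      unfolding 1 2 by (simp add: algebra_simps)
    moreover have "(\<Sum>i\<in>UNIV. (grad \<psi> x \<bullet> axis i 1) * (W x $ i)) = W x \<bullet> grad \<psi> x"
      by (simp add: inner_axis inner_vec_def[of "W x"] mult.commute)
    moreover have "(\<Sum>i\<in>UNIV. g' i x (axis i 1)) = \<psi> x * (\<Sum>i\<in>UNIV. W' x (axis i 1) $ i)
        + (\<Sum>i\<in>UNIV. (grad \<psi> x \<bullet> axis i 1) * (W x $ i))"
      using True by (simp add: g'_def sum.distrib sum_distrib_left)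
    ultimately show ?thesis using True by simp
  qed (simp add: g'_def)
  let ?I = "\<lambda>k. integral\<^sup>L lborel (\<lambda>x. indicator (cball z \<rho>) x *\<^sub>R (k x :: real))"
  let ?k0 = "\<lambda>x. f x powr \<alpha> * (trace (H x) + (p - 2) * (V x \<bullet> (H x *v V x)) / f x)"
  have int: "integrable lborel (\<lambda>x. indicator (cball z \<rho>) x *\<^sub>R (k x :: real))"
    if "continuous_on (cball z \<rho>) k" for k
    by (intro borel_integrable_compact compact_cball that)
  have contH': "continuous_on (cball z \<rho>) (\<lambda>x. trace (H x))"
    using contH cT continuous_on_subset by blast
  have c0: "continuous_on (cball z \<rho>) (\<lambda>x. \<psi> x * ?k0 x)"
    using fc by (intro continuous_intros contc contH' cont\<psi> continuous_on_matrix_vector_mult) auto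
  have c1: "continuous_on (cball z \<rho>) (\<lambda>x. W x \<bullet> grad \<psi> x)" by (intro continuous_intros Wc gc)
  have c2: "continuous_on (cball z \<rho>) (\<lambda>x. f x powr (q / 2) * \<psi> x)"
    using fc by (intro continuous_intros contc cont\<psi>) auto
  have c3: "continuous_on (cball z \<rho>) (\<lambda>x. v x powr r * \<psi> x)"
    using vT[OF cT] by (intro continuous_intros contc cont\<psi>) force
  have "?I (\<lambda>x. \<psi> x * ?k0 x + W x \<bullet> grad \<psi> x) = 0"
    unfolding sumg[symmetric] using ibp by (subst Bochner_Integration.integral_sum) auto
  then have A: "?I (\<lambda>x. \<psi> x * ?k0 x) + ?I (\<lambda>x. W x \<bullet> grad \<psi> x) = 0"
    unfolding scaleR_add_right by (subst (asm) Bochner_Integration.integral_add[OF int[OF c0] int[OF c1]])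
  have i1: "(LINT x:U|lborel. (norm (grad v x) powr (p - 2) *\<^sub>R grad v x) \<bullet> grad \<psi> x) = ?I (\<lambda>x. W x \<bullet> grad \<psi> x)"
    and i2: "(LINT x:U|lborel. rpow (norm (grad v x)) q * \<psi> x) = ?I (\<lambda>x. f x powr (q / 2) * \<psi> x)"
    and i3: "(LINT x:U|lborel. v x powr r * \<psi> x) = ?I (\<lambda>x. v x powr r * \<psi> x)"
  proof -
    have nf: "norm (grad v x) powr s = f x powr (s / 2)" if "x \<in> T" for x s
    proof -
      have "norm (grad v x) = f x powr (1 / 2)"
        using fT[OF that] by (simp add: f_def V_def norm_eq_sqrt_inner powr_half_sqrt)
      then show ?thesis by (simp add: powr_powr)
    qed
    \<comment> \<open>\<open>rpow\<close> and \<open>powr\<close> differ only at base 0 with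
      exponent 0, and there are no critical points in \<open>T\<close>.\<close>
    have rp: "rpow (norm (grad v x)) s = f x powr (s / 2)" if "x \<in> T" for x s
      using nf[OF that, of s] fT[OF that] that by (auto simp: rpow_def T_def V_def)
    have out: "\<psi> x = 0" "grad \<psi> x = 0" if "x \<notin> cball z \<rho>" for x
      using \<psi>(4)[of x] grad_out[OF that] that by auto
    show "(LINT x:U|lborel. (norm (grad v x) powr (p - 2) *\<^sub>R grad v x) \<bullet> grad \<psi> x) = ?I (\<lambda>x. W x \<bullet> grad \<psi> x)"
      unfolding set_lebesgue_integral_def
      using cU nf[OF cT] out by (intro Bochner_Integration.integral_cong refl)
        (auto simp: indicator_def W_def \<alpha>_def V_def subset_iff)
    show "(LINT x:U|lborel. rpow (norm (grad v x)) q * \<psi> x) = ?I (\<lambda>x. f x powr (q / 2) * \<psi> x)"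
      unfolding set_lebesgue_integral_def
      using cU rp[OF cT] out by (intro Bochner_Integration.integral_cong refl)
        (auto simp: indicator_def subset_iff)
    show "(LINT x:U|lborel. v x powr r * \<psi> x) = ?I (\<lambda>x. v x powr r * \<psi> x)"
      unfolding set_lebesgue_integral_def
      using cU out by (intro Bochner_Integration.integral_cong refl)
        (auto simp: indicator_def subset_iff)
  qed
  have "- ?I (\<lambda>x. W x \<bullet> grad \<psi> x) + b * ?I (\<lambda>x. f x powr (q / 2) * \<psi> x) + c * ?I (\<lambda>x. v x powr r * \<psi> x) = 0"
    using weak \<psi>(1) unfolding weak_solution_def i1[symmetric] i2[symmetric] i3[symmetric] by blast
  then have B: "?I (\<lambda>x. \<psi> x * ?k0 x) + b * ?I (\<lambda>x. f x powr (q / 2) * \<psi> x) + c * ?I (\<lambda>x. v x powr r * \<psi> x) = 0"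
    using A by linarith
  have "?I (\<lambda>x. \<psi> x * (\<sigma> * D x)) = \<sigma> * (?I (\<lambda>x. \<psi> x * ?k0 x) + b * ?I (\<lambda>x. f x powr (q / 2) * \<psi> x) + c * ?I (\<lambda>x. v x powr r * \<psi> x))"
  proof -
    have "?I (\<lambda>x. \<psi> x * (\<sigma> * D x)) = integral\<^sup>L lborel (\<lambda>x. \<sigma> * (indicator (cball z \<rho>) x *\<^sub>R (\<psi> x * ?k0 x)
       + b * (indicator (cball z \<rho>) x *\<^sub>R (f x powr (q / 2) * \<psi> x)) + c * (indicator (cball z \<rho>) x *\<^sub>R (v x powr r * \<psi> x))))"
      by (intro Bochner_Integration.integral_cong refl) (simp add: D_def algebra_simps)
    also have "\<dots> = \<sigma> * (?I (\<lambda>x. \<psi> x * ?k0 x) + b * ?I (\<lambda>x. f x powr (q / 2) * \<psi> x) + c * ?I (\<lambda>x. v x powr r * \<psi> x))"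
    proof -
      have "integral\<^sup>L lborel (\<lambda>x. \<sigma> * (A x + b * B x + c * C x))
          = \<sigma> * (integral\<^sup>L lborel A + b * integral\<^sup>L lborel B + c * integral\<^sup>L lborel C)"
        if "integrable lborel A" "integrable lborel B" "integrable lborel C" for A B C :: "real ^ 'n \<Rightarrow> real"
        using that by simp
      from this[OF int[OF c0] int[OF c2] int[OF c3]] show ?thesis .
    qed
    finally show ?thesis .
  qed
  then have "?I (\<lambda>x. \<psi> x * (\<sigma> * D x)) = 0" unfolding B by simp
  then show False
    by (intro pointwise_zero_of_integral_zero[where D="\<lambda>x. \<sigma> * D x", OF \<rho>(1)])
      (use \<rho> \<psi> cont\<psi> contc in \<open>auto intro!: continuous_intros\<close>)
qed

section \<open>Decay of positive solutions\<close>

lemma C2_data_ln: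
  fixes v :: "real ^ 'n \<Rightarrow> real"
  assumes C2: "C2_data S v V H" and pos: "\<And>x. x \<in> S \<Longrightarrow> v x > 0"
  shows "C2_data S (\<lambda>x. ln (v x)) (\<lambda>x. (1 / v x) *\<^sub>R V x)
    (\<lambda>x. (1 / v x) *\<^sub>R H x - (\<chi> i j. ((1 / v x) *\<^sub>R V x) $ i * ((1 / v x) *\<^sub>R V x) $ j))"
    (is "C2_data S ?u ?U ?L")
  unfolding C2_data_def
proof (intro conjI ballI)
  show "open S" by (rule C2_dataD(1)[OF C2])
  fix x assume x: "x \<in> S"
  have v0: "v x > 0" by (rule pos[OF x])
  note dv = C2_dataD(5)[OF C2 x]
  have "(?u has_derivative (\<lambda>h. (V x \<bullet> h) * inverse (v x))) (at x)"
    using v0 by (auto intro!: derivative_eq_intros dv simp: divide_inverse)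
  then show "(?u has_derivative (\<lambda>h. ?U x \<bullet> h)) (at x)"
    by (simp add: divide_inverse mult.commute)
  have "((\<lambda>x. 1 / v x) has_derivative (\<lambda>h. - (V x \<bullet> h) / (v x * v x))) (at x)"
    using v0 by (auto intro!: derivative_eq_intros dv simp: divide_inverse)
  from has_derivative_scaleR[OF this C2_dataD(6)[OF C2 x]]
  show "(?U has_derivative (\<lambda>h. ?L x *v h)) (at x)"
  proof (rule has_derivative_eq_rhs)
    have "?L x *v h = (1 / v x) *\<^sub>R (H x *v h) - (?U x \<bullet> h) *\<^sub>R ?U x" for h
      unfolding matrix_vector_mult_diff_rdistrib outer_product_mult_vec scaleR_matrix_vector_assoc[symmetric] ..
    then show "(\<lambda>h. (1 / v x) *\<^sub>R (H x *v h) + (- (V x \<bullet> h) / (v x * v x)) *\<^sub>R V x) = (\<lambda>h. ?L x *v h)"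
      by (simp add: fun_eq_iff)
  qed
next
  have "v x \<noteq> 0" if "x \<in> S" for x using pos[OF that] by simp
  then show "continuous_on S ?L"
    by (intro continuous_intros continuous_on_vec_lambda continuous_on_component C2_dataD[OF C2]) auto
qed

text \<open>With \<open>v = exp u\<close>, the Hessian of \<open>u\<close> is \<open>H / v\<close>
  minus the outer product of \<open>W\<close>, which produces the term
  \<open>- (p - 1) |W|^2\<close>. The rest is homogeneity: \<open>V = v W\<close>, and the equation
  is multiplied by \<open>|V|\<close> to the power \<open>2 - p\<close> and divided by
  \<open>v\<close>.\<close>

lemma log_equation:
  fixes V :: "real ^ 'n" and H :: "real ^ 'n ^ 'n" and v p b c q r :: real
  defines "W \<equiv> (1 / v) *\<^sub>R V"
  defines "L \<equiv> (1 / v) *\<^sub>R H - (\<chi> i j. W $ i * W $ j)"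
  assumes v: "v > 0" and V: "V \<noteq> 0"
    and eq: "(V \<bullet> V) powr ((p - 2) / 2) * (trace H + (p - 2) * (V \<bullet> (H *v V)) / (V \<bullet> V))
      + b * (V \<bullet> V) powr (q / 2) + c * v powr r = 0"
  shows "trace L + (p - 2) * (W \<bullet> (L *v W)) / (W \<bullet> W)
    = - (p - 1) * (W \<bullet> W) - b * exp ((q - p + 1) * ln v) * (W \<bullet> W) powr ((q - p + 2) / 2)
      - c * exp ((r - p + 1) * ln v) * (W \<bullet> W) powr ((2 - p) / 2)"
proof -
  define f where "f = W \<bullet> W"
  define F where "F = V \<bullet> V"
  have F: "F > 0" using V by (simp add: F_def)
  have Ff: "F = v\<^sup>2 * f" using v by (simp add: F_def f_def W_def power2_eq_square)
  have f: "f > 0" using F v by (simp add: Ff zero_less_mult_iff)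
  define Q where "Q = V \<bullet> (H *v V) / F"
  have trL: "trace L = trace H / v - f"
    by (simp add: L_def trace_def f_def inner_vec_def sum_subtractf sum_divide_distrib)
  have "W \<bullet> (L *v W) = (1 / v) * (W \<bullet> (H *v W)) - f * f"
    by (simp add: L_def matrix_vector_mult_diff_rdistrib inner_diff_right f_def outer_product_mult_vec
        flip: scaleR_matrix_vector_assoc)
  also have "W \<bullet> (H *v W) = Q * f"
  proof -
    have "W \<bullet> (H *v W) = V \<bullet> (H *v V) / v\<^sup>2" by (simp add: W_def matrix_vector_mult_scaleR power2_eq_square)
    then show ?thesis using v f by (simp add: Q_def Ff)
  qed
  finally have WLW: "(W \<bullet> (L *v W)) / f = Q / v - f" using f by (simp add: field_simps)
  have Fp: "F powr s = v powr (2 * s) * f powr s" for s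
    using v f by (simp add: Ff powr_mult powr_powr flip: powr_numeral)
  have half: "2 * (s / 2) = s" for s :: real by simp
  have "F powr ((p - 2) / 2) * (trace H + (p - 2) * Q) = - b * F powr (q / 2) - c * v powr r"
    using eq unfolding F_def[symmetric] Q_def by simp
  then have "F powr ((2 - p) / 2) * (F powr ((p - 2) / 2) * (trace H + (p - 2) * Q))
      = F powr ((2 - p) / 2) * (- b * F powr (q / 2) - c * v powr r)" by simp
  moreover have "F powr ((2 - p) / 2) * F powr ((p - 2) / 2) = 1"
    using F by (simp add: powr_add[symmetric] add_divide_distrib[symmetric])
  ultimately have "trace H + (p - 2) * Q = F powr ((2 - p) / 2) * (- b * F powr (q / 2) - c * v powr r)"
    by (simp add: mult.assoc[symmetric])
  also have "\<dots> = - b * F powr ((q - p + 2) / 2) - c * (F powr ((2 - p) / 2) * v powr r)"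
  proof -
    have "F powr ((2 - p) / 2) * F powr (q / 2) = F powr ((q - p + 2) / 2)"
      by (simp add: powr_add[symmetric] add_divide_distrib[symmetric] algebra_simps)
    then show ?thesis by (simp add: algebra_simps)
  qed
  also have "F powr ((q - p + 2) / 2) = v powr (q - p + 2) * f powr ((q - p + 2) / 2)"
    unfolding Fp half ..
  also have "F powr ((2 - p) / 2) * v powr r = v powr (r - p + 2) * f powr ((2 - p) / 2)"
  proof -
    have "v powr (2 - p) * v powr r = v powr (r - p + 2)" by (simp add: powr_add[symmetric] algebra_simps)
    then show ?thesis unfolding Fp half by (simp add: mult_ac)
  qed
  finally have main: "trace H + (p - 2) * Q = - b * (v powr (q - p + 2) * f powr ((q - p + 2) / 2))
      - c * (v powr (r - p + 2) * f powr ((2 - p) / 2))" .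
  have ve: "v powr (s + 2) / v = exp ((s + 1) * ln v)" for s
  proof -
    have "v powr (s + 2) = v powr (s + 1) * v" using v powr_add[of v "s + 1" 1] by (simp add: add.assoc)
    then show ?thesis using v by (simp add: powr_def)
  qed
  have "trace L + (p - 2) * (W \<bullet> (L *v W)) / f = trace H / v - f + (p - 2) * (Q / v - f)"
    unfolding trL WLW[symmetric] by simp
  also have "\<dots> = (trace H + (p - 2) * Q) / v - (p - 1) * f"
    by (simp add: add_divide_distrib diff_divide_distrib algebra_simps)
  also have "\<dots> = - b * (v powr (q - p + 2) / v) * f powr ((q - p + 2) / 2)
      - c * (v powr (r - p + 2) / v) * f powr ((2 - p) / 2) - (p - 1) * f"
    unfolding main by (simp add: diff_divide_distrib)
  finally show ?thesis unfolding ve f_def[symmetric] by (simp add: algebra_simps)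
qed

section \<open>The four regions as conditions on a quadratic form\<close>

lemma subcritical_form_bound:
  fixes \<alpha> \<beta> N X Y :: real
  assumes N: "N > 0" and XY: "X * Y \<ge> 0"
  shows "\<alpha> * X \<ge> 0 \<Longrightarrow> \<beta> * Y \<ge> 0 \<Longrightarrow>
      (1 / N) * (1 + X\<^sup>2 + Y\<^sup>2) \<le> (1 + (X + Y)\<^sup>2) / N + \<alpha> * X + \<beta> * Y" (is "_ \<Longrightarrow> _ \<Longrightarrow> ?g1")
    and "\<alpha> * X \<ge> 0 \<Longrightarrow>
      (1 / N - \<bar>\<beta>\<bar> / 2) * (1 + X\<^sup>2 + Y\<^sup>2) \<le> (1 + (X + Y)\<^sup>2) / N + \<alpha> * X + \<beta> * Y" (is "_ \<Longrightarrow> ?g2")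
    and "\<beta> * Y \<ge> 0 \<Longrightarrow>
      (1 / N - \<bar>\<alpha>\<bar> / 2) * (1 + X\<^sup>2 + Y\<^sup>2) \<le> (1 + (X + Y)\<^sup>2) / N + \<alpha> * X + \<beta> * Y" (is "_ \<Longrightarrow> ?g3")
    and "(1 / N - sqrt (\<alpha>\<^sup>2 + \<beta>\<^sup>2) / 2) * (1 + X\<^sup>2 + Y\<^sup>2) \<le> (1 + (X + Y)\<^sup>2) / N + \<alpha> * X + \<beta> * Y" (is ?g4)
proof -
  \<comment> \<open>The sign condition on \<open>X * Y\<close> leaves the margin
    \<open>1 / N\<close>, from which linear terms of the wrong sign are paid.\<close>
  have 0: "(1 / N) * (1 + X\<^sup>2 + Y\<^sup>2) \<le> (1 + (X + Y)\<^sup>2) / N"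
  proof -
    have "1 + X\<^sup>2 + Y\<^sup>2 \<le> 1 + (X + Y)\<^sup>2" using XY by (simp add: power2_eq_square algebra_simps)
    then show ?thesis using N by (simp add: divide_right_mono)
  qed
  \<comment> \<open>A linear term with coefficient \<open>s\<close> costs \<open>s / 2\<close>,
    which stays below the margin exactly when \<open>s < 2 / N\<close>. This is the bound in
    \<open>W2\<close> and \<open>W3\<close>; for \<open>W4\<close> both linear terms are first
    merged by Cauchy-Schwarz into one with \<open>s = sqrt (\<alpha>^2 + \<beta>^2)\<close>.\<close>
  have amgm: "s * t \<le> s / 2 * (1 + X\<^sup>2 + Y\<^sup>2)" if "s \<ge> 0" "t\<^sup>2 \<le> X\<^sup>2 + Y\<^sup>2" for s t :: real
  proof -
    have "0 \<le> (t - 1)\<^sup>2" by simp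
    then have "t \<le> (1 + X\<^sup>2 + Y\<^sup>2) / 2" using that(2) by (simp add: power2_eq_square algebra_simps)
    from mult_left_mono[OF this that(1)] show ?thesis by simp
  qed
  have b: "- (\<beta> * Y) \<le> \<bar>\<beta>\<bar> / 2 * (1 + X\<^sup>2 + Y\<^sup>2)"
    using amgm[of "\<bar>\<beta>\<bar>" "\<bar>Y\<bar>"] abs_ge_minus_self[of "\<beta> * Y"] by (simp add: abs_mult)
  have a: "- (\<alpha> * X) \<le> \<bar>\<alpha>\<bar> / 2 * (1 + X\<^sup>2 + Y\<^sup>2)"
    using amgm[of "\<bar>\<alpha>\<bar>" "\<bar>X\<bar>"] abs_ge_minus_self[of "\<alpha> * X"] by (simp add: abs_mult)
  have ab: "- (\<alpha> * X + \<beta> * Y) \<le> sqrt (\<alpha>\<^sup>2 + \<beta>\<^sup>2) / 2 * (1 + X\<^sup>2 + Y\<^sup>2)"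
  proof -
    have "(\<alpha> * X + \<beta> * Y)\<^sup>2 \<le> (\<alpha>\<^sup>2 + \<beta>\<^sup>2) * (X\<^sup>2 + Y\<^sup>2)"
      using zero_le_power2[of "\<alpha> * Y - \<beta> * X"] by (simp add: power2_eq_square algebra_simps)
    then have "sqrt ((\<alpha> * X + \<beta> * Y)\<^sup>2) \<le> sqrt ((\<alpha>\<^sup>2 + \<beta>\<^sup>2) * (X\<^sup>2 + Y\<^sup>2))" by (rule real_sqrt_le_mono)
    then have "- (\<alpha> * X + \<beta> * Y) \<le> sqrt (\<alpha>\<^sup>2 + \<beta>\<^sup>2) * sqrt (X\<^sup>2 + Y\<^sup>2)"
      by (simp add: real_sqrt_mult abs_le_iff)
    also have "\<dots> \<le> sqrt (\<alpha>\<^sup>2 + \<beta>\<^sup>2) / 2 * (1 + X\<^sup>2 + Y\<^sup>2)"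
      by (intro amgm) auto
    finally show ?thesis .
  qed
  show "\<alpha> * X \<ge> 0 \<Longrightarrow> \<beta> * Y \<ge> 0 \<Longrightarrow> ?g1" using 0 by linarith
  show "\<alpha> * X \<ge> 0 \<Longrightarrow> ?g2" using 0 b unfolding left_diff_distrib by linarith
  show "\<beta> * Y \<ge> 0 \<Longrightarrow> ?g3" using 0 a unfolding left_diff_distrib by linarith
  show ?g4 using 0 ab unfolding left_diff_distrib by linarith
qed

text \<open>The gap is drawn from four numbers that do not involve \<open>b\<close> and
  \<open>c\<close>. Membership in a region may depend on the signs of \<open>b\<close> and
  \<open>c\<close>, but that only decides which of the four is taken.\<close>

lemma subcritical_constant:
  fixes b c q r p :: real and n :: nat
  defines "N \<equiv> real n - 1"
  defines "\<alpha> \<equiv> (real n + 1) / N - q / (p - 1)" and "\<beta> \<equiv> (real n + 1) / N - r / (p - 1)"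
  assumes n: "n \<ge> 2" and bc: "b * c \<ge> 0" and W: "(b, c, q, r) \<in> W1 n p \<union> W2 n p \<union> W3 n p \<union> W4 n p"
  shows "\<exists>\<delta>\<in>{1 / N, 1 / N - \<bar>\<beta>\<bar> / 2, 1 / N - \<bar>\<alpha>\<bar> / 2, 1 / N - sqrt (\<alpha>\<^sup>2 + \<beta>\<^sup>2) / 2}. \<delta> > 0 \<and>
    (\<forall>t1 t2. t1 \<ge> 0 \<longrightarrow> t2 \<ge> 0 \<longrightarrow>
      \<delta> * (1 + (b * t1)\<^sup>2 + (c * t2)\<^sup>2) \<le> (1 + (b * t1 + c * t2)\<^sup>2) / N + \<alpha> * (b * t1) + \<beta> * (c * t2))"
proof -
  have N: "N > 0" using n by (simp add: N_def)
  have XY: "(b * t1) * (c * t2) \<ge> 0" if "t1 \<ge> 0" "t2 \<ge> 0" for t1 t2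
  proof -
    have "(b * t1) * (c * t2) = (b * c) * (t1 * t2)" by simp
    then show ?thesis using bc that by (metis mult_nonneg_nonneg)
  qed
  have sgn1: "\<alpha> * (b * t) \<ge> 0" if "b * \<alpha> \<ge> 0" "t \<ge> 0" for t
    using mult_nonneg_nonneg[OF that] by (simp add: mult_ac)
  have sgn2: "\<beta> * (c * t) \<ge> 0" if "c * \<beta> \<ge> 0" "t \<ge> 0" for t
    using mult_nonneg_nonneg[OF that] by (simp add: mult_ac)
  note form = subcritical_form_bound[OF N XY]
  consider "b * \<alpha> \<ge> 0" "c * \<beta> \<ge> 0" | "b * \<alpha> \<ge> 0" "\<bar>\<beta>\<bar> < 2 / N" | "\<bar>\<alpha>\<bar> < 2 / N" "c * \<beta> \<ge> 0"
    | "\<alpha>\<^sup>2 + \<beta>\<^sup>2 < 4 / N\<^sup>2"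
    using W by (auto simp: W1_def W2_def W3_def W4_def \<alpha>_def \<beta>_def N_def)
  then show ?thesis
  proof cases
    case 1
    then show ?thesis using N by (intro bexI[of _ "1 / N"] conjI allI impI form(1) sgn1 sgn2) auto
  next
    case 2
    then show ?thesis by (intro bexI[of _ "1 / N - \<bar>\<beta>\<bar> / 2"] conjI allI impI form(2) sgn1) auto
  next
    case 3
    then show ?thesis by (intro bexI[of _ "1 / N - \<bar>\<alpha>\<bar> / 2"] conjI allI impI form(3) sgn2) auto
  next
    case 4
    have "sqrt (\<alpha>\<^sup>2 + \<beta>\<^sup>2) < sqrt ((2 / N)\<^sup>2)"
      using 4 by (intro real_sqrt_less_mono) (simp add: power_divide)
    then have "sqrt (\<alpha>\<^sup>2 + \<beta>\<^sup>2) < 2 / N" using N by simp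
    then show ?thesis by (intro bexI[of _ "1 / N - sqrt (\<alpha>\<^sup>2 + \<beta>\<^sup>2) / 2"] conjI allI impI form(4)) auto
  qed
qed

section \<open>Balls around the singularity and integration along rays\<close>

lemma ball_subset_of_frontier_dist:
  fixes \<Omega> :: "'a::real_normed_vector set"
  assumes "a \<in> \<Omega>" and d: "frontier \<Omega> = {} \<or> infdist a (frontier \<Omega>) \<ge> d"
  shows "ball a d \<subseteq> \<Omega>"
proof
  fix x assume x: "x \<in> ball a d"
  show "x \<in> \<Omega>"
  proof (rule ccontr)
    assume "x \<notin> \<Omega>"
    moreover have "a \<in> ball a d" using x by (auto intro: le_less_trans[OF zero_le_dist])
    ultimately have "ball a d \<inter> \<Omega> \<noteq> {}" "ball a d - \<Omega> \<noteq> {}"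
      using x \<open>a \<in> \<Omega>\<close> by blast+
    then have "ball a d \<inter> frontier \<Omega> \<noteq> {}" by (intro connected_Int_frontier connected_ball)
    then obtain y where y: "y \<in> frontier \<Omega>" "dist a y < d" by auto
    \<comment> \<open>The point \<open>y\<close> excludes the empty frontier, which \<open>d\<close>
      lists separately because \<open>infdist\<close> to the empty set is 0 by convention.\<close>
    then show False using d infdist_le[OF y(1), of a] by auto
  qed
qed

text \<open>Along the ray through \<open>x\<close>, the derivative of \<open>u\<close> at distance
  \<open>t\<close> is at least \<open>- C / t\<close>, so adding \<open>C ln t\<close> makes
  \<open>u\<close> nondecreasing from \<open>norm x\<close> to \<open>R\<close>.\<close>

lemma radial_growth:
  fixes u :: "'a::real_inner \<Rightarrow> real" and U :: "'a \<Rightarrow> 'a"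
  assumes du: "\<And>y. 0 < norm y \<Longrightarrow> norm y \<le> R \<Longrightarrow> (u has_derivative (\<lambda>h. U y \<bullet> h)) (at y)"
    and bound: "\<And>y. 0 < norm y \<Longrightarrow> norm y \<le> R \<Longrightarrow> norm (U y) * norm y \<le> C"
    and x: "0 < norm x" "norm x \<le> R"
  shows "u x \<le> u ((R / norm x) *\<^sub>R x) + C * ln (R / norm x)"
proof -
  define e where "e = (1 / norm x) *\<^sub>R x"
  have e: "norm e = 1" using x by (simp add: e_def)
  define g where "g t = u (0 + t *\<^sub>R e) + C * ln t" for t
  have "\<exists>y. (g has_real_derivative y) (at t) \<and> 0 \<le> y" if t: "norm x \<le> t" "t \<le> R" for t
  proof -
    have t0: "t > 0" using t x by linarith
    then have nt: "norm (t *\<^sub>R e) = t" using e by simp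
    have "((\<lambda>t. u (0 + t *\<^sub>R e)) has_real_derivative U (t *\<^sub>R e) \<bullet> e) (at t)"
      using has_derivative_along_line[of u _ 0 t e] du[of "t *\<^sub>R e"] nt t t0
      by (simp add: has_real_derivative_iff_has_vector_derivative)
    moreover have "(ln has_real_derivative 1 / t) (at t)" using t0 by (rule DERIV_ln_divide)
    ultimately have "(g has_real_derivative U (t *\<^sub>R e) \<bullet> e + C * (1 / t)) (at t)"
      unfolding g_def[abs_def] by (intro DERIV_add DERIV_cmult)
    moreover have "0 \<le> U (t *\<^sub>R e) \<bullet> e + C * (1 / t)"
    proof -
      have "norm (U (t *\<^sub>R e)) \<le> C / t" using bound[of "t *\<^sub>R e"] nt t t0 by (simp add: field_simps)
      moreover have "\<bar>U (t *\<^sub>R e) \<bullet> e\<bar> \<le> norm (U (t *\<^sub>R e))"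
        using Cauchy_Schwarz_ineq2[of "U (t *\<^sub>R e)" e] e by simp
      ultimately show ?thesis by simp
    qed
    ultimately show ?thesis by blast
  qed
  from DERIV_nonneg_imp_nondecreasing[OF x(2) this] have "g (norm x) \<le> g R" .
  moreover have "norm x *\<^sub>R e = x" "R *\<^sub>R e = (R / norm x) *\<^sub>R x" using x by (simp_all add: e_def)
  moreover have "ln (R / norm x) = ln R - ln (norm x)" 
    using x by (intro ln_divide_pos) linarith+
  ultimately show ?thesis by (simp add: g_def right_diff_distrib)
qed

text \<open>For \<open>0 < norm y \<le> R\<close> the ball of radius \<open>norm y / 2\<close> about
  \<open>y\<close> avoids 0 and stays within distance \<open>2 * R\<close> of it. Applying the
  gradient estimate there costs the factor 2 in the exponent; exponentiating the growth bound for
  \<open>ln v\<close> turns the logarithm into a power.\<close>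

lemma positive_solution_decay:
  fixes \<Omega> :: "(real ^ 'n) set" and v :: "real ^ 'n \<Rightarrow> real"
  defines "n \<equiv> real CARD('n)"
  assumes p: "p > 1" and n: "n \<ge> 2" and \<delta>: "\<delta> > 0"
    and cond: "\<And>t1 t2. t1 \<ge> 0 \<Longrightarrow> t2 \<ge> 0 \<Longrightarrow>
      (1 + (b * t1 + c * t2)\<^sup>2) / (n - 1) + ((n + 1) / (n - 1) - q / (p - 1)) * (b * t1)
        + ((n + 1) / (n - 1) - r / (p - 1)) * (c * t2) \<ge> \<delta> * (1 + (b * t1)\<^sup>2 + (c * t2)\<^sup>2)"
    and K: "bernstein_const n p q \<delta> \<le> K"
    and \<Omega>: "open \<Omega>" "ball 0 (2 * R) \<subseteq> \<Omega>"
    and C2: "C_on 2 (\<Omega> - {0}) v" and pos: "\<And>x. x \<in> \<Omega> - {0} \<Longrightarrow> v x > 0"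
    and weak: "weak_solution p b c q r (\<Omega> - {0}) v"
    and x: "x \<noteq> 0" "norm x < R"
  shows "v x \<le> (SUP y \<in> sphere 0 R. v y) * (R / norm x) powr (2 * sqrt K)"
proof -
  define S where "S = \<Omega> - {0}"
  have R: "R > 0" using x by (meson le_less_trans norm_ge_zero)
  have "open S" unfolding S_def using \<Omega>(1) by (intro open_Diff) auto
  then obtain H where H: "C2_data S v (grad v) H" using C_on_2_C2_data C2 S_def by blast
  define u where "u x = ln (v x)" for x
  define U where "U x = (1 / v x) *\<^sub>R grad v x" for x
  define L :: "real ^ 'n \<Rightarrow> real ^ 'n ^ 'n" where "L x = (1 / v x) *\<^sub>R H x - (\<chi> i j. U x $ i * U x $ j)" for x
  have posS: "v x > 0" if "x \<in> S" for x using pos that by (simp add: S_def)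
  have C2u: "C2_data S u U L"
    using C2_data_ln[OF H posS] unfolding u_def[abs_def] L_def[abs_def] U_def[abs_def] .
  have pde: "trace (L x) + (p - 2) * (U x \<bullet> (L x *v U x)) / (U x \<bullet> U x)
       = - (p - 1) * (U x \<bullet> U x) - b * exp ((q - p + 1) * u x) * (U x \<bullet> U x) powr ((q - p + 2) / 2)
         - c * exp ((r - p + 1) * u x) * (U x \<bullet> U x) powr ((2 - p) / 2)"
    if "x \<in> S" "U x \<noteq> 0" for x
  proof -
    have g: "grad v x \<noteq> 0" using that(2) by (auto simp: U_def)
    show ?thesis
      unfolding L_def U_def u_def
      by (rule log_equation[OF posS[OF that(1)] g])
        (rule weak_solution_pointwise[OF H posS weak[folded S_def] that(1) g])
  qed
  have bound: "norm (U y) * norm y \<le> 2 * sqrt K" if y: "0 < norm y" "norm y \<le> R" for y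
  proof -
    have "cball y (norm y / 2) \<subseteq> S"
    proof
      fix w assume "w \<in> cball y (norm y / 2)"
      then have w: "norm (y - w) \<le> norm y / 2" by (simp add: dist_norm)
      have "norm w < 2 * R"
        using norm_triangle_ineq[of "w - y" y] w y R by (simp add: norm_minus_commute)
      moreover have "w \<noteq> 0" using w y by auto
      ultimately show "w \<in> S" using \<Omega>(2) by (auto simp: S_def)
    qed
    then have "(norm (U y) * (norm y / 2))\<^sup>2 \<le> bernstein_const n p q \<delta>"
      unfolding n_def using n \<delta> p y pde cond unfolding n_def
      by (intro log_gradient_bound[OF C2u]) auto
    then have "norm (U y) * (norm y / 2) \<le> sqrt K"
      using K by (intro real_le_rsqrt) linarith
    then show ?thesis by simp
  qed
  have inS: "y \<in> S" if "0 < norm y" "norm y \<le> R" for y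
    using \<Omega>(2) that R by (auto simp: S_def)
  let ?y = "(R / norm x) *\<^sub>R x"
  have y: "norm ?y = R" using x R by simp
  have "u x \<le> u ?y + 2 * sqrt K * ln (R / norm x)"
    by (rule radial_growth[of R u U, OF C2_dataD(5)[OF C2u inS] bound]) (use x in auto)
  then have "exp (u x) \<le> exp (u ?y + 2 * sqrt K * ln (R / norm x))" by simp
  moreover have "exp (u x) = v x" "exp (u ?y) = v ?y"
    using posS[OF inS] x y R by (simp_all add: u_def)
  moreover have "exp (2 * sqrt K * ln (R / norm x)) = (R / norm x) powr (2 * sqrt K)"
    using x R by (simp add: powr_def)
  ultimately have 1: "v x \<le> v ?y * (R / norm x) powr (2 * sqrt K)" by (simp add: exp_add)
  \<comment> \<open>Only for a bounded set does the supremum dominate the value at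
    \<open>?y\<close>; boundedness follows from compactness of the sphere.\<close>
  have "bdd_above (v ` sphere 0 R)"
  proof (intro bounded_imp_bdd_above compact_imp_bounded compact_continuous_image)
    show "continuous_on (sphere 0 R) v"
      using C2_dataD(4)[OF H] inS R by (auto intro!: continuous_on_subset[where s=S])
  qed auto
  then have "v ?y \<le> (SUP y \<in> sphere 0 R. v y)"
    by (rule cSUP_upper2) (use y in auto)
  then have "v ?y * (R / norm x) powr (2 * sqrt K) \<le> (SUP y \<in> sphere 0 R. v y) * (R / norm x) powr (2 * sqrt K)"
    by (intro mult_right_mono) auto
  with 1 show ?thesis by linarith
qed

theorem corollary1p7:
  fixes p q r :: real
  assumes "CARD('n::finite) \<ge> 2" and "p > 1"
  shows "\<exists>C::real. \<forall>b c :: real.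
    b * c \<ge> 0 \<and> (b, c, q, r) \<in> W1 CARD('n) p \<union> W2 CARD('n) p \<union> W3 CARD('n) p \<union> W4 CARD('n) p \<longrightarrow>
    (\<forall>(\<Omega> :: (real ^ 'n) set) (R :: real) (v :: real ^ 'n \<Rightarrow> real).
       open \<Omega> \<and> connected \<Omega> \<and> 0 \<in> \<Omega> \<and>
       R > 0 \<and> (frontier \<Omega> = {} \<or> infdist 0 (frontier \<Omega>) \<ge> 2 * R) \<and>
       C_on 2 (\<Omega> - {0}) v \<and> (\<forall>x \<in> \<Omega> - {0}. v x > 0) \<and>
       weak_solution p b c q r (\<Omega> - {0}) v \<longrightarrow>
       (\<forall>x \<in> ball 0 R - {0}. v x \<le> (SUP y \<in> sphere 0 R. v y) * (R / norm x) powr C))"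
proof -
  define n where "n = real CARD('n)"
  define \<alpha> where "\<alpha> = (n + 1) / (n - 1) - q / (p - 1)"
  define \<beta> where "\<beta> = (n + 1) / (n - 1) - r / (p - 1)"
  define \<Delta> where "\<Delta> = {1 / (n - 1), 1 / (n - 1) - \<bar>\<beta>\<bar> / 2, 1 / (n - 1) - \<bar>\<alpha>\<bar> / 2,
    1 / (n - 1) - sqrt (\<alpha>\<^sup>2 + \<beta>\<^sup>2) / 2}"
  \<comment> \<open>The maximum over all four candidates fixes the exponent before \<open>b\<close>
    and \<open>c\<close> are chosen. Candidates that are not positive can only enlarge it; the
    estimate is applied with a positive one.\<close>
  define K where "K = Max (bernstein_const n p q ` \<Delta>)"
  have n: "n \<ge> 2" using assms(1) by (simp add: n_def)
  have K: "bernstein_const n p q \<delta> \<le> K" if "\<delta> \<in> \<Delta>" for \<delta>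
    unfolding K_def using that by (intro Max_ge) (auto simp: \<Delta>_def)
  show ?thesis
  proof (intro exI[of _ "2 * sqrt K"] allI impI ballI; elim conjE)
    fix b c R :: real and \<Omega> :: "(real ^ 'n) set" and v :: "real ^ 'n \<Rightarrow> real" and x :: "real ^ 'n"
    assume bc: "b * c \<ge> 0" and W: "(b, c, q, r) \<in> W1 CARD('n) p \<union> W2 CARD('n) p \<union> W3 CARD('n) p \<union> W4 CARD('n) p"
      and \<Omega>: "open \<Omega>" "0 \<in> \<Omega>" "frontier \<Omega> = {} \<or> infdist 0 (frontier \<Omega>) \<ge> 2 * R"
      and v: "C_on 2 (\<Omega> - {0}) v" "\<forall>x \<in> \<Omega> - {0}. v x > 0" "weak_solution p b c q r (\<Omega> - {0}) v"
      and x: "x \<in> ball 0 R - {0}"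
    obtain \<delta> where \<delta>: "\<delta> \<in> \<Delta>" "\<delta> > 0" "\<And>t1 t2. t1 \<ge> 0 \<Longrightarrow> t2 \<ge> 0 \<Longrightarrow>
      \<delta> * (1 + (b * t1)\<^sup>2 + (c * t2)\<^sup>2) \<le> (1 + (b * t1 + c * t2)\<^sup>2) / (n - 1) + \<alpha> * (b * t1) + \<beta> * (c * t2)"
      using subcritical_constant[OF assms(1) bc W] unfolding \<Delta>_def \<alpha>_def \<beta>_def n_def by blast
    have "ball 0 (2 * R) \<subseteq> \<Omega>" by (rule ball_subset_of_frontier_dist[OF \<Omega>(2,3)])
    then show "v x \<le> (SUP y \<in> sphere 0 R. v y) * (R / norm x) powr (2 * sqrt K)"
      using v(2) x
      by (intro positive_solution_decay[OF assms(2) n[unfolded n_def] \<delta>(2)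
            \<delta>(3)[unfolded \<alpha>_def \<beta>_def n_def] K[OF \<delta>(1), unfolded n_def] \<Omega>(1) _ v(1) _ v(3)]) auto
  qed
qed

end
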